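(* Let $\mathfrak o$ be a compact discrete valuation ring with residue field cardinality $q$, let $n\ge1$, and write $T=q^{-s}$. Then, as rational functions in $T$, $$\zeta_{\mathfrak h_n(\mathfrak o)}(s)=\sum_{r=0}^{n}\frac{1}{1-q^{\,2n+\frac{r(2n+1-r)}{2}}\,T^{n+1}}\cdot\frac{(-q)^r(1-q^{2n-2r+1})(q^2;q^2)_n}{(q;q)_{2n-r+1}\,(q;q)_r\,(q^{r}T;q^{2})_{n-r}\,(q^{2n-r}T;q)_{r}}.$$
   Context: A compact discrete valuation ring is a complete discrete valuation ring with finite residue field. Heisenberg algebra: $\mathfrak h_n(\mathfrak o)$ is the $\mathfrak o$-Lie algebra that is free as an $\mathfrak o$-module on $x_1,\dots,x_{2n},y$, with bracket determined by $[x_{2i-1},x_{2i}]=y$ for $i=1,\dots,n$; all brackets of basis elements not implied by these (via antisymmetry) vanish. Zeta function: $\zeta_{\mathfrak h_n(\mathfrak o)}(s)=\sum_{i\ge0}a_{q^i}\,q^{-is}$, where $a_{q^i}$ is the number of $\mathfrak o$-Lie subalgebras ($\mathfrak o$-submodules closed under the bracket) of $\mathfrak h_n(\mathfrak o)$ of additive index $q^i$. It is a rational function in $T=q^{-s}$ (the identity may equivalently be read as one of formal power series in $T$). Pochhammer symbol: $(a;Q)_m=\prod_{i=0}^{m-1}(1-aQ^i)$ for $m\ge0$. *)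

theory Defs
  imports
    "HOL-Algebra.Algebra"
    "HOL-Computational_Algebra.Formal_Power_Series"
begin

section \<open>Compact discrete valuation rings\<close>

locale discrete_valuation_ring = principal_domain R for R (structure) +
  assumes ex1_maximal: "\<exists>!M. maximalideal M R \<and> M \<noteq> {\<zero>}"

definition max_ideal :: "('a, 'm) ring_scheme \<Rightarrow> 'a set" where
  "max_ideal R = (THE M. maximalideal M R \<and> M \<noteq> {\<zero>\<^bsub>R\<^esub>})"

definition residue_field :: "('a, 'm) ring_scheme \<Rightarrow> 'a set ring" where
  "residue_field R = R Quot (max_ideal R)"

definition adic_Cauchy :: "('a, 'm) ring_scheme \<Rightarrow> 'a set \<Rightarrow> (nat \<Rightarrow> 'a) \<Rightarrow> bool" where
  "adic_Cauchy R I f \<longleftrightarrow>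
     (\<forall>k::nat. \<exists>N. \<forall>i\<ge>N. \<forall>j\<ge>N. f i \<ominus>\<^bsub>R\<^esub> f j \<in> I [^]\<^bsub>ideals_set R\<^esub> k)"

definition adic_tendsto :: "('a, 'm) ring_scheme \<Rightarrow> 'a set \<Rightarrow> (nat \<Rightarrow> 'a) \<Rightarrow> 'a \<Rightarrow> bool" where
  "adic_tendsto R I f l \<longleftrightarrow> (\<forall>k::nat. \<exists>N. \<forall>i\<ge>N. f i \<ominus>\<^bsub>R\<^esub> l \<in> I [^]\<^bsub>ideals_set R\<^esub> k)"

locale compact_dvr = discrete_valuation_ring +
  assumes complete:
    "\<lbrakk> f \<in> UNIV \<rightarrow> carrier R; adic_Cauchy R (max_ideal R) f \<rbrakk>
       \<Longrightarrow> \<exists>l \<in> carrier R. adic_tendsto R (max_ideal R) f l"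
    and finite_residue_field: "finite (carrier (residue_field R))"


section \<open>Lie algebras and their subalgebras\<close>

text \<open>
  A Lie algebra over \<open>R\<close> is represented by a \<open>module\<close> record whose multiplication is the Lie
  bracket. The \<open>one\<close> field carries no meaning.
\<close>

locale lie_algebra = module +
  assumes bracket_closed:
    "\<lbrakk> u \<in> carrier M; v \<in> carrier M \<rbrakk> \<Longrightarrow> u \<otimes>\<^bsub>M\<^esub> v \<in> carrier M"
  and bracket_add_left:
    "\<lbrakk> u \<in> carrier M; v \<in> carrier M; w \<in> carrier M \<rbrakk>
       \<Longrightarrow> (u \<oplus>\<^bsub>M\<^esub> v) \<otimes>\<^bsub>M\<^esub> w = u \<otimes>\<^bsub>M\<^esub> w \<oplus>\<^bsub>M\<^esub> v \<otimes>\<^bsub>M\<^esub> w"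
  and bracket_add_right:
    "\<lbrakk> u \<in> carrier M; v \<in> carrier M; w \<in> carrier M \<rbrakk>
       \<Longrightarrow> w \<otimes>\<^bsub>M\<^esub> (u \<oplus>\<^bsub>M\<^esub> v) = w \<otimes>\<^bsub>M\<^esub> u \<oplus>\<^bsub>M\<^esub> w \<otimes>\<^bsub>M\<^esub> v"
  and bracket_smult_left:
    "\<lbrakk> a \<in> carrier R; u \<in> carrier M; v \<in> carrier M \<rbrakk>
       \<Longrightarrow> (a \<odot>\<^bsub>M\<^esub> u) \<otimes>\<^bsub>M\<^esub> v = a \<odot>\<^bsub>M\<^esub> (u \<otimes>\<^bsub>M\<^esub> v)"
  and bracket_smult_right:
    "\<lbrakk> a \<in> carrier R; u \<in> carrier M; v \<in> carrier M \<rbrakk>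
       \<Longrightarrow> u \<otimes>\<^bsub>M\<^esub> (a \<odot>\<^bsub>M\<^esub> v) = a \<odot>\<^bsub>M\<^esub> (u \<otimes>\<^bsub>M\<^esub> v)"
  and bracket_self: "u \<in> carrier M \<Longrightarrow> u \<otimes>\<^bsub>M\<^esub> u = \<zero>\<^bsub>M\<^esub>"
  and jacobi:
    "\<lbrakk> u \<in> carrier M; v \<in> carrier M; w \<in> carrier M \<rbrakk>
       \<Longrightarrow> u \<otimes>\<^bsub>M\<^esub> (v \<otimes>\<^bsub>M\<^esub> w) \<oplus>\<^bsub>M\<^esub> v \<otimes>\<^bsub>M\<^esub> (w \<otimes>\<^bsub>M\<^esub> u)
             \<oplus>\<^bsub>M\<^esub> w \<otimes>\<^bsub>M\<^esub> (u \<otimes>\<^bsub>M\<^esub> v) = \<zero>\<^bsub>M\<^esub>"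

definition lie_subalgebra ::
    "('a, 'm) ring_scheme \<Rightarrow> ('a, 'b, 'k) module_scheme \<Rightarrow> 'b set \<Rightarrow> bool" where
  "lie_subalgebra R L H \<longleftrightarrow> submodule H R L \<and> (\<forall>u\<in>H. \<forall>v\<in>H. u \<otimes>\<^bsub>L\<^esub> v \<in> H)"

text \<open>
  An \<open>H\<close> of infinite index has \<open>card (a_rcosets\<^bsub>L\<^esub> H) = 0\<close>, so it is not counted for any \<open>m > 0\<close>.
  For a finitely generated module over a compact discrete valuation ring there are only finitely
  many subalgebras of each index \<open>m > 0\<close>, so \<open>card\<close> below counts a finite set.
\<close>

definition subalgebras_of_index ::
    "('a, 'm) ring_scheme \<Rightarrow> ('a, 'b, 'k) module_scheme \<Rightarrow> nat \<Rightarrow> 'b set set" where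
  "subalgebras_of_index R L m = {H. lie_subalgebra R L H \<and> card (a_rcosets\<^bsub>L\<^esub> H) = m}"

text \<open>The subalgebra zeta function as a formal power series in \<open>T = q\<^sup>-\<^sup>s\<close>, where \<open>q\<close> is the
  cardinality of the residue field of \<open>R\<close>.\<close>

definition zeta_fps ::
    "('a, 'm) ring_scheme \<Rightarrow> ('a, 'b, 'k) module_scheme \<Rightarrow> rat fps" where
  "zeta_fps R L =
     Abs_fps (\<lambda>i. of_nat (card (subalgebras_of_index R L (card (carrier (residue_field R)) ^ i))))"


section \<open>The Heisenberg algebra\<close>

text \<open>
  Elements are coordinate vectors over the index set \<open>{1..2n+1}\<close>: coordinate \<open>j \<le> 2n\<close> belongs to the
  basis element \<open>x\<^sub>j\<close>, coordinate \<open>2n+1\<close> to \<open>y\<close>. The bracket is the bilinear extension of the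
  relations between the basis elements.
\<close>

definition heisenberg :: "('a, 'm) ring_scheme \<Rightarrow> nat \<Rightarrow> ('a, nat \<Rightarrow> 'a) module" where
  "heisenberg R n =
     \<lparr> carrier = {1..2*n+1} \<rightarrow>\<^sub>E carrier R,
       monoid.mult = (\<lambda>u v. \<lambda>j\<in>{1..2*n+1}.
                 if j = 2*n+1
                 then (\<Oplus>\<^bsub>R\<^esub>i\<in>{1..n}. u (2*i-1) \<otimes>\<^bsub>R\<^esub> v (2*i) \<ominus>\<^bsub>R\<^esub> u (2*i) \<otimes>\<^bsub>R\<^esub> v (2*i-1))
                 else \<zero>\<^bsub>R\<^esub>),
       one = (\<lambda>j\<in>{1..2*n+1}. \<zero>\<^bsub>R\<^esub>),
       ring.zero = (\<lambda>j\<in>{1..2*n+1}. \<zero>\<^bsub>R\<^esub>),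
       ring.add = (\<lambda>u v. \<lambda>j\<in>{1..2*n+1}. u j \<oplus>\<^bsub>R\<^esub> v j),
       smult = (\<lambda>a u. \<lambda>j\<in>{1..2*n+1}. a \<otimes>\<^bsub>R\<^esub> u j) \<rparr>"

definition heis_basis :: "('a, 'm) ring_scheme \<Rightarrow> nat \<Rightarrow> nat \<Rightarrow> nat \<Rightarrow> 'a" where
  "heis_basis R n k = (\<lambda>j\<in>{1..2*n+1}. if j = k then \<one>\<^bsub>R\<^esub> else \<zero>\<^bsub>R\<^esub>)"

lemma heisenberg_simps:
  "carrier (heisenberg R n) = {1..2*n+1} \<rightarrow>\<^sub>E carrier R"
  "u \<otimes>\<^bsub>heisenberg R n\<^esub> v = (\<lambda>j\<in>{1..2*n+1}.
     if j = 2*n+1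
     then (\<Oplus>\<^bsub>R\<^esub>i\<in>{1..n}. u (2*i-1) \<otimes>\<^bsub>R\<^esub> v (2*i) \<ominus>\<^bsub>R\<^esub> u (2*i) \<otimes>\<^bsub>R\<^esub> v (2*i-1))
     else \<zero>\<^bsub>R\<^esub>)"
  "\<zero>\<^bsub>heisenberg R n\<^esub> = (\<lambda>j\<in>{1..2*n+1}. \<zero>\<^bsub>R\<^esub>)"
  "u \<oplus>\<^bsub>heisenberg R n\<^esub> v = (\<lambda>j\<in>{1..2*n+1}. u j \<oplus>\<^bsub>R\<^esub> v j)"
  "a \<odot>\<^bsub>heisenberg R n\<^esub> u = (\<lambda>j\<in>{1..2*n+1}. a \<otimes>\<^bsub>R\<^esub> u j)"
  by (simp_all add: heisenberg_def)

context cring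
begin

lemma heisenberg_module: "module R (heisenberg R n)"
proof (rule moduleI)
  show "abelian_group (heisenberg R n)"
  proof (rule abelian_groupI)
    fix u assume u: "u \<in> carrier (heisenberg R n)"
    show "\<exists>w\<in>carrier (heisenberg R n). w \<oplus>\<^bsub>heisenberg R n\<^esub> u = \<zero>\<^bsub>heisenberg R n\<^esub>"
      using u
      by (intro bexI[of _ "\<lambda>j\<in>{1..2*n+1}. \<ominus> u j"])
         (auto simp: heisenberg_simps fun_eq_iff PiE_iff l_neg)
  qed (auto simp: heisenberg_simps fun_eq_iff PiE_iff a_assoc extensional_def intro: a_comm)
qed (auto simp: heisenberg_simps fun_eq_iff PiE_iff extensional_def is_cring l_distr r_distr m_assoc)

lemma heisenberg_lie_algebra: "lie_algebra R (heisenberg R n)"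
proof -
  let ?L = "heisenberg R n"
  interpret L: module R ?L by (rule heisenberg_module)
  define B where "B u v = (\<Oplus>i\<in>{1..n}. u (2*i-1) \<otimes> v (2*i) \<ominus> u (2*i) \<otimes> v (2*i-1))"
    for u v :: "nat \<Rightarrow> 'a"
  define Y where "Y b = (\<lambda>j\<in>{1..2*n+1}. if j = 2*n+1 then b else \<zero>)" for b
  have mult: "u \<otimes>\<^bsub>?L\<^esub> v = Y (B u v)" for u v
    by (simp only: heisenberg_simps B_def Y_def)
  have Y_closed: "Y b \<in> carrier ?L" if "b \<in> carrier R" for b
    using that by (auto simp: Y_def heisenberg_simps)
  have Y_zero: "Y \<zero> = \<zero>\<^bsub>?L\<^esub>"
    by (auto simp: Y_def heisenberg_simps)
  have Y_add: "Y b \<oplus>\<^bsub>?L\<^esub> Y c = Y (b \<oplus> c)" if "b \<in> carrier R" "c \<in> carrier R" for b c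
    using that by (auto simp: Y_def heisenberg_simps fun_eq_iff)
  have Y_smult: "a \<odot>\<^bsub>?L\<^esub> Y b = Y (a \<otimes> b)" if "a \<in> carrier R" "b \<in> carrier R" for a b
    using that by (auto simp: Y_def heisenberg_simps fun_eq_iff)
  have coord: "u k \<in> carrier R" if "u \<in> carrier ?L" "k \<in> {1..2*n+1}" for u k
    using that by (auto simp: heisenberg_simps PiE_iff)
  have term_closed: "u (2*i-1) \<otimes> v (2*i) \<ominus> u (2*i) \<otimes> v (2*i-1) \<in> carrier R"
    if "u \<in> carrier ?L" "v \<in> carrier ?L" "i \<in> {1..n}" for u v i
  proof -
    have c: "2*i-1 \<in> {1..2*n+1}" "2*i \<in> {1..2*n+1}" using that(3) by auto
    show ?thesis
      using that(1,2)[THEN coord, OF c(1)] that(1,2)[THEN coord, OF c(2)] by simp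
  qed
  have B_closed [simp]: "B u v \<in> carrier R" if "u \<in> carrier ?L" "v \<in> carrier ?L" for u v
    unfolding B_def using that by (intro finsum_closed Pi_I term_closed)
  have add_coord: "(u \<oplus>\<^bsub>?L\<^esub> v) k = u k \<oplus> v k" if "k \<in> {1..2*n+1}" for u v k
    using that by (simp add: heisenberg_simps)
  have smult_coord: "(a \<odot>\<^bsub>?L\<^esub> u) k = a \<otimes> u k" if "k \<in> {1..2*n+1}" for a u k
    using that by (simp add: heisenberg_simps)
  have B_self: "B u u = \<zero>" if u: "u \<in> carrier ?L" for u
    unfolding B_def
  proof (rule add.finprod_one_eqI)
    fix i assume "i \<in> {1..n}"
    then have c: "2*i-1 \<in> {1..2*n+1}" "2*i \<in> {1..2*n+1}" by auto
    show "u (2*i-1) \<otimes> u (2*i) \<ominus> u (2*i) \<otimes> u (2*i-1) = \<zero>"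
      using u[THEN coord, OF c(1)] u[THEN coord, OF c(2)] by algebra
  qed
  have B_add_left: "B (u \<oplus>\<^bsub>?L\<^esub> v) w = B u w \<oplus> B v w"
    if "u \<in> carrier ?L" "v \<in> carrier ?L" "w \<in> carrier ?L" for u v w
  proof -
    have "B u w \<oplus> B v w = (\<Oplus>i\<in>{1..n}. (u (2*i-1) \<otimes> w (2*i) \<ominus> u (2*i) \<otimes> w (2*i-1))
            \<oplus> (v (2*i-1) \<otimes> w (2*i) \<ominus> v (2*i) \<otimes> w (2*i-1)))"
      unfolding B_def using that by (intro add.finprod_multf [symmetric] Pi_I term_closed)
    also have "\<dots> = B (u \<oplus>\<^bsub>?L\<^esub> v) w"
      unfolding B_def
    proof (rule finsum_cong')
      fix i assume i: "i \<in> {1..n}"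
      then have c: "2*i-1 \<in> {1..2*n+1}" "2*i \<in> {1..2*n+1}" by auto
      show "(u (2*i-1) \<otimes> w (2*i) \<ominus> u (2*i) \<otimes> w (2*i-1))
            \<oplus> (v (2*i-1) \<otimes> w (2*i) \<ominus> v (2*i) \<otimes> w (2*i-1))
          = (u \<oplus>\<^bsub>?L\<^esub> v) (2*i-1) \<otimes> w (2*i) \<ominus> (u \<oplus>\<^bsub>?L\<^esub> v) (2*i) \<otimes> w (2*i-1)"
        unfolding add_coord[OF c(1)] add_coord[OF c(2)]
        using that[THEN coord, OF c(1)] that[THEN coord, OF c(2)] by algebra
    qed (use that in \<open>auto intro!: term_closed simp del: One_nat_def\<close>)
    finally show ?thesis by simp
  qed
  have B_smult_left: "B (a \<odot>\<^bsub>?L\<^esub> u) v = a \<otimes> B u v"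
    if a: "a \<in> carrier R" and uv: "u \<in> carrier ?L" "v \<in> carrier ?L" for a u v
  proof -
    have "a \<otimes> B u v = (\<Oplus>i\<in>{1..n}. a \<otimes> (u (2*i-1) \<otimes> v (2*i) \<ominus> u (2*i) \<otimes> v (2*i-1)))"
      unfolding B_def using that by (intro finsum_rdistr Pi_I term_closed) auto
    also have "\<dots> = B (a \<odot>\<^bsub>?L\<^esub> u) v"
      unfolding B_def
    proof (rule finsum_cong')
      fix i assume i: "i \<in> {1..n}"
      then have c: "2*i-1 \<in> {1..2*n+1}" "2*i \<in> {1..2*n+1}" by auto
      show "a \<otimes> (u (2*i-1) \<otimes> v (2*i) \<ominus> u (2*i) \<otimes> v (2*i-1))
          = (a \<odot>\<^bsub>?L\<^esub> u) (2*i-1) \<otimes> v (2*i) \<ominus> (a \<odot>\<^bsub>?L\<^esub> u) (2*i) \<otimes> v (2*i-1)"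
        unfolding smult_coord[OF c(1)] smult_coord[OF c(2)]
        using a uv[THEN coord, OF c(1)] uv[THEN coord, OF c(2)] by algebra
    qed (use that in \<open>auto intro!: term_closed simp del: One_nat_def\<close>)
    finally show ?thesis by simp
  qed
  have B_swap: "B v u = \<ominus> B u v" if uv: "u \<in> carrier ?L" "v \<in> carrier ?L" for u v
  proof -
    have "B u v \<oplus> B v u = (\<Oplus>i\<in>{1..n}. (u (2*i-1) \<otimes> v (2*i) \<ominus> u (2*i) \<otimes> v (2*i-1))
            \<oplus> (v (2*i-1) \<otimes> u (2*i) \<ominus> v (2*i) \<otimes> u (2*i-1)))"
      unfolding B_def using that by (intro add.finprod_multf [symmetric] Pi_I term_closed)
    also have "\<dots> = \<zero>"
    proof (rule add.finprod_one_eqI)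
      fix i assume "i \<in> {1..n}"
      then have c: "2*i-1 \<in> {1..2*n+1}" "2*i \<in> {1..2*n+1}" by auto
      show "(u (2*i-1) \<otimes> v (2*i) \<ominus> u (2*i) \<otimes> v (2*i-1))
            \<oplus> (v (2*i-1) \<otimes> u (2*i) \<ominus> v (2*i) \<otimes> u (2*i-1)) = \<zero>"
        using uv[THEN coord, OF c(1)] uv[THEN coord, OF c(2)] by algebra
    qed
    finally show ?thesis using that by (metis B_closed minus_equality a_comm)
  qed
  have B_add_right: "B w (u \<oplus>\<^bsub>?L\<^esub> v) = B w u \<oplus> B w v"
    if "u \<in> carrier ?L" "v \<in> carrier ?L" "w \<in> carrier ?L" for u v w
    using that B_add_left[OF that] B_swap[of "u \<oplus>\<^bsub>?L\<^esub> v" w] B_swap[of u w] B_swap[of v w]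
    by (simp add: minus_add)
  have B_smult_right: "B u (a \<odot>\<^bsub>?L\<^esub> v) = a \<otimes> B u v"
    if "a \<in> carrier R" "u \<in> carrier ?L" "v \<in> carrier ?L" for a u v
    using that B_smult_left[of a v u] B_swap[of "a \<odot>\<^bsub>?L\<^esub> v" u] B_swap[of v u]
    by (simp add: r_minus)
  have B_center: "B u (v \<otimes>\<^bsub>?L\<^esub> w) = \<zero>" if "u \<in> carrier ?L" for u v w
    unfolding B_def
  proof (rule add.finprod_one_eqI)
    fix i assume i: "i \<in> {1..n}"
    then have "(v \<otimes>\<^bsub>?L\<^esub> w) (2*i-1) = \<zero>" "(v \<otimes>\<^bsub>?L\<^esub> w) (2*i) = \<zero>"
      by (auto simp: mult Y_def)
    moreover have "u (2*i-1) \<in> carrier R" "u (2*i) \<in> carrier R"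
      by (rule coord[OF that]; use i in force)+
    ultimately show "u (2*i-1) \<otimes> (v \<otimes>\<^bsub>?L\<^esub> w) (2*i) \<ominus> u (2*i) \<otimes> (v \<otimes>\<^bsub>?L\<^esub> w) (2*i-1) = \<zero>"
      by (simp add: minus_eq)
  qed
  have center: "u \<otimes>\<^bsub>?L\<^esub> (v \<otimes>\<^bsub>?L\<^esub> w) = \<zero>\<^bsub>?L\<^esub>" if "u \<in> carrier ?L" for u v w
    unfolding mult[of u "v \<otimes>\<^bsub>?L\<^esub> w"] B_center[OF that] by (rule Y_zero)
  show ?thesis
    by unfold_locales
      (simp_all add: mult Y_closed Y_add Y_smult Y_zero center[unfolded mult]
        B_add_left B_add_right B_smult_left B_smult_right B_self)
qed

lemma heis_basis_bracket:
  assumes "j \<in> {1..2*n+1}" "k \<in> {1..2*n+1}" "j < k"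
  shows "heis_basis R n j \<otimes>\<^bsub>heisenberg R n\<^esub> heis_basis R n k =
    (if odd j \<and> k = j + 1 \<and> k \<le> 2*n then heis_basis R n (2*n+1) else \<zero>\<^bsub>heisenberg R n\<^esub>)"
proof -
  have "(\<Oplus>i\<in>{1..n}. heis_basis R n j (2*i-1) \<otimes> heis_basis R n k (2*i) \<ominus>
          heis_basis R n j (2*i) \<otimes> heis_basis R n k (2*i-1)) =
        (\<Oplus>i\<in>{1..n}. if i = k div 2 then
           (if odd j \<and> k = j + 1 \<and> k \<le> 2*n then \<one> else \<zero>) else \<zero>)"
  proof (rule finsum_cong')
    fix i assume i: "i \<in> {1..n}"
    have e: "heis_basis R n m l = (if l = m then \<one> else \<zero>)" if "l \<in> {1..2*n+1}" for m l
      using that by (simp add: heis_basis_def)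
    have range: "2*i-1 \<in> {1..2*n+1}" "2*i \<in> {1..2*n+1}" using i by auto
    have iff: "(2*i-1 = j \<and> 2*i = k) \<longleftrightarrow> (i = k div 2 \<and> odd j \<and> k = j + 1 \<and> k \<le> 2*n)"
    proof
      assume "2*i-1 = j \<and> 2*i = k"
      then have "j = 2*i-1" "k = 2*i" by auto
      then show "i = k div 2 \<and> odd j \<and> k = j + 1 \<and> k \<le> 2*n" using i by auto
    next
      assume "i = k div 2 \<and> odd j \<and> k = j + 1 \<and> k \<le> 2*n"
      then show "2*i-1 = j \<and> 2*i = k" by (auto elim!: oddE)
    qed
    have "\<not> (2*i = j \<and> 2*i-1 = k)" using assms(3) by auto
    then have "heis_basis R n j (2*i-1) \<otimes> heis_basis R n k (2*i) \<ominus>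
        heis_basis R n j (2*i) \<otimes> heis_basis R n k (2*i-1) =
        (if 2*i-1 = j \<and> 2*i = k then \<one> else \<zero>)"
      unfolding e[OF range(1)] e[OF range(2)] by (auto simp: minus_eq)
    then show "heis_basis R n j (2*i-1) \<otimes> heis_basis R n k (2*i) \<ominus>
        heis_basis R n j (2*i) \<otimes> heis_basis R n k (2*i-1) =
        (if i = k div 2 then
           (if odd j \<and> k = j + 1 \<and> k \<le> 2*n then \<one> else \<zero>) else \<zero>)"
      unfolding iff by simp
  qed auto
  also have "\<dots> = (if odd j \<and> k = j + 1 \<and> k \<le> 2*n then \<one> else \<zero>)"
  proof (cases "odd j \<and> k = j + 1 \<and> k \<le> 2*n")
    case True
    then have "k div 2 \<in> {1..n}" by (auto elim!: oddE)
    then show ?thesis using True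
      by (subst add.finprod_singleton_swap) auto
  qed (auto intro: add.finprod_one_eqI)
  finally show ?thesis
    by (auto simp: heisenberg_simps heis_basis_def fun_eq_iff)
qed

end


section \<open>q-Pochhammer symbols\<close>

definition qpochhammer :: "'a::comm_ring_1 \<Rightarrow> 'a \<Rightarrow> nat \<Rightarrow> 'a" where
  "qpochhammer a Q m = (\<Prod>i<m. 1 - a * Q ^ i)"

end

theory Submission
  imports Defs "HOL-Computational_Algebra.Polynomial_FPS"
begin

text \<open>
  Write \<open>V\<close> for the span of the \<open>x\<^sub>i\<close> and \<open>w\<close> for the alternating form on \<open>V\<close> with
  \<open>[u, v] = w(u, v) y\<close>; let \<open>p\<close> be a uniformizer. A submodule \<open>H\<close> of finite index has a projection
  \<open>\<Lambda>\<close> to \<open>V\<close> and meets the line of \<open>y\<close> in \<open>p^k y\<close> for some \<open>k\<close>. It is a subalgebra if and only if \<open>w\<close>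
  takes values in \<open>p^k\<close> on \<open>\<Lambda>\<close> (we then say that \<open>\<Lambda>\<close> has level \<open>k\<close>), and its index is
  \<open>[V : \<Lambda>] q^k\<close>. For fixed \<open>\<Lambda>\<close> and \<open>k\<close> the possible \<open>H\<close> are the graphs of the homomorphisms from
  \<open>\<Lambda>\<close> to \<open>R/p^k\<close>, and there are \<open>q^(2nk)\<close> of them because \<open>\<Lambda>\<close> is free of rank \<open>2n\<close>
  (\<open>card_lifts\<close>). So the zeta function is \<open>\<Sum>\<^sub>k (q^(2n) T)^k Z\<^sub>k(T)\<close>, where \<open>Z\<^sub>k\<close> counts the
  sublattices of level \<open>k\<close> in \<open>V\<close> by their index.

  The series \<open>Z\<^sub>k\<close> satisfy a recursion in \<open>k\<close>, provided that \<open>V\<close> is replaced by any lattice \<open>U\<close> on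
  which \<open>p^-k w\<close> is integral with elementary divisors \<open>1\<close> (\<open>2d\<close> times) and \<open>p\<close> (\<open>2(n-d)\<close> times).
  A sublattice of \<open>U\<close> of level \<open>k+1\<close> has an isotropic image in the symplectic space of dimension
  \<open>2d\<close> over the residue field obtained from \<open>U\<close> by dividing out the radical modulo \<open>p\<close>. A Moebius
  inversion over the isotropic subspaces, with weight \<open>(-1)^e q^(e^2)\<close> in dimension \<open>d - e\<close>, reduces
  the count to that of sublattices of the preimages of these subspaces (\<open>moebius\<close>), and on such a
  preimage \<open>p^-(k+1) w\<close> is again of the above kind, with \<open>n - e\<close> in place of \<open>d\<close> (\<open>good_step\<close>).
  Hence the vector of the series for \<open>d = 0, ..., n\<close> is multiplied by a fixed matrix when \<open>k\<close>
  increases by one (\<open>card_level_subs\<close>); for \<open>k = 0\<close> all entries are \<open>1/(T;q)\<^sub>2\<^sub>n\<close>.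

  It remains to diagonalize that matrix. Row vectors are encoded as polynomials of degree at most
  \<open>n\<close> in \<open>T\<close>. The action on them commutes with a tridiagonal operator that expresses a first-order
  \<open>q^2\<close>-difference equation; its solutions \<open>(T;q)\<^sub>r (q^(r+1) T; q^2)\<^sub>n\<^sub>-\<^sub>r\<close> are therefore eigenvectors,
  and comparing leading coefficients gives the eigenvalues \<open>q^(r(2n+1-r)/2)\<close> (\<open>transfer_eigen\<close>).
  The row vector that selects the entry \<open>d = n\<close> is the polynomial \<open>1\<close>. Its expansion in the
  eigenvectors (\<open>eigen_expansion\<close>) holds because the sum of the weighted eigenvectors is invariant
  under \<open>T \<mapsto> qT\<close>, hence constant. The weights of this expansion and the geometric series in \<open>k\<close>
  give the summands of the theorem (\<open>generating_function\<close>).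
\<close>

section \<open>Counting isotropic subspaces\<close>

lemma qpochhammer_0 [simp]: "qpochhammer a Q 0 = 1"
  by (simp add: qpochhammer_def)

lemma qpochhammer_Suc: "qpochhammer a Q (Suc m) = qpochhammer a Q m * (1 - a * Q ^ m)"
  by (simp add: qpochhammer_def)

lemma qpochhammer_Suc_left: "qpochhammer a Q (Suc m) = (1 - a) * qpochhammer (a * Q) Q m"
  unfolding qpochhammer_def by (subst prod.lessThan_Suc_shift) (simp add: mult.assoc)

lemma qpochhammer_add: "qpochhammer a Q (l + m) = qpochhammer a Q l * qpochhammer (a * Q ^ l) Q m"
  by (induct m) (simp_all add: qpochhammer_Suc power_add mult.assoc)

lemma qpochhammer_nonzero:
  fixes Q :: rat assumes "Q > 1" shows "qpochhammer Q Q m \<noteq> 0"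
proof -
  have "Q * Q ^ i \<noteq> 1" for i using one_less_power[OF assms, of "Suc i"] by simp
  then show ?thesis by (simp add: qpochhammer_def)
qed

text \<open>
  The number of isotropic subspaces of dimension \<open>a - e\<close> in a symplectic space of dimension \<open>2a\<close>
  over a field with \<open>Q\<close> elements.
\<close>

definition iso_count :: "rat \<Rightarrow> nat \<Rightarrow> nat \<Rightarrow> rat" where
  "iso_count Q a e = (if e \<le> a then qpochhammer (Q\<^sup>2) (Q\<^sup>2) a / (qpochhammer (Q\<^sup>2) (Q\<^sup>2) e * qpochhammer Q Q (a - e)) else 0)"

text \<open>
  Isotropic subspaces counted with the weight of the Moebius inversion; as a matrix in \<open>d\<close> and
  \<open>n - e\<close> these numbers describe the passage from one level to the next, up to powers of \<open>T\<close>.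
\<close>

definition mob_count :: "rat \<Rightarrow> nat \<Rightarrow> nat \<Rightarrow> rat" where
  "mob_count Q d e = (- 1) ^ e * Q ^ e\<^sup>2 * iso_count Q d e"

text \<open>
  A separate name for the index shift keeps natural subtraction out of the recurrences at \<open>e = 0\<close>.
\<close>

definition mob_count_prev :: "rat \<Rightarrow> nat \<Rightarrow> nat \<Rightarrow> rat" where
  "mob_count_prev Q d e = (if e = 0 then 0 else mob_count Q d (e - 1))"

context fixes Q :: rat assumes Q: "Q > 1"
begin

lemma Qpow_neq: "m > 0 \<Longrightarrow> Q ^ m \<noteq> 1"
  using one_less_power[OF Q, of m] by simp

lemma Q_square_gt_1: "Q\<^sup>2 > 1" using one_less_power[OF Q, of 2] by simp

lemma iso_count_self [simp]: "iso_count Q a a = 1"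
  using qpochhammer_nonzero[OF Q_square_gt_1] by (simp add: iso_count_def)

lemma iso_count_gt [simp]: "e > a \<Longrightarrow> iso_count Q a e = 0"
  by (simp add: iso_count_def)

lemma iso_count_Suc: "e \<le> a \<Longrightarrow> iso_count Q (Suc a) e * (1 - Q ^ (Suc a - e)) = (1 - Q ^ (2 * Suc a)) * iso_count Q a e"
proof -
  assume e: "e \<le> a"
  have 1: "qpochhammer Q Q (Suc a - e) = qpochhammer Q Q (a - e) * (1 - Q ^ (Suc a - e))"
    using e by (simp add: Suc_diff_le qpochhammer_Suc)
  have 2: "qpochhammer (Q\<^sup>2) (Q\<^sup>2) (Suc a) = qpochhammer (Q\<^sup>2) (Q\<^sup>2) a * (1 - Q ^ (2 * Suc a))"
    by (simp add: qpochhammer_Suc power_mult[symmetric] power_add[symmetric])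
  have nz: "1 - Q ^ (Suc a - e) \<noteq> 0" using Qpow_neq[of "Suc a - e"] e by auto
  have key: "(A * y) / (B * (C * z)) * z = y * (A / (B * C))" if "z \<noteq> 0" for A y B C z :: rat using that by simp
  have "e \<le> Suc a" using e by simp
  then show ?thesis unfolding iso_count_def using e by (simp only: 1 2 if_True key[OF nz])
qed

lemma mob_count_gt [simp]: "e > d \<Longrightarrow> mob_count Q d e = 0"
  by (simp add: mob_count_def)

lemma mob_count_self: "mob_count Q d d = (- 1) ^ d * Q ^ d\<^sup>2"
  by (simp add: mob_count_def)

lemma mob_count_ratio: "mob_count Q (e + j) (Suc e) * (1 - Q ^ (2 * Suc e)) = - (Q ^ (2 * e + 1)) * (1 - Q ^ j) * mob_count Q (e + j) e"
proof (cases j)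
  case (Suc i)
  have 1: "qpochhammer Q Q (Suc i) = qpochhammer Q Q i * (1 - Q ^ Suc i)" by (simp add: qpochhammer_Suc)
  have 2: "qpochhammer (Q\<^sup>2) (Q\<^sup>2) (Suc e) = qpochhammer (Q\<^sup>2) (Q\<^sup>2) e * (1 - Q ^ (2 * Suc e))"
    by (simp add: qpochhammer_Suc power_mult[symmetric] power_add[symmetric])
  have nz: "1 - Q ^ Suc i \<noteq> 0" "1 - Q ^ (2 * Suc e) \<noteq> 0" using Qpow_neq[of "Suc i"] Qpow_neq[of "2 * Suc e"] by auto
  have a: "iso_count Q (e + Suc i) (Suc e) * (1 - Q ^ (2 * Suc e)) = iso_count Q (e + Suc i) e * (1 - Q ^ Suc i)"
  proof -
    have key: "A / ((B * y) * C) * y = A / (B * (C * z)) * z" if "z \<noteq> 0" "y \<noteq> 0" for A y B C z :: rat using that by simp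
    have "Suc e \<le> e + Suc i" "e \<le> e + Suc i" "e + Suc i - Suc e = i" "e + Suc i - e = Suc i" by simp_all
    then show ?thesis unfolding iso_count_def by (simp only: 1 2 if_True key[OF nz])
  qed
  have "(Suc e)\<^sup>2 = e\<^sup>2 + (2 * e + 1)" by (simp add: power2_eq_square)
  then have b: "(- 1) ^ Suc e * Q ^ (Suc e)\<^sup>2 = - ((-1) ^ e * Q ^ e\<^sup>2 * Q ^ (2 * e + 1))"
    by (simp add: power_add)
  have key: "- (c * x) * N * z = - x * y * (c * N')" if "N * z = N' * y" for c x y z N N' :: rat
    using that by Groebner_Basis.algebra
  show ?thesis unfolding mob_count_def Suc b by (rule key[OF a])
qed simp

lemma mob_count_Suc: "mob_count Q (Suc (e + j)) e * (1 - Q ^ Suc j) = (1 - Q ^ (2 * Suc (e + j))) * mob_count Q (e + j) e"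
proof -
  have "Suc (e + j) - e = Suc j" by simp
  then have "iso_count Q (Suc (e + j)) e * (1 - Q ^ Suc j) = (1 - Q ^ (2 * Suc (e + j))) * iso_count Q (e + j) e"
    using iso_count_Suc[of e "e + j"] by (simp only: le_add1)
  then have "(- 1) ^ e * Q ^ e\<^sup>2 * (iso_count Q (Suc (e + j)) e * (1 - Q ^ Suc j)) = (- 1) ^ e * Q ^ e\<^sup>2 * ((1 - Q ^ (2 * Suc (e + j))) * iso_count Q (e + j) e)"
    by (rule arg_cong)
  then show ?thesis unfolding mob_count_def by (simp only: mult_ac)
qed

lemma mob_count_prev_ratio: "mob_count Q (e + j) e * (1 - Q ^ (2 * e)) * Q = - (Q ^ (2 * e)) * (1 - Q ^ Suc j) * mob_count_prev Q (e + j) e"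
proof (cases e)
  case (Suc i)
  have 1: "Q ^ (2 * Suc i) = Q ^ (2 * i + 1) * Q" by simp
  have 2: "mob_count_prev Q (e + j) e = mob_count Q (i + Suc j) i" "mob_count Q (e + j) e = mob_count Q (i + Suc j) (Suc i)" by (simp_all add: Suc mob_count_prev_def)
  have key: "a * (1 - x * Q) * Q = - (x * Q) * y * b" if "a * (1 - x * Q) = - x * y * b" for a b x y :: rat
    using that by Groebner_Basis.algebra
  show ?thesis unfolding 2 unfolding Suc 1 by (rule key[OF mob_count_ratio[of i "Suc j", unfolded 1]])
qed (simp add: mob_count_prev_def)

text \<open>
  This recurrence and the next one express that \<open>transfer_op\<close> and \<open>qdiff_op\<close> below commute: up to
  powers of \<open>Q\<close> they are the parts of that statement which are free of \<open>Q^(2n)\<close> and proportional to it.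
  For \<open>e \<le> d\<close> all terms are rational multiples of \<open>mob_count Q d e\<close>, by the ratios above.
\<close>

lemma mob_count_rec1:
  "Q * (Q ^ (2 * Suc e) - 1) * mob_count Q d (Suc e) - (1 + Q) * Q * Q ^ (2 * e) * mob_count Q d e + Q ^ (2 * e) * mob_count_prev Q d e
    = - Q * mob_count Q (Suc d) e"
proof -
  consider "e > Suc d" | "e = Suc d" | j where "d = e + j" by (metis le_Suc_ex not_less_eq less_linear le_less)
  then show ?thesis
  proof cases
    case 1 then show ?thesis by (simp add: mob_count_prev_def)
  next
    case 2
    have "(Suc d)\<^sup>2 = d\<^sup>2 + (2 * d + 1)" by (simp add: power2_eq_square)
    then show ?thesis using 2 by (simp add: mob_count_prev_def mob_count_self power_add power2_eq_square mult_2)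
  next
    case 3
    define x y where "x = Q ^ e" and "y = Q ^ j"
    let ?p = "mob_count Q d e" and ?s = "mob_count Q d (Suc e)" and ?m = "mob_count_prev Q d e" and ?t = "mob_count Q (Suc d) e"
    have r1: "?s * (1 - x\<^sup>2 * Q\<^sup>2) = - (x\<^sup>2 * Q) * (1 - y) * ?p"
      using mob_count_ratio[of e j] 3 unfolding x_def y_def by (simp add: power_mult power_mult_distrib power2_eq_square power_add mult_ac)
    have r2: "?t * (1 - y * Q) = (1 - x\<^sup>2 * y\<^sup>2 * Q\<^sup>2) * ?p"
      using mob_count_Suc[of e j] 3 unfolding x_def y_def by (simp add: power_mult power_mult_distrib power2_eq_square power_add mult_ac)
    have r3: "?p * (1 - x\<^sup>2) * Q = - (x\<^sup>2) * (1 - y * Q) * ?m"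
      using mob_count_prev_ratio[of e j] 3 unfolding x_def y_def by (simp add: power_mult power_mult_distrib power2_eq_square power_add mult_ac)
    have nz: "1 - y * Q \<noteq> 0" using Qpow_neq[of "Suc j"] by (simp add: y_def mult.commute)
    have "(1 - y * Q) * (Q * (x\<^sup>2 * Q\<^sup>2 - 1) * ?s - (1 + Q) * Q * x\<^sup>2 * ?p + x\<^sup>2 * ?m)
      = (1 - y * Q) * (- Q * ?t)"
      using r1 r2 r3 by Groebner_Basis.algebra
    then have "Q * (x\<^sup>2 * Q\<^sup>2 - 1) * ?s - (1 + Q) * Q * x\<^sup>2 * ?p + x\<^sup>2 * ?m = - Q * ?t" by (rule mult_left_cancel[OF nz, THEN iffD1])
    then show ?thesis unfolding x_def by (simp add: power_mult power_mult_distrib power2_eq_square mult_ac)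
  qed
qed

lemma mob_count_rec2:
  "Q ^ (2 * d + 1) * mob_count_prev Q d e = - mob_count Q (Suc d) e + (1 + Q) * mob_count Q d e - Q * (1 - Q ^ (2 * d)) * mob_count Q (d - 1) e"
proof -
  consider "e > Suc d" | "e = Suc d" | j where "d = e + j" by (metis le_Suc_ex not_less_eq less_linear le_less)
  then show ?thesis
  proof cases
    case 1 then show ?thesis by (simp add: mob_count_prev_def)
  next
    case 2
    have "(Suc d)\<^sup>2 = d\<^sup>2 + (2 * d + 1)" by (simp add: power2_eq_square)
    then show ?thesis using 2 by (simp add: mob_count_prev_def mob_count_self power_add power2_eq_square mult_2)
  next
    case 3
    define x y where "x = Q ^ e" and "y = Q ^ j"
    let ?p = "mob_count Q d e" and ?m = "mob_count_prev Q d e" and ?t = "mob_count Q (Suc d) e"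
    have r0: "(1 - Q ^ (2 * d)) * mob_count Q (d - 1) e = (1 - y) * ?p"
    proof (cases j)
      case 0
      then show ?thesis using 3 by (cases e) (simp_all add: y_def)
    next
      case (Suc i)
      then show ?thesis using mob_count_Suc[of e i] 3 by (simp add: y_def mult_ac)
    qed
    have r2: "?t * (1 - y * Q) = (1 - x\<^sup>2 * y\<^sup>2 * Q\<^sup>2) * ?p"
      using mob_count_Suc[of e j] 3 unfolding x_def y_def by (simp add: power_mult power_mult_distrib power2_eq_square power_add mult_ac)
    have r3: "?p * (1 - x\<^sup>2) * Q = - (x\<^sup>2) * (1 - y * Q) * ?m"
      using mob_count_prev_ratio[of e j] 3 unfolding x_def y_def by (simp add: power_mult power_mult_distrib power2_eq_square power_add mult_ac)
    have nz: "1 - y * Q \<noteq> 0" using Qpow_neq[of "Suc j"] by (simp add: y_def mult.commute)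
    have "(1 - y * Q) * (x\<^sup>2 * y\<^sup>2 * Q * ?m) = (1 - y * Q) * (- ?t + (1 + Q) * ?p - Q * ((1 - y) * ?p))"
      using r2 r3 by Groebner_Basis.algebra
    then have "x\<^sup>2 * y\<^sup>2 * Q * ?m = - ?t + (1 + Q) * ?p - Q * ((1 - y) * ?p)" by (rule mult_left_cancel[OF nz, THEN iffD1])
    moreover have "Q ^ (2 * d + 1) = x\<^sup>2 * y\<^sup>2 * Q" unfolding 3 x_def y_def by (simp add: power_mult power_mult_distrib power2_eq_square power_add mult_ac)
    moreover have "Q * (1 - Q ^ (2 * d)) * mob_count Q (d - 1) e = Q * ((1 - y) * ?p)" using r0 by (simp only: mult.assoc)
    ultimately show ?thesis by (simp only:)
  qed
qed

text \<open>
  Summing \<open>mob_count_rec1\<close> over \<open>e\<close> shows that the sum does not depend on \<open>d\<close>. This is the Moebius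
  inversion: the weights of the isotropic subspaces containing a given one add up to \<open>1\<close>.
\<close>

lemma sum_mob_count: "(\<Sum>e\<le>d. mob_count Q d e) = 1"
proof (induct d)
  case 0 show ?case by (simp add: mob_count_self)
next
  case (Suc d)
  have a: "(\<Sum>e\<le>Suc d. Q * (Q ^ (2 * Suc e) - 1) * mob_count Q d (Suc e)) = (\<Sum>e\<le>d. Q * (Q ^ (2 * e) - 1) * mob_count Q d e)"
  proof -
    have "(\<Sum>e\<le>Suc (Suc d). Q * (Q ^ (2 * e) - 1) * mob_count Q d e) = (\<Sum>e\<le>Suc d. Q * (Q ^ (2 * Suc e) - 1) * mob_count Q d (Suc e))"
      by (subst sum.atMost_Suc_shift) simp
    then show ?thesis by simp
  qed
  have b: "(\<Sum>e\<le>Suc d. Q ^ (2 * e) * mob_count_prev Q d e) = (\<Sum>e\<le>d. Q ^ (2 * e) * Q\<^sup>2 * mob_count Q d e)"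
    by (subst sum.atMost_Suc_shift) (simp add: mob_count_prev_def power2_eq_square mult_ac)
  have "- Q * (\<Sum>e\<le>Suc d. mob_count Q (Suc d) e) = (\<Sum>e\<le>Suc d. Q * (Q ^ (2 * Suc e) - 1) * mob_count Q d (Suc e) - (1 + Q) * Q * Q ^ (2 * e) * mob_count Q d e + Q ^ (2 * e) * mob_count_prev Q d e)"
    unfolding mob_count_rec1 sum_distrib_left ..
  also have "\<dots> = (\<Sum>e\<le>d. Q * (Q ^ (2 * e) - 1) * mob_count Q d e) - (\<Sum>e\<le>d. (1 + Q) * Q * Q ^ (2 * e) * mob_count Q d e) + (\<Sum>e\<le>d. Q ^ (2 * e) * Q\<^sup>2 * mob_count Q d e)"
    unfolding sum.distrib sum_subtractf a b by simp
  also have "\<dots> = (\<Sum>e\<le>d. - Q * mob_count Q d e)"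
    unfolding sum.distrib[symmetric] sum_subtractf[symmetric] by (intro sum.cong) (auto simp: algebra_simps power2_eq_square)
  also have "\<dots> = - Q" unfolding sum_distrib_left[symmetric] Suc by simp
  finally show ?case using Q by simp
qed

section \<open>A transfer operator and a commuting q-difference operator\<close>

text \<open>
  The coefficient vector \<open>m\<close> stands for the polynomial \<open>\<Sum> m\<^sub>j T^j\<close>, in which \<open>T^j\<close> represents the
  lattices of type \<open>d = n - j\<close>.
\<close>

definition transfer_op :: "nat \<Rightarrow> (nat \<Rightarrow> rat) \<Rightarrow> nat \<Rightarrow> rat" where
  "transfer_op n m e = (\<Sum>j\<le>n. m j * mob_count Q (n - j) e)"

text \<open>
  This is \<open>Q/T\<close> times \<open>f \<mapsto> (1 - T)(1 - QT) f(Q^2 T) - (1 + Q^(2n+1) T^2) f(T)\<close> on coefficients. An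
  eigenvector of it solves a first-order \<open>Q^2\<close>-difference equation.
\<close>

definition qdiff_op :: "nat \<Rightarrow> (nat \<Rightarrow> rat) \<Rightarrow> nat \<Rightarrow> rat" where
  "qdiff_op n m e = Q * (Q ^ (2 * Suc e) - 1) * m (Suc e) - (1 + Q) * Q * Q ^ (2 * e) * m e
     + (Q ^ (2 * e) - Q ^ (2 * n + 2)) * (if e = 0 then 0 else m (e - 1))"

text \<open>
  After the recurrences are applied to each \<open>mob_count Q (n - j)\<close>, the claim is a shift of the
  summation index. The boundary terms vanish because the factors \<open>Q^(2j) - 1\<close> and
  \<open>Q^(2j+2) - Q^(2n+2)\<close> are zero at \<open>j = 0\<close> and \<open>j = n\<close>.
\<close>

lemma qdiff_transfer_commute:
  assumes "m (Suc n) = 0"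
  shows "qdiff_op n (transfer_op n m) e = transfer_op n (qdiff_op n m) e"
proof -
  define F where "F j = (if j = 0 then 0 else mob_count Q (Suc n - j) e)" for j
  have trm: "Q * (Q ^ (2 * Suc e) - 1) * mob_count Q (n - j) (Suc e) - (1 + Q) * Q * Q ^ (2 * e) * mob_count Q (n - j) e
      + (Q ^ (2 * e) - Q ^ (2 * n + 2)) * mob_count_prev Q (n - j) e
     = Q * (Q ^ (2 * j) - 1) * F j - (1 + Q) * Q * Q ^ (2 * j) * mob_count Q (n - j) e
       + (Q ^ (2 * Suc j) - Q ^ (2 * n + 2)) * mob_count Q (n - Suc j) e" if j: "j \<le> n" for j
  proof -
    obtain d where d: "n = j + d" using j le_Suc_ex by blast
    have e1: "(Q ^ (2 * j) - 1) * F j = (Q ^ (2 * j) - 1) * mob_count Q (Suc d) e" by (simp add: F_def d)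
    have "Q ^ (2 * n + 2) * mob_count_prev Q d e = Q * Q ^ (2 * j) * (Q ^ (2 * d + 1) * mob_count_prev Q d e)"
      unfolding d by (simp add: power_add power_mult power2_eq_square mult_ac distrib_left)
    also have "\<dots> = Q * Q ^ (2 * j) * (- mob_count Q (Suc d) e + (1 + Q) * mob_count Q d e - Q * (1 - Q ^ (2 * d)) * mob_count Q (d - 1) e)"
      unfolding mob_count_rec2 ..
    finally have B: "Q ^ (2 * n + 2) * mob_count_prev Q d e = Q * Q ^ (2 * j) * (- mob_count Q (Suc d) e + (1 + Q) * mob_count Q d e - Q * (1 - Q ^ (2 * d)) * mob_count Q (d - 1) e)" .
    have c: "Q ^ (2 * n + 2) = Q ^ (2 * j) * Q ^ (2 * d) * Q\<^sup>2" "Q ^ (2 * Suc j) = Q ^ (2 * j) * Q\<^sup>2" "n - j = d" "n - Suc j = d - 1"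
      unfolding d by (simp_all add: power_add power_mult power2_eq_square distrib_left mult_ac)
    have key: "Q * (A - 1) * s - (1 + Q) * Q * E * p + (E - J * D * Q\<^sup>2) * m
       = Q * (J - 1) * f - (1 + Q) * Q * J * p + (J * Q\<^sup>2 - J * D * Q\<^sup>2) * u"
      if "Q * (A - 1) * s - (1 + Q) * Q * E * p + E * m = - Q * t"
        "J * D * Q\<^sup>2 * m = Q * J * (- t + (1 + Q) * p - Q * (1 - D) * u)" "(J - 1) * f = (J - 1) * t"
      for A E J D s p m f u t :: rat
      using that by Groebner_Basis.algebra
    show ?thesis unfolding c by (rule key[OF mob_count_rec1[of e d] B[unfolded c] e1])
  qed
  have L: "qdiff_op n (transfer_op n m) e = (\<Sum>j\<le>n. m j * (Q * (Q ^ (2 * Suc e) - 1) * mob_count Q (n - j) (Suc e) - (1 + Q) * Q * Q ^ (2 * e) * mob_count Q (n - j) e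
      + (Q ^ (2 * e) - Q ^ (2 * n + 2)) * mob_count_prev Q (n - j) e))"
    unfolding qdiff_op_def transfer_op_def mob_count_prev_def
    by (simp add: sum_distrib_left sum.distrib sum_subtractf algebra_simps)
  have s1: "(\<Sum>j\<le>n. m j * (Q * (Q ^ (2 * j) - 1) * F j)) = (\<Sum>j\<le>n. Q * (Q ^ (2 * Suc j) - 1) * m (Suc j) * mob_count Q (n - j) e)"
  proof -
    have "(\<Sum>j\<le>n. m j * (Q * (Q ^ (2 * j) - 1) * F j)) = (\<Sum>j\<le>Suc n. m j * (Q * (Q ^ (2 * j) - 1) * F j))" using assms by simp
    also have "\<dots> = (\<Sum>j\<le>n. m (Suc j) * (Q * (Q ^ (2 * Suc j) - 1) * F (Suc j)))" by (subst sum.atMost_Suc_shift) simp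
    finally show ?thesis by (simp add: F_def mult_ac)
  qed
  have s3: "(\<Sum>j\<le>n. m j * ((Q ^ (2 * Suc j) - Q ^ (2 * n + 2)) * mob_count Q (n - Suc j) e)) 
     = (\<Sum>j\<le>n. (Q ^ (2 * j) - Q ^ (2 * n + 2)) * (if j = 0 then 0 else m (j - 1)) * mob_count Q (n - j) e)"
  proof -
    have "(\<Sum>j\<le>n. (Q ^ (2 * j) - Q ^ (2 * n + 2)) * (if j = 0 then 0 else m (j - 1)) * mob_count Q (n - j) e)
       = (\<Sum>j\<le>Suc n. (Q ^ (2 * j) - Q ^ (2 * n + 2)) * (if j = 0 then 0 else m (j - 1)) * mob_count Q (n - j) e)" by simp
    also have "\<dots> = (\<Sum>j\<le>n. m j * ((Q ^ (2 * Suc j) - Q ^ (2 * n + 2)) * mob_count Q (n - Suc j) e))"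
      by (subst sum.atMost_Suc_shift) (simp add: mult_ac)
    finally show ?thesis by simp
  qed
  have "qdiff_op n (transfer_op n m) e = (\<Sum>j\<le>n. m j * (Q * (Q ^ (2 * j) - 1) * F j - (1 + Q) * Q * Q ^ (2 * j) * mob_count Q (n - j) e
       + (Q ^ (2 * Suc j) - Q ^ (2 * n + 2)) * mob_count Q (n - Suc j) e))"
    unfolding L using trm by (intro sum.cong) auto
  also have "\<dots> = (\<Sum>j\<le>n. m j * (Q * (Q ^ (2 * j) - 1) * F j)) - (\<Sum>j\<le>n. m j * ((1 + Q) * Q * Q ^ (2 * j) * mob_count Q (n - j) e))
       + (\<Sum>j\<le>n. m j * ((Q ^ (2 * Suc j) - Q ^ (2 * n + 2)) * mob_count Q (n - Suc j) e))"
    by (simp add: sum.distrib sum_subtractf distrib_left right_diff_distrib)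
  also have "\<dots> = transfer_op n (qdiff_op n m) e"
    unfolding s1 s3 transfer_op_def qdiff_op_def sum.distrib[symmetric] sum_subtractf[symmetric]
    by (intro sum.cong refl) (simp add: algebra_simps)
  finally show ?thesis .
qed

section \<open>Eigenvectors of the transfer operator\<close>

text \<open>
  For even \<open>r = 2k\<close> this is \<open>(T; Q^2)\<^sub>k\<close>, for odd \<open>r = 2k + 1\<close> it is \<open>(QT; Q^2)\<^sub>k\<close>. Treating both
  parities as one sequence makes the eigenvectors symmetric products.
\<close>

fun half_poch :: "nat \<Rightarrow> rat poly" where
  "half_poch 0 = 1"
| "half_poch (Suc 0) = 1"
| "half_poch (Suc (Suc r)) = [:1, - (Q ^ r):] * half_poch r"

lemma half_poch_dilate2: "(if even r then [:1, - 1:] else [:1, - Q:]) * pcompose (half_poch r) [:0, Q\<^sup>2:] = [:1, - (Q ^ r):] * half_poch r"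
proof (induct r rule: half_poch.induct)
  case (3 r)
  have e: "pcompose [:1, - (Q ^ r):] [:0, Q\<^sup>2:] = [:1, - (Q ^ Suc (Suc r)):]"
    by (simp add: pcompose_pCons power2_eq_square mult_ac)
  have "(if even (Suc (Suc r)) then [:1, - 1:] else [:1, - Q:]) * pcompose (half_poch (Suc (Suc r))) [:0, Q\<^sup>2:]
     = [:1, - (Q ^ Suc (Suc r)):] * ((if even r then [:1, - 1:] else [:1, - Q:]) * pcompose (half_poch r) [:0, Q\<^sup>2:])"
    unfolding half_poch.simps(3) pcompose_mult e even_Suc not_not by (simp only: mult_ac)
  then show ?case unfolding 3 half_poch.simps(3) .
qed (simp_all add: one_pCons pcompose_const)

lemma half_poch_degree_coeff: "degree (half_poch r) = r div 2 \<and> coeff (half_poch r) (r div 2) = (- 1) ^ (r div 2) * Q ^ ((r div 2) * ((r - 1) div 2))"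
proof (induct r rule: half_poch.induct)
  case (3 r)
  have nz: "half_poch r \<noteq> 0" using 3 Q by (metis coeff_0 mult_eq_0_iff power_not_zero zero_neq_neg_one less_irrefl not_one_less_zero)
  have d1: "degree [:1, - (Q ^ r):] = 1" using Q by simp
  have "degree (half_poch (Suc (Suc r))) = degree [:1, - (Q ^ r):] + degree (half_poch r)"
    unfolding half_poch.simps using nz by (intro degree_mult_eq) auto
  then have d: "degree (half_poch (Suc (Suc r))) = Suc (Suc r) div 2" using d1 3 by simp
  have "coeff (half_poch (Suc (Suc r))) (degree [:1, - (Q ^ r):] + degree (half_poch r)) = coeff [:1, - (Q ^ r):] (degree [:1, - (Q ^ r):]) * coeff (half_poch r) (degree (half_poch r))"
    unfolding half_poch.simps by (rule coeff_mult_degree_sum)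
  then have c: "coeff (half_poch (Suc (Suc r))) (Suc (Suc r) div 2) = - (Q ^ r) * ((- 1) ^ (r div 2) * Q ^ ((r div 2) * ((r - 1) div 2)))"
    using d1 3 by (simp del: half_poch.simps)
  have "r + (r div 2) * ((r - 1) div 2) = (Suc (Suc r) div 2) * ((Suc (Suc r) - 1) div 2)"
  proof (cases "even r")
    case True
    then obtain k where k: "r = 2 * k" by auto
    show ?thesis unfolding k by (cases k) (auto simp: algebra_simps)
  next
    case False
    then obtain k where k: "r = 2 * k + 1" by (auto elim: oddE)
    show ?thesis unfolding k by (auto simp: algebra_simps)
  qed
  then have "Q ^ r * Q ^ ((r div 2) * ((r - 1) div 2)) = Q ^ ((Suc (Suc r) div 2) * ((Suc (Suc r) - 1) div 2))"
    by (simp add: power_add[symmetric])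
  then show ?case using d unfolding c by (simp del: half_poch.simps)
qed simp_all

lemma half_poch_0: "coeff (half_poch r) 0 = 1"
  by (induct r rule: half_poch.induct) (simp_all add: coeff_mult)

text \<open>
  This equals \<open>(T;Q)\<^sub>r (Q^(r+1) T; Q^2)\<^sub>n\<^sub>-\<^sub>r\<close> for \<open>r \<le> n\<close>; the product form shows the symmetry
  under \<open>r \<mapsto> 2n + 1 - r\<close>.
\<close>

definition eigen :: "nat \<Rightarrow> nat \<Rightarrow> rat poly" where
  "eigen n r = half_poch r * half_poch (2 * n + 1 - r)"

lemma half_sum: "(r::nat) \<le> 2 * n + 1 \<Longrightarrow> r div 2 + (2 * n + 1 - r) div 2 = n"
  by presburger

lemma half_poch_nz: "half_poch r \<noteq> 0"
  using half_poch_0[of r] by (metis coeff_0 zero_neq_one)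

lemma eigen_degree: "r \<le> 2 * n + 1 \<Longrightarrow> degree (eigen n r) = n"
  unfolding eigen_def using half_poch_degree_coeff half_poch_nz by (simp add: degree_mult_eq half_sum)

lemma eigen_0: "coeff (eigen n r) 0 = 1"
  by (simp add: eigen_def coeff_mult half_poch_0)

lemma eigen_lead:
  assumes "r \<le> 2 * n + 1"
  shows "coeff (eigen n r) n * Q ^ (r * (2 * n + 1 - r) div 2) = (- 1) ^ n * Q ^ n\<^sup>2"
proof -
  let ?s = "2 * n + 1 - r"
  have "coeff (eigen n r) (degree (half_poch r) + degree (half_poch ?s)) = coeff (half_poch r) (degree (half_poch r)) * coeff (half_poch ?s) (degree (half_poch ?s))"
    unfolding eigen_def by (rule coeff_mult_degree_sum)
  then have c: "coeff (eigen n r) n = (- 1) ^ (r div 2) * Q ^ ((r div 2) * ((r - 1) div 2)) * ((- 1) ^ (?s div 2) * Q ^ ((?s div 2) * ((?s - 1) div 2)))"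
    using half_poch_degree_coeff[of r] half_poch_degree_coeff[of ?s] half_sum[OF assms] by simp
  have s: "(- 1 :: rat) ^ (r div 2) * (- 1) ^ (?s div 2) = (- 1) ^ n" unfolding power_add[symmetric] half_sum[OF assms] ..
  have "(r div 2) * ((r - 1) div 2) + (?s div 2) * ((?s - 1) div 2) + r * ?s div 2 = n\<^sup>2"
  proof (cases "even r")
    case True
    then obtain k where k: "r = 2 * k" by auto
    then obtain j where j: "n = k + j" using assms le_Suc_ex[of k n] by auto
    have "?s = 2 * j + 1" unfolding k j by simp
    then show ?thesis unfolding k j by (cases k) (auto simp: algebra_simps power2_eq_square)
  next
    case False
    then obtain k where k: "r = 2 * k + 1" by (auto elim: oddE)
    then obtain j where j: "n = k + j" using assms le_Suc_ex[of k n] by auto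
    have s: "?s = 2 * j" unfolding k j by simp
    have "r * ?s div 2 = (2 * k + 1) * j" unfolding s unfolding k by simp
    then show ?thesis unfolding s unfolding k j by (cases j) (auto simp: algebra_simps power2_eq_square)
  qed
  then have e: "Q ^ ((r div 2) * ((r - 1) div 2)) * Q ^ ((?s div 2) * ((?s - 1) div 2)) * Q ^ (r * ?s div 2) = Q ^ n\<^sup>2"
    unfolding power_add[symmetric] by simp
  show ?thesis unfolding c s[symmetric] e[symmetric] by (simp only: mult_ac)
qed

text \<open>
  One of \<open>r\<close> and \<open>2n + 1 - r\<close> is even and the other odd, so the two factors contribute \<open>1 - T\<close> and
  \<open>1 - QT\<close>.
\<close>

lemma eigen_dilate2:
  assumes "r \<le> 2 * n + 1"
  shows "[:1, - 1:] * [:1, - Q:] * pcompose (eigen n r) [:0, Q\<^sup>2:] = [:1, - (Q ^ r):] * [:1, - (Q ^ (2 * n + 1 - r)):] * eigen n r"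
proof -
  let ?s = "2 * n + 1 - r"
  have "even r \<longleftrightarrow> odd ?s" using assms by auto
  moreover have "A * B = (if b then A else B) * (if c then A else B)" if "b \<longleftrightarrow> \<not> c" for A B :: "rat poly" and b c
    using that by (cases b) (simp_all add: mult.commute)
  ultimately have "[:1, - 1:] * [:1, - Q:] = (if even r then [:1, - 1:] else [:1, - Q:]) * (if even ?s then [:1, - 1:] else [:1, - Q:])" by blast
  then have "[:1, - 1:] * [:1, - Q:] * pcompose (eigen n r) [:0, Q\<^sup>2:] = 
     ((if even r then [:1, - 1:] else [:1, - Q:]) * pcompose (half_poch r) [:0, Q\<^sup>2:]) * ((if even ?s then [:1, - 1:] else [:1, - Q:]) * pcompose (half_poch ?s) [:0, Q\<^sup>2:])"
    unfolding eigen_def pcompose_mult by (simp only: mult_ac)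
  then show ?thesis unfolding half_poch_dilate2 eigen_def by (simp only: mult_ac)
qed

lemma coeff_two_linear:
  "coeff ([:1, - a:] * [:1, - b:] * f) (Suc e) = coeff f (Suc e) - (a + b) * coeff f e + a * b * (if e = 0 then 0 else coeff f (e - 1))" for a b :: rat
proof -
  have "[:1, - a:] * [:1, - b:] = [:1, - (a + b), a * b:]" by (simp add: algebra_simps)
  then show ?thesis by (cases e) (simp_all add: algebra_simps)
qed

lemma qdiff_eigen:
  assumes "r \<le> 2 * n + 1"
  shows "qdiff_op n (coeff (eigen n r)) e = - Q * (Q ^ r + Q ^ (2 * n + 1 - r)) * coeff (eigen n r) e"
proof -
  let ?g = "coeff (eigen n r)" and ?s = "2 * n + 1 - r"
  have mob_count: "coeff (pcompose (eigen n r) [:0, Q\<^sup>2:]) i = Q ^ (2 * i) * ?g i" for i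
    by (simp add: coeff_pcompose_linear power_mult)
  have "Q ^ r * Q ^ ?s = Q ^ (2 * n + 1)" using assms by (simp add: power_add[symmetric])
  then have 1: "Q ^ (2 * Suc e) * ?g (Suc e) - (1 + Q) * (Q ^ (2 * e) * ?g e) + Q * (if e = 0 then 0 else Q ^ (2 * (e - 1)) * ?g (e - 1))
    = ?g (Suc e) - (Q ^ r + Q ^ ?s) * ?g e + Q ^ (2 * n + 1) * (if e = 0 then 0 else ?g (e - 1))"
    using arg_cong[OF eigen_dilate2[OF assms], of "\<lambda>f. coeff f (Suc e)"] unfolding coeff_two_linear mob_count by simp
  have 2: "Q * (Q * (if e = 0 then 0 else Q ^ (2 * (e - 1)) * ?g (e - 1))) = Q ^ (2 * e) * (if e = 0 then 0 else ?g (e - 1))"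
    by (cases e) simp_all
  have 3: "Q ^ (2 * n + 2) = Q * Q ^ (2 * n + 1)" by simp
  have key: "Q * (A - 1) * s - (1 + Q) * Q * E * p + (E - Q * N) * m = - Q * c * p"
    if "A * s - (1 + Q) * (E * p) + Q * u = s - c * p + N * m" "Q * (Q * u) = E * m" for A s E p N m c u :: rat
    using that by Groebner_Basis.algebra
  show ?thesis unfolding qdiff_op_def 3 by (rule key[OF 1 2])
qed

text \<open>
  Read as a recurrence, the eigenvalue equation determines every coefficient from the constant
  one.
\<close>

lemma qdiff_unique:
  assumes "\<And>e. qdiff_op n f e = c * f e" "\<And>e. qdiff_op n g e = c * g e" "g 0 = 1"
  shows "f e = f 0 * g e"
proof (induct e rule: less_induct)
  case (less e)
  show ?case
  proof (cases e)
    case (Suc i)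
    have nz: "Q * (Q ^ (2 * Suc i) - 1) \<noteq> 0" using Q Qpow_neq[of "2 * Suc i"] by simp
    have i: "f i = f 0 * g i" by (rule less) (simp add: Suc)
    have m: "(if i = 0 then 0 else f (i - 1)) = f 0 * (if i = 0 then 0 else g (i - 1))" 
    proof (cases i)
      case (Suc l)
      then have "f l = f 0 * g l" by (intro less) (simp add: \<open>e = Suc i\<close>)
      then show ?thesis by (simp only: Suc if_False nat.distinct diff_Suc_1)
    qed simp
    have key: "z * u = z * (x * v)" if "z * u - b * (x * p) + d * (x * m) = c * (x * p)" "z * v - b * p + d * m = c * p" for z u x v b p d m :: rat
    proof -
      have "x * (c * p + b * p - d * m) = c * (x * p) + b * (x * p) - d * (x * m)"
        by (simp only: distrib_left right_diff_distrib mult.left_commute)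
      then have "z * u = x * (c * p + b * p - d * m)" using that(1) by linarith
      moreover have "c * p + b * p - d * m = z * v" using that(2) by linarith
      ultimately show ?thesis by (simp only: mult.left_commute)
    qed
    have "Q * (Q ^ (2 * Suc i) - 1) * f (Suc i) = Q * (Q ^ (2 * Suc i) - 1) * (f 0 * g (Suc i))"
      using assms(1,2)[of i, unfolded qdiff_op_def] unfolding i m by (rule key)
    then show ?thesis unfolding Suc by (rule mult_left_cancel[OF nz, THEN iffD1])
  qed (simp add: assms)
qed

text \<open>
  Since the operators commute and the eigenspaces of \<open>qdiff_op\<close> are lines, the eigenvectors of the
  latter are eigenvectors of \<open>transfer_op\<close>. The coefficient of \<open>T^n\<close> in the image involves only the
  constant coefficient, which yields the eigenvalue.
\<close>

lemma transfer_eigen: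
  assumes "r \<le> 2 * n + 1"
  shows "transfer_op n (coeff (eigen n r)) e = Q ^ (r * (2 * n + 1 - r) div 2) * coeff (eigen n r) e"
proof -
  let ?g = "coeff (eigen n r)"
  have top: "?g (Suc n) = 0" using eigen_degree[OF assms] by (simp add: coeff_eq_0)
  have "qdiff_op n (transfer_op n ?g) e = - Q * (Q ^ r + Q ^ (2 * n + 1 - r)) * transfer_op n ?g e" for e
  proof -
    have "qdiff_op n (transfer_op n ?g) e = (\<Sum>j\<le>n. - Q * (Q ^ r + Q ^ (2 * n + 1 - r)) * ?g j * mob_count Q (n - j) e)"
      unfolding qdiff_transfer_commute[where m = ?g, OF top] transfer_op_def[of _ "qdiff_op n ?g"] qdiff_eigen[OF assms] ..
    then show ?thesis unfolding transfer_op_def[of _ ?g] sum_distrib_left by (simp only: mult.assoc)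
  qed
  then have h: "transfer_op n ?g e = transfer_op n ?g 0 * ?g e" for e
    using qdiff_eigen[OF assms] eigen_0 by (rule qdiff_unique)
  have "transfer_op n ?g n = (\<Sum>j\<in>{0}. ?g j * mob_count Q (n - j) n)"
    unfolding transfer_op_def by (rule sum.mono_neutral_right) auto
  then have "transfer_op n ?g n = (- 1) ^ n * Q ^ n\<^sup>2" by (simp add: eigen_0 mob_count_self)
  then have "?g n * transfer_op n ?g 0 = ?g n * Q ^ (r * (2 * n + 1 - r) div 2)"
    unfolding eigen_lead[OF assms] using h[of n] by (simp only: mult.commute)
  moreover have "?g n \<noteq> 0"
  proof -
    have "?g n = lead_coeff (eigen n r)" using eigen_degree[OF assms] by simp
    moreover have "eigen n r \<noteq> 0" unfolding eigen_def using half_poch_nz by simp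
    ultimately show ?thesis by (simp only: leading_coeff_0_iff) simp
  qed
  ultimately have "transfer_op n ?g 0 = Q ^ (r * (2 * n + 1 - r) div 2)" using mult_left_cancel by blast
  then show ?thesis using h[of e] by (simp only:)
qed

section \<open>Expansion of 1 in eigenvectors\<close>

text \<open>
  The coefficients of the polynomial \<open>1\<close> in the eigenvectors; they are the scalar factors of the
  summands in the main theorem.
\<close>

definition eig_weight :: "nat \<Rightarrow> nat \<Rightarrow> rat" where
  "eig_weight n r = (- Q) ^ r * (1 - Q ^ (2 * n - 2 * r + 1)) * qpochhammer (Q\<^sup>2) (Q\<^sup>2) n / (qpochhammer Q Q (2 * n - r + 1) * qpochhammer Q Q r)"

lemma antisymmetric_sum: fixes F :: "nat \<Rightarrow> rat"
  assumes "odd m" "\<And>r. r \<le> m \<Longrightarrow> F (m - r) = F r"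
  shows "(\<Sum>r\<le>m. (- 1) ^ r * F r) = 0"
proof -
  have "(\<Sum>r\<le>m. (- 1) ^ r * F r) = (\<Sum>r\<le>m. (- 1) ^ (m - r) * F (m - r))"
    by (rule sum.reindex_bij_witness[of _ "\<lambda>r. m - r" "\<lambda>r. m - r"]) auto
  also have "\<dots> = (\<Sum>r\<le>m. - ((- 1) ^ r * F r))"
  proof (rule sum.cong)
    fix r assume r: "r \<in> {..m}"
    have "(- 1 :: rat) ^ (m - r) = - ((- 1) ^ r)" using assms(1) r by (cases "even r") auto
    then show "(- 1) ^ (m - r) * F (m - r) = - ((- 1) ^ r * F r)" using assms(2) r by simp
  qed simp
  finally show ?thesis by (simp add: sum_negf)
qed

abbreviation "qf \<equiv> qpochhammer Q Q"
abbreviation "hp r t \<equiv> poly (half_poch r) t"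

lemma hp_rec: "hp (Suc (Suc r)) t = (1 - Q ^ r * t) * hp r t"
  by (simp add: algebra_simps)

lemma qf_Suc: "qf (Suc m) = qf m * (1 - Q ^ Suc m)"
  by (simp add: qpochhammer_Suc)

lemma hp_shift: "(if odd r then (1 - t) else 1) * hp r (Q * t) = hp (Suc r) t"
proof (induct r rule: half_poch.induct)
  case (3 r)
  have "(if odd (Suc (Suc r)) then (1 - t) else 1) * hp (Suc (Suc r)) (Q * t) = (1 - Q ^ r * (Q * t)) * ((if odd r then (1 - t) else 1) * hp r (Q * t))"
    unfolding hp_rec by simp
  also have "\<dots> = hp (Suc (Suc (Suc r))) t" unfolding 3 hp_rec by (simp add: mult_ac)
  finally show ?case .
qed simp_all

text \<open>
  Extending the summation to \<open>r \<le> 2n\<close> replaces the weights by simpler ones: the terms \<open>r\<close> and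
  \<open>2n + 1 - r\<close> belong to the same eigenvector, and their sum is the weight \<open>eig_weight\<close> up to the
  factor \<open>(Q^2; Q^2)\<^sub>n\<close>.
\<close>

definition sym_sum :: "nat \<Rightarrow> rat \<Rightarrow> rat" where
  "sym_sum n t = (\<Sum>r\<le>2 * n. (- Q) ^ r / (qf r * qf (2 * n - r)) * (hp r t * hp (2 * n + 1 - r) t))"

text \<open>
  The difference of the two sides is a combination of two sums over \<open>r + s = 2n - 1\<close> with sign
  \<open>(-1)^r\<close> and terms symmetric in \<open>r\<close> and \<open>s\<close>. Both vanish since \<open>2n - 1\<close> is odd.
\<close>

lemma sym_sum_shift: assumes "n \<ge> 1" "t \<noteq> 1" shows "sym_sum n (Q * t) = sym_sum n t"
proof -
  let ?M = "2 * n"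
  define m where "m = ?M - 1"
  have m: "?M = Suc m" "odd m" using assms by (auto simp: m_def)
  define d where "d r = (- 1) ^ r / (qf r * qf (?M - r))" for r
  have dr: "(- Q) ^ r / (qf r * qf (?M - r)) = d r * Q ^ r" for r unfolding d_def by (simp add: power_minus[of Q])
  have sym: "(- Q) ^ r / (qf r * qf (?M - r)) = d (?M - r) * Q ^ r" if "r \<le> ?M" for r
  proof -
    have "(- 1 :: rat) ^ (?M - r) = (- 1) ^ r" using that by (cases "even r") auto
    then show ?thesis using that unfolding d_def by (simp add: power_minus[of Q] mult.commute)
  qed
  have "(1 - t) * sym_sum n (Q * t) = (\<Sum>r\<le>?M. (- Q) ^ r / (qf r * qf (?M - r)) * (hp (Suc r) t * hp (Suc (Suc (?M - r))) t))"
    unfolding sym_sum_def sum_distrib_left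
  proof (rule sum.cong)
    fix r assume r: "r \<in> {..?M}"
    have "odd r \<longleftrightarrow> even (?M + 1 - r)" using r by auto
    then have "(1 - t) * (hp r (Q * t) * hp (?M + 1 - r) (Q * t)) = ((if odd r then (1 - t) else 1) * hp r (Q * t)) * ((if odd (?M + 1 - r) then (1 - t) else 1) * hp (?M + 1 - r) (Q * t))"
      by simp
    also have "\<dots> = hp (Suc r) t * hp (Suc (Suc (?M - r))) t" unfolding hp_shift using r by (simp add: Suc_diff_le del: half_poch.simps)
    finally show "(1 - t) * ((- Q) ^ r / (qf r * qf (?M - r)) * (hp r (Q * t) * hp (?M + 1 - r) (Q * t))) = (- Q) ^ r / (qf r * qf (?M - r)) * (hp (Suc r) t * hp (Suc (Suc (?M - r))) t)"
      by (subst mult.left_commute) (simp only:)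
  qed simp
  also have "\<dots> = (\<Sum>r\<le>?M. d (?M - r) * Q ^ r * (hp (Suc r) t * ((1 - Q ^ (?M - r) * t) * hp (?M - r) t)))"
    unfolding hp_rec using sym by (intro sum.cong) auto
  also have "\<dots> = (\<Sum>r\<le>?M. d r * Q ^ (?M - r) * (hp (Suc (?M - r)) t * ((1 - Q ^ r * t) * hp r t)))"
    by (rule sum.reindex_bij_witness[of _ "\<lambda>r. ?M - r" "\<lambda>r. ?M - r"]) auto
  finally have 1: "(1 - t) * sym_sum n (Q * t) = (\<Sum>r\<le>?M. d r * Q ^ (?M - r) * (hp (Suc (?M - r)) t * ((1 - Q ^ r * t) * hp r t)))" .
  have 2: "(1 - t) * sym_sum n t = (\<Sum>r\<le>?M. d r * ((1 - t) * Q ^ r) * (hp r t * hp (Suc (?M - r)) t))"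
    unfolding sym_sum_def sum_distrib_left dr by (intro sum.cong) (auto simp: Suc_diff_le simp del: half_poch.simps)
  have "(1 - t) * sym_sum n t - (1 - t) * sym_sum n (Q * t) = 
    (\<Sum>r\<le>?M. d r * (1 - Q ^ (?M - r)) * (hp (Suc (Suc r)) t * hp (Suc (?M - r)) t)) - (\<Sum>r\<le>?M. d r * (1 - Q ^ r) * (hp r t * hp (Suc (?M - r)) t))"
    unfolding 1 2 sum_subtractf[symmetric] hp_rec by (intro sum.cong) (auto simp: algebra_simps simp del: half_poch.simps)
  also have "(\<Sum>r\<le>?M. d r * (1 - Q ^ (?M - r)) * (hp (Suc (Suc r)) t * hp (Suc (?M - r)) t)) = 
     (\<Sum>r\<le>m. (- 1) ^ r * (1 / (qf r * qf (m - r)) * (hp (Suc (Suc r)) t * hp (Suc (Suc (m - r))) t)))"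
  proof -
    have "d r * (1 - Q ^ (?M - r)) * (hp (Suc (Suc r)) t * hp (Suc (?M - r)) t) = (- 1) ^ r * (1 / (qf r * qf (m - r)) * (hp (Suc (Suc r)) t * hp (Suc (Suc (m - r))) t))" if "r \<le> m" for r
    proof -
      have s: "?M - r = Suc (m - r)" using m that by simp
      have nz: "1 - Q ^ Suc (m - r) \<noteq> 0" using Qpow_neq[of "Suc (m - r)"] by simp
      have key: "(a / (b * (c * z))) * z * x = a * (1 / (b * c) * x)" if "z \<noteq> 0" for a b c z x :: rat using that by simp
      show ?thesis unfolding d_def s qf_Suc by (rule key[OF nz])
    qed
    then show ?thesis unfolding m(1) by (simp del: half_poch.simps power_Suc)
  qed
  also have "\<dots> = 0" using m by (intro antisymmetric_sum) (auto simp: mult.commute simp del: half_poch.simps)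
  also have "(\<Sum>r\<le>?M. d r * (1 - Q ^ r) * (hp r t * hp (Suc (?M - r)) t)) = 
      - (\<Sum>r\<le>m. (- 1) ^ r * (1 / (qf r * qf (m - r)) * (hp (Suc r) t * hp (Suc (m - r)) t)))"
  proof -
    have "d (Suc r) * (1 - Q ^ Suc r) * (hp (Suc r) t * hp (Suc (?M - Suc r)) t) = - ((- 1) ^ r * (1 / (qf r * qf (m - r)) * (hp (Suc r) t * hp (Suc (m - r)) t)))" for r
    proof -
      have s: "?M - Suc r = m - r" using m by simp
      have nz: "1 - Q ^ Suc r \<noteq> 0" using Qpow_neq[of "Suc r"] by simp
      have key: "(- 1 * a / ((b * z) * c)) * z * x = - (a * (1 / (b * c) * x))" if "z \<noteq> 0" for a b c z x :: rat using that by simp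
      show ?thesis unfolding d_def s qf_Suc power_Suc[of "- 1"] by (rule key[OF nz])
    qed
    then show ?thesis unfolding m(1) sum.atMost_Suc_shift by (simp add: sum_negf del: half_poch.simps power_Suc)
  qed
  also have "(\<Sum>r\<le>m. (- 1) ^ r * (1 / (qf r * qf (m - r)) * (hp (Suc r) t * hp (Suc (m - r)) t))) = 0"
    using m by (intro antisymmetric_sum) (auto simp: mult.commute simp del: half_poch.simps)
  finally have "(1 - t) * sym_sum n t = (1 - t) * sym_sum n (Q * t)" by simp
  then show ?thesis using assms by simp
qed

lemma eig_weight_sym_sum: "(\<Sum>r\<le>n. eig_weight n r * poly (eigen n r) t) = qpochhammer (Q\<^sup>2) (Q\<^sup>2) n * sym_sum n t"
proof -
  define c where "c r = (- Q) ^ r / (qf r * qf (2 * n - r))" for r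
  define g where "g r = hp r t * hp (2 * n + 1 - r) t" for r
  have gs: "g (2 * n + 1 - r) = g r" if "r \<le> 2 * n + 1" for r using that unfolding g_def by (simp add: mult.commute)
  have split: "{..2 * n} = {..n} \<union> {Suc n..2 * n}" by auto
  have "sym_sum n t = (\<Sum>r\<le>2 * n. c r * g r)" unfolding sym_sum_def c_def g_def ..
  also have "\<dots> = (\<Sum>r\<le>n. c r * g r) + (\<Sum>r\<in>{Suc n..2 * n}. c r * g r)"
    unfolding split by (rule sum.union_disjoint) auto
  also have "(\<Sum>r\<in>{Suc n..2 * n}. c r * g r) = (\<Sum>r\<in>{1..n}. c (2 * n + 1 - r) * g r)"
    by (rule sum.reindex_bij_witness[of _ "\<lambda>r. 2 * n + 1 - r" "\<lambda>r. 2 * n + 1 - r"]) (auto simp: gs[simplified])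
  also have "\<dots> = (\<Sum>r\<le>n. (if r = 0 then 0 else c (2 * n + 1 - r)) * g r)"
    by (rule sum.mono_neutral_cong_left) auto
  finally have e: "sym_sum n t = (\<Sum>r\<le>n. (c r + (if r = 0 then 0 else c (2 * n + 1 - r))) * g r)"
    by (simp add: sum.distrib distrib_right)
  have "eig_weight n r = qpochhammer (Q\<^sup>2) (Q\<^sup>2) n * (c r + (if r = 0 then 0 else c (2 * n + 1 - r)))" if r: "r \<le> n" for r
  proof (cases r)
    case 0
    have nz: "1 - Q ^ Suc (2 * n) \<noteq> 0" using Qpow_neq[of "Suc (2 * n)"] by simp
    have key: "1 * z * a / (b * z * 1) = a * (1 / (1 * b) + 0)" if "z \<noteq> 0" for a b z :: rat using that by simp
    have "2 * n - 0 + 1 = Suc (2 * n)" "2 * n - 2 * 0 + 1 = Suc (2 * n)" "2 * n - 0 = 2 * n" by simp_all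
    then show ?thesis unfolding eig_weight_def c_def 0 by (simp only: qf_Suc power_0 qpochhammer_0 if_True simp_thms key[OF nz])
  next
    case (Suc i)
    obtain j where j: "n = r + j" using le_Suc_ex[OF r] by blast
    define s where "s = r + 2 * j"
    have s: "2 * n - r = s" "2 * n - r + 1 = Suc s" "2 * n + 1 - r = Suc s" "2 * n - 2 * r + 1 = 2 * j + 1" "2 * n - Suc s = i"
      unfolding s_def j Suc by auto
    have nz: "1 - Q ^ Suc s \<noteq> 0" "1 - Q ^ Suc i \<noteq> 0"
      using Qpow_neq[of "Suc s"] Qpow_neq[of "Suc i"] by (simp_all del: power_Suc)
    have p: "(- Q) ^ Suc s = - ((- Q) ^ r * Q ^ (2 * j + 1))" 
    proof -
      have "Suc s = r + (2 * j + 1)" by (simp add: s_def)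
      moreover have "(- Q) ^ (2 * j + 1) = - (Q ^ (2 * j + 1))" by (rule power_minus_odd) simp
      ultimately show ?thesis by (simp only: power_add[of _ r] mult_minus_right)
    qed
    have x: "Q ^ Suc s = Q ^ Suc i * Q ^ (2 * j + 1)" unfolding s_def Suc by (simp add: power_add)
    have nz': "qf s \<noteq> 0" "qf i \<noteq> 0" using qpochhammer_nonzero[OF Q] by auto
    have key: "a * (1 - v) * b / ((S * (1 - y * v)) * (I * (1 - y))) = b * (a / ((I * (1 - y)) * S) + - (a * v) / ((S * (1 - y * v)) * I))"
      if "1 - y * v \<noteq> 0" "1 - y \<noteq> 0" "S \<noteq> 0" "I \<noteq> 0" for a b v y S I :: rat
    proof -
      have k1: "a / ((I * z) * S) = a * w / ((S * w) * (I * z))" if "w \<noteq> 0" for a I z S w :: rat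
        using that by (metis mult.assoc mult.commute mult_divide_mult_cancel_right)
      have k2: "b / ((S * w) * I) = b * z / ((S * w) * (I * z))" if "z \<noteq> 0" for b S w I z :: rat
        using that by (metis mult.assoc mult_divide_mult_cancel_right)
      note k1[OF that(1), of a I "1 - y" S]
      moreover note k2[OF that(2), of "- (a * v)" S "1 - y * v" I]
      ultimately have "a / ((I * (1 - y)) * S) + - (a * v) / ((S * (1 - y * v)) * I) = (a * (1 - y * v) + - (a * v) * (1 - y)) / ((S * (1 - y * v)) * (I * (1 - y)))"
        by (simp only: add_divide_distrib)
      also have "a * (1 - y * v) + - (a * v) * (1 - y) = a * (1 - v)" by (simp add: algebra_simps)
      finally show ?thesis by (simp add: mult_ac)
    qed
    have "(if r = 0 then 0 else c (2 * n + 1 - r)) = - ((- Q) ^ r * Q ^ (2 * j + 1)) / (qf (Suc s) * qf i)"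
      unfolding c_def s p using Suc by (simp del: power_Suc)
    moreover have "c r = (- Q) ^ r / (qf (Suc i) * qf s)" unfolding c_def s using Suc by simp
    moreover have "eig_weight n r = (- Q) ^ r * (1 - Q ^ (2 * j + 1)) * qpochhammer (Q\<^sup>2) (Q\<^sup>2) n / (qf (Suc s) * qf (Suc i))" unfolding eig_weight_def s using Suc by simp
    ultimately show ?thesis using key[OF nz(1)[unfolded x] nz(2) nz'] unfolding qf_Suc x by (simp only:)
  qed
  then have "eig_weight n r * poly (eigen n r) t = qpochhammer (Q\<^sup>2) (Q\<^sup>2) n * ((c r + (if r = 0 then 0 else c (2 * n + 1 - r))) * g r)" if "r \<le> n" for r
    using that by (simp only: eigen_def poly_mult g_def mult.assoc)
  then show ?thesis unfolding e sum_distrib_left by (intro sum.cong) auto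
qed

lemma hp_even: "hp (2 * k) t = qpochhammer t (Q\<^sup>2) k"
proof (induct k)
  case (Suc k)
  have "2 * Suc k = Suc (Suc (2 * k))" "Q ^ (2 * k) = (Q\<^sup>2) ^ k" by (simp_all add: power_mult)
  then show ?case using Suc by (simp only: hp_rec qpochhammer_Suc mult_ac)
qed simp

lemma hp_odd: "hp (2 * k + 1) t = qpochhammer (Q * t) (Q\<^sup>2) k"
proof (induct k)
  case (Suc k)
  have "2 * Suc k + 1 = Suc (Suc (2 * k + 1))" "Q ^ (2 * k + 1) = Q * (Q\<^sup>2) ^ k" by (simp_all add: power_mult)
  then show ?case using Suc by (simp only: hp_rec qpochhammer_Suc mult_ac)
qed simp

lemma qpochhammer_interlace: "qpochhammer (Q\<^sup>2) (Q\<^sup>2) n * qpochhammer Q (Q\<^sup>2) n = qf (2 * n)"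
proof (induct n)
  case (Suc n)
  have "qf (2 * Suc n) = qf (2 * n) * (1 - Q ^ (2 * n + 1)) * (1 - Q ^ (2 * n + 2))" by (simp add: qf_Suc)
  moreover have "Q\<^sup>2 * (Q\<^sup>2) ^ n = Q ^ (2 * n + 2)" "Q * (Q\<^sup>2) ^ n = Q ^ (2 * n + 1)" by (simp_all add: power_mult power2_eq_square)
  moreover have "a * x * (b * y) = c * y * x" if "a * b = c" for a b c x y :: rat using that by (simp add: mult_ac)
  ultimately show ?case using Suc unfolding qpochhammer_Suc by (simp only:)
qed simp

text \<open>
  By invariance under \<open>t \<mapsto> Qt\<close> the polynomial takes the same value at all powers of \<open>Q\<close>, so it is
  constant. At \<open>t = 1\<close> only the term \<open>r = 0\<close> survives, because every other eigenvector has the factor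
  \<open>1 - T\<close>.
\<close>

lemma eigen_expansion: assumes n: "n \<ge> 1" shows "(\<Sum>r\<le>n. smult (eig_weight n r) (eigen n r)) = 1"
proof -
  let ?S = "\<Sum>r\<le>n. smult (eig_weight n r) (eigen n r)"
  have ev: "poly ?S t = qpochhammer (Q\<^sup>2) (Q\<^sup>2) n * sym_sum n t" for t
    unfolding eig_weight_sym_sum[symmetric] by (simp add: poly_sum)
  \<comment> \<open>Starting at \<open>Q\<close> instead of \<open>1\<close> keeps away from the exceptional point \<open>t = 1\<close> of the invariance.\<close>
  have const: "poly ?S (Q ^ Suc k) = poly ?S Q" for k
  proof (induct k)
    case (Suc k)
    have "poly ?S (Q * Q ^ Suc k) = poly ?S (Q ^ Suc k)" unfolding ev using sym_sum_shift[OF n, of "Q ^ Suc k"] Qpow_neq[of "Suc k"] by simp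
    then show ?case using Suc by simp
  qed simp
  have "?S - [:poly ?S Q:] = 0"
  proof (rule ccontr)
    assume "?S - [:poly ?S Q:] \<noteq> 0"
    then have "finite {x. poly (?S - [:poly ?S Q:]) x = 0}" by (rule poly_roots_finite)
    moreover have "range (\<lambda>k. Q ^ Suc k) \<subseteq> {x. poly (?S - [:poly ?S Q:]) x = 0}" using const by auto
    ultimately have "finite (range (\<lambda>k. Q ^ Suc k))" by (rule rev_finite_subset)
    moreover have "inj (\<lambda>k. Q ^ Suc k)" using Q by (intro injI) (simp add: power_inject_exp del: power_Suc)
    ultimately show False using finite_imageD infinite_UNIV_nat by blast
  qed
  then have S: "?S = [:poly ?S Q:]" by simp
  have "poly (eigen n r) 1 = 0" if r: "1 \<le> r" "r \<le> n" for r
  proof (cases "even r")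
    case True
    then obtain k where "r = 2 * k" by auto
    with r obtain i where "r = 2 * Suc i" by (cases k) auto
    then have "hp r 1 = 0" using hp_even[of "Suc i" 1] by (simp add: qpochhammer_Suc_left del: half_poch.simps)
    then show ?thesis by (simp add: eigen_def)
  next
    case False
    then obtain k where k: "r = 2 * k + 1" by (auto elim: oddE)
    then have "2 * n + 1 - r = 2 * Suc (n - k - 1)" using r by auto
    then obtain i where "2 * n + 1 - r = 2 * Suc i" by blast
    then have "hp (2 * n + 1 - r) 1 = 0" using hp_even[of "Suc i" 1] by (simp add: qpochhammer_Suc_left del: half_poch.simps)
    then show ?thesis by (simp add: eigen_def)
  qed
  then have "(\<Sum>r\<le>n. eig_weight n r * poly (eigen n r) 1) = (\<Sum>r\<in>{0}. eig_weight n r * poly (eigen n r) 1)"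
    by (intro sum.mono_neutral_right) auto
  also have "\<dots> = eig_weight n 0 * hp (2 * n + 1) 1" by (simp add: eigen_def)
  also have "\<dots> = 1"
  proof -
    have nz: "1 - Q ^ Suc (2 * n) \<noteq> 0" "qf (2 * n) \<noteq> 0" using Qpow_neq[of "Suc (2 * n)"] qpochhammer_nonzero[OF Q] by auto
    have w: "eig_weight n 0 = (1 - Q ^ Suc (2 * n)) * qpochhammer (Q\<^sup>2) (Q\<^sup>2) n / (qf (2 * n) * (1 - Q ^ Suc (2 * n)))" by (simp add: eig_weight_def qf_Suc del: power_Suc)
    have "eig_weight n 0 * hp (2 * n + 1) 1 = (1 - Q ^ Suc (2 * n)) * (qpochhammer (Q\<^sup>2) (Q\<^sup>2) n * qpochhammer Q (Q\<^sup>2) n) / (qf (2 * n) * (1 - Q ^ Suc (2 * n)))"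
      unfolding w hp_odd by (simp add: mult_ac del: power_Suc)
    then show ?thesis using nz unfolding qpochhammer_interlace by (simp add: mult.commute)
  qed
  finally have "poly ?S 1 = 1" by (simp add: poly_sum)
  moreover have "poly ?S 1 = poly ?S Q" by (subst S) simp
  ultimately have "poly ?S Q = 1" by simp
  then show ?thesis using S by (simp add: one_pCons)
qed

end

section \<open>Torsion-free modules over a discrete valuation ring\<close>

text \<open>
  The uniformizer \<open>p\<close> and a system \<open>S\<close> of representatives of the residue field are parameters, so
  the cardinality of the residue field is \<open>card S\<close>.
\<close>

locale dvr_lattice = module R M + domain R for R (structure) and M (structure) +
  fixes p :: 'a and S :: "'a set"
  assumes p_closed [simp, intro]: "p \<in> carrier R"
    and p_nonzero [simp]: "p \<noteq> \<zero>"
    and p_nonunit: "p \<notin> Units R"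
    and uniformizer: "\<lbrakk>a \<in> carrier R; a \<noteq> \<zero>\<rbrakk> \<Longrightarrow> \<exists>k::nat. \<exists>u\<in>Units R. a = p [^] k \<otimes> u"
    and S_finite: "finite S" and S_closed: "S \<subseteq> carrier R"
    and S_repr: "a \<in> carrier R \<Longrightarrow> \<exists>!s. s \<in> S \<and> a \<ominus> s \<in> PIdl p"
    and torsion_free: "\<lbrakk>r \<in> carrier R; x \<in> carrier M; r \<odot>\<^bsub>M\<^esub> x = \<zero>\<^bsub>M\<^esub>\<rbrakk> \<Longrightarrow> r = \<zero> \<or> x = \<zero>\<^bsub>M\<^esub>"
begin

abbreviation madd (infixl \<open>\<boxplus>\<close> 65) where "x \<boxplus> y \<equiv> x \<oplus>\<^bsub>M\<^esub> y"
abbreviation msub (infixl \<open>\<boxminus>\<close> 65) where "x \<boxminus> y \<equiv> x \<ominus>\<^bsub>M\<^esub> y"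
abbreviation msmult (infixr \<open>\<bullet>\<close> 70) where "r \<bullet> x \<equiv> r \<odot>\<^bsub>M\<^esub> x"
abbreviation mzero (\<open>\<zero>\<^sub>M\<close>) where "\<zero>\<^sub>M \<equiv> \<zero>\<^bsub>M\<^esub>"
abbreviation sub where "sub A \<equiv> submodule A R M"
abbreviation q where "q \<equiv> card S"

definition P :: "nat \<Rightarrow> 'a set" where "P k = {p [^] k \<otimes> c |c. c \<in> carrier R}"

lemma ppow_nz [simp]: "p [^] (k::nat) \<noteq> \<zero>"
  by (induct k) (auto simp: integral_iff)

lemma P_I [intro]: "c \<in> carrier R \<Longrightarrow> p [^] k \<otimes> c \<in> P k"
  unfolding P_def by blast

lemma P_E: assumes "a \<in> P k" obtains c where "c \<in> carrier R" "a = p [^] k \<otimes> c"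
  using assms unfolding P_def by blast

lemma P_closed: "a \<in> P k \<Longrightarrow> a \<in> carrier R"
  by (auto simp: P_def)

lemma P_0 [simp]: "P 0 = carrier R"
proof -
  have "x \<in> P 0" if "x \<in> carrier R" for x using that P_I[of x 0] by simp
  then show ?thesis using P_closed by blast
qed

lemma P_1: "P (Suc 0) = PIdl p"
  unfolding P_def cgenideal_def using R.m_comm by auto

lemma P_zero [simp]: "\<zero> \<in> P k"
  using P_I[of \<zero> k] by simp

lemma P_add [intro]: "\<lbrakk>a \<in> P k; b \<in> P k\<rbrakk> \<Longrightarrow> a \<oplus> b \<in> P k"
  by (elim P_E) (auto simp: R.r_distr[symmetric])

lemma P_minus [intro]: "a \<in> P k \<Longrightarrow> \<ominus> a \<in> P k"
  by (elim P_E) (auto simp: R.r_minus[symmetric])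

lemma P_diff [intro]: "\<lbrakk>a \<in> P k; b \<in> P k\<rbrakk> \<Longrightarrow> a \<ominus> b \<in> P k"
  unfolding R.minus_eq by auto

lemma P_mult [intro]: "\<lbrakk>a \<in> carrier R; b \<in> P k\<rbrakk> \<Longrightarrow> a \<otimes> b \<in> P k"
  by (elim P_E) (auto simp: R.m_lcomm[of a])

lemma P_mult_pow: "\<lbrakk>b \<in> P k\<rbrakk> \<Longrightarrow> p [^] j \<otimes> b \<in> P (j + k)"
  by (elim P_E) (auto simp: R.m_assoc[symmetric] R.nat_pow_mult)

lemma P_mult_pow_iff: assumes "b \<in> carrier R" shows "p [^] j \<otimes> b \<in> P (j + k) \<longleftrightarrow> b \<in> P k"
proof
  assume "p [^] j \<otimes> b \<in> P (j + k)"
  then obtain c where c: "c \<in> carrier R" "p [^] j \<otimes> b = p [^] (j + k) \<otimes> c" by (rule P_E)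
  then have "p [^] j \<otimes> b = p [^] j \<otimes> (p [^] k \<otimes> c)"
    by (simp add: R.m_assoc[symmetric] R.nat_pow_mult)
  then have "b = p [^] k \<otimes> c" using assms c(1) by (subst (asm) m_lcancel) auto
  then show "b \<in> P k" using c by auto
qed (rule P_mult_pow)

lemma P_mult_p_iff: "b \<in> carrier R \<Longrightarrow> p \<otimes> b \<in> P (Suc k) \<longleftrightarrow> b \<in> P k"
  using P_mult_pow_iff[of b 1 k] by simp

lemma P_antimono: "j \<le> k \<Longrightarrow> P k \<subseteq> P j"
proof
  fix a assume "j \<le> k" "a \<in> P k"
  then obtain c where "c \<in> carrier R" "a = p [^] k \<otimes> c" by (auto elim: P_E)
  moreover have "p [^] k = p [^] j \<otimes> p [^] (k - j)" using \<open>j \<le> k\<close> by (simp add: R.nat_pow_mult)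
  ultimately show "a \<in> P j" by (auto simp: R.m_assoc)
qed

lemma P_strict: "p [^] (k::nat) \<notin> P (Suc k)"
proof
  assume "p [^] k \<in> P (Suc k)"
  then have "p [^] k \<otimes> \<one> \<in> P (k + 1)" by simp
  then have "\<one> \<in> P 1" using P_mult_pow_iff[of \<one> k 1] by simp
  then show False using p_nonunit
    by (auto elim!: P_E) (metis Units_one_closed p_closed prod_unit_l unit_factor)
qed

lemma nonunit_in_P: "\<lbrakk>a \<in> carrier R; a \<notin> Units R\<rbrakk> \<Longrightarrow> a \<in> P 1"
proof -
  assume a: "a \<in> carrier R" "a \<notin> Units R"
  show ?thesis
  proof (cases "a = \<zero>")
    case False
    then obtain k :: nat and u where k: "u \<in> Units R" "a = p [^] k \<otimes> u" using uniformizer a by blast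
    then have "k \<noteq> 0" using a by (cases k) auto
    then have "P k \<subseteq> P 1" by (intro P_antimono) auto
    then show ?thesis using k by auto
  qed simp
qed

lemma ideal_is_P:
  assumes zero: "\<zero> \<in> I" and sub: "I \<subseteq> carrier R"
    and mult: "\<And>a b. a \<in> carrier R \<Longrightarrow> b \<in> I \<Longrightarrow> a \<otimes> b \<in> I"
    and nz: "r \<in> I" "r \<noteq> \<zero>"
  obtains k where "I = P k"
proof -
  have 1: "p [^] k \<in> I" if "u \<in> Units R" "p [^] k \<otimes> u \<in> I" for k :: nat and u
    using mult[OF _ that(2), of "inv u"] that(1) by (simp add: R.m_lcomm[of "inv u"] R.Units_closed)
  have ex: "\<exists>k::nat. p [^] k \<in> I" using uniformizer[of r] nz sub 1 by blast
  define k :: nat where "k = (LEAST k. p [^] k \<in> I)"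
  have k: "p [^] k \<in> I" unfolding k_def using ex by (rule LeastI_ex)
  have "I = P k"
  proof
    show "P k \<subseteq> I" using mult[OF _ k] by (auto simp: P_def R.m_comm)
    show "I \<subseteq> P k"
    proof
      fix a assume a: "a \<in> I"
      show "a \<in> P k"
      proof (cases "a = \<zero>")
        case False
        then obtain j :: nat and u where j: "u \<in> Units R" "a = p [^] j \<otimes> u" using uniformizer a sub by blast
        then have "p [^] j \<in> I" using 1 a by blast
        then have "k \<le> j" unfolding k_def by (rule Least_le)
        then have "P j \<subseteq> P k" by (rule P_antimono)
        then show ?thesis using j by auto
      qed simp
    qed
  qed
  then show ?thesis by (rule that)
qed

lemma q_ge_2: "q \<ge> 2"
proof -
  obtain s t where s: "s \<in> S" "\<zero> \<ominus> s \<in> PIdl p" and t: "t \<in> S" "\<one> \<ominus> t \<in> PIdl p"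
    using S_repr[of \<zero>] S_repr[of \<one>] by blast
  have "s \<noteq> t"
  proof
    assume st: "s = t"
    have c: "s \<in> carrier R" using s S_closed by auto
    have "(\<one> \<ominus> t) \<ominus> (\<zero> \<ominus> s) \<in> P 1"
      using P_diff[OF t(2)[folded P_1] s(2)[folded P_1]] by simp
    also have "(\<one> \<ominus> t) \<ominus> (\<zero> \<ominus> s) = \<one>" using c st by algebra
    finally show False using P_strict[of 0] by simp
  qed
  then have "card {s,t} \<le> q" using s t S_finite by (intro card_mono) auto
  then show ?thesis using \<open>s \<noteq> t\<close> by simp
qed

section \<open>Submodules, cosets and indices\<close>

lemma subD: assumes "sub A" shows "A \<subseteq> carrier M" "\<And>x. x \<in> A \<Longrightarrow> x \<in> carrier M" "\<zero>\<^sub>M \<in> A"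
   "\<And>x y. x \<in> A \<Longrightarrow> y \<in> A \<Longrightarrow> x \<boxplus> y \<in> A" "\<And>x y. x \<in> A \<Longrightarrow> y \<in> A \<Longrightarrow> x \<boxminus> y \<in> A"
   "\<And>x. x \<in> A \<Longrightarrow> \<ominus>\<^bsub>M\<^esub> x \<in> A"
   "\<And>r x. r \<in> carrier R \<Longrightarrow> x \<in> A \<Longrightarrow> r \<bullet> x \<in> A"
proof -
  note E = submoduleE[OF assms]
  show "\<And>x. x \<in> A \<Longrightarrow> x \<in> carrier M" using E(1) by auto
  show "A \<subseteq> carrier M" "\<And>x y. x \<in> A \<Longrightarrow> y \<in> A \<Longrightarrow> x \<boxplus> y \<in> A" "\<And>x. x \<in> A \<Longrightarrow> \<ominus>\<^bsub>M\<^esub> x \<in> A"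
     "\<And>r x. r \<in> carrier R \<Longrightarrow> x \<in> A \<Longrightarrow> r \<bullet> x \<in> A" using E by auto
  show "\<zero>\<^sub>M \<in> A" using subgroup.one_closed[OF submodule.axioms(1)[OF assms]] by simp
  show "\<And>x y. x \<in> A \<Longrightarrow> y \<in> A \<Longrightarrow> x \<boxminus> y \<in> A" using E unfolding a_minus_def by auto
qed

lemma subI: assumes "A \<subseteq> carrier M" "\<zero>\<^sub>M \<in> A"
   "\<And>x y. x \<in> A \<Longrightarrow> y \<in> A \<Longrightarrow> x \<boxplus> y \<in> A" 
   "\<And>r x. r \<in> carrier R \<Longrightarrow> x \<in> A \<Longrightarrow> r \<bullet> x \<in> A"
  shows "sub A"
proof (rule submoduleI)
  fix a assume "a \<in> A"
  then show "\<ominus>\<^bsub>M\<^esub> a \<in> A" using assms(4)[of "\<ominus> \<one>" a] assms(1) by (auto simp: smult_l_minus)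
qed (use assms in auto)

lemma msub_zero [simp]: "x \<in> carrier M \<Longrightarrow> x \<boxminus> \<zero>\<^sub>M = x"
  using M.r_neg[of "\<zero>\<^sub>M"] by (simp add: M.minus_eq)

lemma sub_add_iff: "\<lbrakk>sub A; x \<in> A; y \<in> carrier M\<rbrakk> \<Longrightarrow> x \<boxplus> y \<in> A \<longleftrightarrow> y \<in> A"
  "\<lbrakk>sub A; x \<in> A; y \<in> carrier M\<rbrakk> \<Longrightarrow> y \<boxplus> x \<in> A \<longleftrightarrow> y \<in> A"
proof -
  assume *: "sub A" "x \<in> A" "y \<in> carrier M"
  have "y = (y \<boxplus> x) \<boxminus> x" using * subD[OF *(1)] 
    by (simp add: M.minus_eq M.a_assoc M.r_neg)
  then show 1: "y \<boxplus> x \<in> A \<longleftrightarrow> y \<in> A" using subD[OF *(1)] * by metis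
  then show "x \<boxplus> y \<in> A \<longleftrightarrow> y \<in> A" using * subD[OF *(1)] by (simp add: M.a_comm)
qed

lemma sub_unit_iff: "\<lbrakk>sub A; u \<in> Units R; x \<in> carrier M\<rbrakk> \<Longrightarrow> u \<bullet> x \<in> A \<longleftrightarrow> x \<in> A"
proof -
  assume *: "sub A" "u \<in> Units R" "x \<in> carrier M"
  have "x = inv u \<bullet> (u \<bullet> x)" using * by (simp add: smult_assoc1[symmetric] R.Units_closed)
  then show ?thesis using * subD(7)[OF *(1), of "inv u"] subD(7)[OF *(1), of u] by (metis R.Units_closed R.Units_inv_closed)
qed

lemma sub_Int: "\<lbrakk>sub A; sub B\<rbrakk> \<Longrightarrow> sub (A \<inter> B)"
  by (rule subI) (use subD in auto)

abbreviation cs :: "'c set \<Rightarrow> 'c \<Rightarrow> 'c set" where "cs A x \<equiv> A +>\<^bsub>M\<^esub> x"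

lemma cs_eq_iff: assumes "sub A" "x \<in> carrier M" "y \<in> carrier M"
  shows "cs A x = cs A y \<longleftrightarrow> x \<boxminus> y \<in> A"
proof -
  note s = subD[OF assms(1)]
  have x: "x = (x \<boxminus> y) \<boxplus> y" using assms by (simp add: M.minus_eq M.a_assoc M.l_neg)
  have y: "y = \<ominus>\<^bsub>M\<^esub> (x \<boxminus> y) \<boxplus> x" using assms by (simp add: M.minus_eq M.minus_add M.a_assoc M.a_comm[of y] M.r_neg1)
  have "z \<boxplus> x = (z \<boxplus> (x \<boxminus> y)) \<boxplus> y" if "z \<in> carrier M" for z
    using that assms by (subst x) (simp add: M.a_assoc)
  moreover have "z \<boxplus> y = (z \<boxminus> (x \<boxminus> y)) \<boxplus> x" if "z \<in> carrier M" for z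
    using that assms by (subst y) (simp add: M.a_assoc M.minus_eq)
  ultimately have "cs A x = cs A y" if "x \<boxminus> y \<in> A"
    using that s unfolding a_r_coset_def' set_eq_iff
    by simp metis
  moreover have "x \<boxminus> y \<in> A" if "cs A x = cs A y"
  proof -
    have "x \<in> cs A x" using s assms unfolding a_r_coset_def' by (auto intro!: bexI[of _ "\<zero>\<^sub>M"])
    then have "x \<in> cs A y" using that by simp
    then obtain a where "a \<in> A" "x = a \<boxplus> y" unfolding a_r_coset_def' by auto
    then show ?thesis using s assms by (simp add: M.minus_eq M.a_assoc M.r_neg)
  qed
  ultimately show ?thesis by blast
qed

text \<open>
  Infinite index gives the value \<open>0\<close>; accordingly, finiteness of an index is written \<open>idx B A \<noteq> 0\<close>
  below.
\<close>

definition idx :: "'c set \<Rightarrow> 'c set \<Rightarrow> nat" where "idx B A = card (cs A ` B)"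

lemma card_image_cong_rel:
  assumes "\<And>x y. x \<in> B \<Longrightarrow> y \<in> B \<Longrightarrow> F x = F y \<longleftrightarrow> G x = G y"
  shows "card (F ` B) = card (G ` B)"
proof -
  obtain T where T: "T \<subseteq> B" "inj_on F T" "F ` B = F ` T"
    using subset_image_inj[of "F ` B" F B] by auto
  have "inj_on G T"
  proof (rule inj_onI)
    fix x y assume "x \<in> T" "y \<in> T" "G x = G y"
    then show "x = y" using assms[of x y] inj_onD[OF T(2)] T(1) by blast
  qed
  moreover have "G ` B = G ` T"
  proof -
    have "G x \<in> G ` T" if "x \<in> B" for x
    proof -
      from that T obtain t where t: "t \<in> T" "F x = F t" by auto
      then have "G x = G t" using assms that T by blast
      then show ?thesis using t by blast
    qed
    then show ?thesis using T by blast
  qed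
  ultimately show ?thesis using T by (simp add: card_image)
qed

text \<open>
  Sums of representatives form a transversal. Infinite indices are covered, because the cardinality
  of an infinite product of nonempty sets is also \<open>0\<close>.
\<close>

lemma idx_mult: assumes "sub A" "sub B" "sub C" "A \<subseteq> B" "B \<subseteq> C"
  shows "idx C A = idx C B * idx B A"
proof -
  obtain T where T: "T \<subseteq> C" "inj_on (cs B) T" "cs B ` C = cs B ` T"
    using subset_image_inj[of "cs B ` C" "cs B" C] by auto
  obtain T' where T': "T' \<subseteq> B" "inj_on (cs A) T'" "cs A ` B = cs A ` T'"
    using subset_image_inj[of "cs A ` B" "cs A" B] by auto
  note s = subD[OF assms(1)] subD[OF assms(2)] subD[OF assms(3)]
  let ?f = "\<lambda>(x,y). cs A (x \<boxplus> y)"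
  have "inj_on ?f (T \<times> T')"
  proof (rule inj_onI, clarify)
    fix x y x' y' assume *: "x \<in> T" "y \<in> T'" "x' \<in> T" "y' \<in> T'" "cs A (x \<boxplus> y) = cs A (x' \<boxplus> y')"
    have c: "x \<in> carrier M" "y \<in> carrier M" "x' \<in> carrier M" "y' \<in> carrier M" "y \<in> B" "y' \<in> B"
      using * T T' s by auto
    have d: "(x \<boxplus> y) \<boxminus> (x' \<boxplus> y') \<in> A" using *(5) c by (subst (asm) cs_eq_iff) (auto intro: assms)
    have e: "(x \<boxplus> y) \<boxminus> (x' \<boxplus> y') = (x \<boxminus> x') \<boxplus> (y \<boxminus> y')" using c
      by (simp add: M.minus_eq M.minus_add M.a_ac)
    have "x \<boxminus> x' \<in> B"
    proof -
      have "y \<boxminus> y' \<in> B" using c s by auto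
      then show ?thesis using d e assms(4) sub_add_iff(2)[OF assms(2), of "y \<boxminus> y'" "x \<boxminus> x'"] c by auto
    qed
    then have "cs B x = cs B x'" using c assms by (subst cs_eq_iff) auto
    then have x: "x = x'" using T * by (auto simp: inj_on_def)
    then have "y \<boxminus> y' \<in> A" using d e c by (simp add: M.minus_eq M.r_neg)
    then have "cs A y = cs A y'" using c assms by (subst cs_eq_iff) auto
    then show "x = x' \<and> y = y'" using x T' * by (auto simp: inj_on_def)
  qed
  moreover have "?f ` (T \<times> T') = cs A ` C"
  proof -
    have "cs A z \<in> ?f ` (T \<times> T')" if z: "z \<in> C" for z
    proof -
      obtain x where x: "x \<in> T" "cs B z = cs B x" using T z by blast
      have c: "x \<in> carrier M" "z \<in> carrier M" using x z s T by auto
      have "z \<boxminus> x \<in> B" using x c by (subst (asm) cs_eq_iff) (auto intro: assms)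
      then obtain y where y: "y \<in> T'" "cs A (z \<boxminus> x) = cs A y" using T' by blast
      have c': "y \<in> carrier M" using y s T' by auto
      have "(z \<boxminus> x) \<boxminus> y \<in> A" using y c c' by (subst (asm) cs_eq_iff) (auto intro: assms)
      also have "(z \<boxminus> x) \<boxminus> y = z \<boxminus> (x \<boxplus> y)" using c c' by (simp add: M.minus_eq M.minus_add M.a_ac)
      finally have "cs A z = cs A (x \<boxplus> y)" using c c' assms by (subst cs_eq_iff) auto
      then show ?thesis using x y by auto
    qed
    then show ?thesis using T T' s assms by (auto simp: subset_iff)
  qed
  ultimately have "card (cs A ` C) = card (T \<times> T')" by (metis card_image)
  then show ?thesis unfolding idx_def T(3) T'(3) using T T' by (simp add: card_image card_cartesian_product)
qed

lemma idx_self: "sub A \<Longrightarrow> idx A A = 1"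
proof -
  assume A: "sub A"
  have "cs A x = cs A \<zero>\<^sub>M" if "x \<in> A" for x
    using that subD[OF A] A by (subst cs_eq_iff) (auto simp: M.minus_eq)
  then have "cs A ` A = {cs A \<zero>\<^sub>M}" using subD[OF A] by auto
  then show ?thesis by (simp add: idx_def)
qed

lemma idx_1_imp_eq: assumes "sub A" "sub B" "A \<subseteq> B" "idx B A = 1" shows "A = B"
proof -
  obtain c where c: "cs A ` B = {c}" using assms(4) unfolding idx_def by (auto simp: card_1_singleton_iff)
  have "x \<in> A" if "x \<in> B" for x
  proof -
    have "cs A x \<in> {c}" "cs A \<zero>\<^sub>M \<in> {c}" unfolding c[symmetric] using that subD(3)[OF assms(2)] by auto
    then have "cs A x = cs A \<zero>\<^sub>M" by simp
    then show ?thesis using that subD[OF assms(2)] assms by (subst (asm) cs_eq_iff) auto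
  qed
  then show ?thesis using assms by auto
qed

definition ext :: "'c set \<Rightarrow> 'c \<Rightarrow> 'c set" where "ext A x = {a \<boxplus> r \<bullet> x |a r. a \<in> A \<and> r \<in> carrier R}"

lemma ext_I: "\<lbrakk>a \<in> A; r \<in> carrier R\<rbrakk> \<Longrightarrow> a \<boxplus> r \<bullet> x \<in> ext A x"
  unfolding ext_def by blast

lemma ext_E: assumes "y \<in> ext A x" obtains a r where "a \<in> A" "r \<in> carrier R" "y = a \<boxplus> r \<bullet> x"
  using assms unfolding ext_def by blast

lemma ext_sub: assumes "sub A" "x \<in> carrier M" shows "sub (ext A x)"
proof (rule subI)
  note s = subD[OF assms(1)]
  show "ext A x \<subseteq> carrier M" using s assms by (auto elim!: ext_E)
  show "\<zero>\<^sub>M \<in> ext A x" using ext_I[of "\<zero>\<^sub>M" A \<zero> x] s assms by simp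
  show "y \<boxplus> z \<in> ext A x" if yz: "y \<in> ext A x" "z \<in> ext A x" for y z
  proof -
    obtain a r b t where *: "a \<in> A" "r \<in> carrier R" "y = a \<boxplus> r \<bullet> x" "b \<in> A" "t \<in> carrier R" "z = b \<boxplus> t \<bullet> x"
      using yz by (auto elim!: ext_E)
    have "y \<boxplus> z = (a \<boxplus> b) \<boxplus> (r \<oplus> t) \<bullet> x" using * assms s by (simp add: smult_l_distr M.a_ac)
    then show ?thesis using * s ext_I by simp
  qed
  show "r \<bullet> y \<in> ext A x" if ry: "r \<in> carrier R" "y \<in> ext A x" for r y
  proof -
    obtain a t where *: "a \<in> A" "t \<in> carrier R" "y = a \<boxplus> t \<bullet> x" using ry by (auto elim!: ext_E)
    have "r \<bullet> y = r \<bullet> a \<boxplus> (r \<otimes> t) \<bullet> x" using * assms s ry by (simp add: smult_r_distr smult_assoc1)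
    then show ?thesis using * s ext_I ry by simp
  qed
qed

lemma ext_incl: "\<lbrakk>sub A; x \<in> carrier M\<rbrakk> \<Longrightarrow> A \<subseteq> ext A x"
proof
  fix a assume "sub A" "x \<in> carrier M" "a \<in> A"
  then show "a \<in> ext A x" using ext_I[of a A \<zero> x] subD[of A] by auto
qed

lemma ext_mem: "\<lbrakk>sub A; x \<in> carrier M\<rbrakk> \<Longrightarrow> x \<in> ext A x"
  using ext_I[of "\<zero>\<^sub>M" A \<one> x] subD[of A] by simp

lemma ext_least: "\<lbrakk>sub B; A \<subseteq> B; x \<in> B\<rbrakk> \<Longrightarrow> ext A x \<subseteq> B"
  using subD[of B] by (auto elim!: ext_E)

lemma ext_absorb: "\<lbrakk>sub A; x \<in> A\<rbrakk> \<Longrightarrow> ext A x = A"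
  using ext_least[of A A x] ext_incl[of A x] subD by blast

lemma idx_line: assumes "sub A" "x \<in> carrier M" "x \<notin> A" "p \<bullet> x \<in> A" shows "idx (ext A x) A = q"
proof -
  note s = subD[OF assms(1)]
  have "cs A ` ext A x = (\<lambda>r. cs A (r \<bullet> x)) ` S"
  proof -
    have "cs A (a \<boxplus> r \<bullet> x) \<in> (\<lambda>r. cs A (r \<bullet> x)) ` S" if ar: "a \<in> A" "r \<in> carrier R" for a r
    proof -
      obtain t where t: "t \<in> S" "r \<ominus> t \<in> PIdl p" using S_repr[OF ar(2)] by blast
      then obtain c where c: "c \<in> carrier R" "r \<ominus> t = c \<otimes> p" unfolding cgenideal_def by blast
      have tc: "t \<in> carrier R" using t S_closed by auto
      have "(a \<boxplus> r \<bullet> x) \<boxminus> t \<bullet> x = a \<boxplus> (r \<ominus> t) \<bullet> x" using ar s assms tc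
        by (simp add: M.minus_eq R.minus_eq smult_l_distr smult_l_minus M.a_assoc)
      also have "\<dots> = a \<boxplus> c \<bullet> p \<bullet> x" using c assms by (simp add: smult_assoc1)
      also have "\<dots> \<in> A" using s ar c assms by auto
      finally have "cs A (a \<boxplus> r \<bullet> x) = cs A (t \<bullet> x)" using s assms tc ar by (subst cs_eq_iff) auto
      then show ?thesis using t by auto
    qed
    moreover have "r \<bullet> x \<in> ext A x" if "r \<in> S" for r
      using subD(7)[OF ext_sub ] ext_mem assms that S_closed by blast
    ultimately show ?thesis by (auto elim!: ext_E)
  qed
  moreover have "inj_on (\<lambda>r. cs A (r \<bullet> x)) S"
  proof (rule inj_onI)
    fix r t assume rt: "r \<in> S" "t \<in> S" "cs A (r \<bullet> x) = cs A (t \<bullet> x)"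
    have c: "r \<in> carrier R" "t \<in> carrier R" using rt S_closed by auto
    have "r \<bullet> x \<boxminus> t \<bullet> x \<in> A" using rt c assms by (subst (asm) cs_eq_iff) auto
    also have "r \<bullet> x \<boxminus> t \<bullet> x = (r \<ominus> t) \<bullet> x" using c assms
        by (simp add: M.minus_eq R.minus_eq smult_l_distr smult_l_minus)
    finally have "r \<ominus> t \<notin> Units R" using sub_unit_iff[OF assms(1), of "r \<ominus> t" x] assms by blast
    then have "r \<ominus> t \<in> PIdl p" using nonunit_in_P[of "r \<ominus> t"] c by (simp add: P_1)
    moreover have "r \<ominus> r \<in> PIdl p" using P_zero[of "Suc 0"] c unfolding P_1 by (simp add: R.minus_eq R.r_neg)
    ultimately show "r = t" using S_repr[OF c(1)] rt by blast
  qed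
  ultimately show ?thesis unfolding idx_def by (simp add: card_image)
qed

text \<open>
  The submodules \<open>A + R p^i x\<close> for \<open>i = 0, ..., k\<close> form a chain with steps of index \<open>q\<close>.
\<close>

lemma idx_cyclic: 
  assumes "sub A" "x \<in> carrier M" "\<And>r. r \<in> carrier R \<Longrightarrow> r \<bullet> x \<in> A \<longleftrightarrow> r \<in> P k"
  shows "idx (ext A x) A = q ^ k"
  using assms
proof (induct k arbitrary: x)
  case 0
  then have "x \<in> A" using 0(3)[of \<one>] by simp
  then show ?case using 0 by (simp add: ext_absorb idx_self)
next
  case (Suc k)
  have r: "r \<bullet> p \<bullet> x \<in> A \<longleftrightarrow> r \<in> P k" if "r \<in> carrier R" for r
    using Suc(4)[of "p \<otimes> r"] that P_mult_p_iff[OF that, of k] Suc(3)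
    by (simp add: smult_assoc1[symmetric] R.m_comm)
  have 1: "idx (ext A (p \<bullet> x)) A = q ^ k" by (rule Suc(1)) (use r Suc in auto)
  let ?B = "ext A (p \<bullet> x)"
  have B: "sub ?B" using Suc by (intro ext_sub) auto
  have in_B: "p \<bullet> x \<in> ?B" using Suc by (intro ext_mem) auto
  have "x \<notin> ?B"
  proof
    assume "x \<in> ?B"
    then obtain a r where ar: "a \<in> A" "r \<in> carrier R" "x = a \<boxplus> r \<bullet> p \<bullet> x" by (rule ext_E)
    have "(\<one> \<ominus> r \<otimes> p) \<bullet> x = x \<boxminus> r \<bullet> p \<bullet> x" using ar Suc
      by (simp add: M.minus_eq R.minus_eq smult_l_distr smult_l_minus smult_assoc1)
    also have "\<dots> = (a \<boxplus> r \<bullet> p \<bullet> x) \<boxminus> r \<bullet> p \<bullet> x" using ar by simp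
    also have "\<dots> = a" using subD[OF Suc(2)] ar(1,2) Suc(3) by (simp add: M.minus_eq M.a_assoc M.r_neg)
    finally have "\<one> \<ominus> r \<otimes> p \<in> P (Suc k)" using Suc(4)[of "\<one> \<ominus> r \<otimes> p"] ar by simp
    then have a: "\<one> \<ominus> r \<otimes> p \<in> P 1" using P_antimono[of 1 "Suc k"] by auto
    have b: "r \<otimes> p \<in> P 1" using ar P_I[of r 1] by (simp add: R.m_comm)
    have "\<one> = (\<one> \<ominus> r \<otimes> p) \<oplus> r \<otimes> p" using ar(2) p_closed by algebra
    then have "\<one> \<in> P 1" using P_add[OF a b] by simp
    then show False using P_strict[of 0] by simp
  qed
  then have 2: "idx (ext ?B x) ?B = q" using B in_B Suc by (intro idx_line) auto
  have inA: "A \<subseteq> ?B" using Suc by (intro ext_incl) auto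
  have "ext ?B x = ext A x"
  proof
    have "p \<bullet> x \<in> ext A x" using Suc by (intro subD(7)[OF ext_sub] ext_mem) auto
    then show "ext ?B x \<subseteq> ext A x" using Suc by (intro ext_least ext_sub ext_incl ext_mem) auto
    show "ext A x \<subseteq> ext ?B x" using Suc B inA ext_incl[of ?B x] by (intro ext_least ext_sub ext_mem) auto
  qed
  moreover have "idx (ext ?B x) A = idx (ext ?B x) ?B * idx ?B A"
    using Suc B inA by (intro idx_mult ext_sub ext_incl) auto
  ultimately show ?case using 1 2 by simp
qed

text \<open>
  The multipliers of \<open>x\<close> into \<open>A\<close> form an ideal. It cannot be zero: otherwise \<open>A + R p^k x\<close> would
  have index \<open>q^k\<close> in \<open>A + R x\<close> for every \<open>k\<close>, and the index of \<open>A\<close> would be divisible by all powers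
  of \<open>q\<close>.
\<close>

lemma conductor:
  assumes "sub A" "x \<in> carrier M" "idx (ext A x) A \<noteq> 0"
  obtains k where "\<And>r. r \<in> carrier R \<Longrightarrow> r \<bullet> x \<in> A \<longleftrightarrow> r \<in> P k"
proof -
  let ?I = "{r \<in> carrier R. r \<bullet> x \<in> A}"
  note s = subD[OF assms(1)]
  have "\<exists>r\<in>?I. r \<noteq> \<zero>"
  proof (rule ccontr)
    assume "\<not> ?thesis"
    then have z: "r = \<zero>" if "r \<in> carrier R" "r \<bullet> x \<in> A" for r using that by auto
    have "q ^ k dvd idx (ext A x) A" for k
    proof -
      let ?B = "ext A (p [^] k \<bullet> x)"
      have B: "sub ?B" "A \<subseteq> ?B" using assms by (auto intro!: ext_sub ext_incl[THEN subsetD])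
      have BC: "?B \<subseteq> ext A x" using assms by (intro ext_least ext_sub ext_incl subD(7)[OF ext_sub] ext_mem) auto
      have "r \<bullet> x \<in> ?B \<longleftrightarrow> r \<in> P k" if r: "r \<in> carrier R" for r
      proof
        assume "r \<bullet> x \<in> ?B"
        then obtain a t where at: "a \<in> A" "t \<in> carrier R" "r \<bullet> x = a \<boxplus> t \<bullet> p [^] k \<bullet> x" by (rule ext_E)
        have "(r \<ominus> t \<otimes> p [^] k) \<bullet> x = r \<bullet> x \<boxminus> t \<bullet> p [^] k \<bullet> x" using at(2) assms r
          by (simp add: M.minus_eq R.minus_eq smult_l_distr smult_l_minus smult_assoc1)
        also have "\<dots> = a" unfolding at(3) using s at(1,2) assms(2) by (simp add: M.minus_eq M.a_assoc M.r_neg)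
        finally have "r \<ominus> t \<otimes> p [^] k = \<zero>" using z at r by simp
        then have "r = p [^] k \<otimes> t" using r at(2) by (simp add: R.m_comm)
        then show "r \<in> P k" using at by auto
      next
        assume "r \<in> P k"
        then obtain c where "c \<in> carrier R" "r = p [^] k \<otimes> c" by (rule P_E)
        then have "r \<bullet> x = c \<bullet> p [^] k \<bullet> x" using assms by (simp add: smult_assoc1[symmetric] R.m_comm)
        then show "r \<bullet> x \<in> ?B" using \<open>c \<in> carrier R\<close> assms by (auto intro!: subD(7)[OF B(1)] ext_mem)
      qed
      then have "idx (ext ?B x) ?B = q ^ k" using B assms by (intro idx_cyclic) auto
      moreover have "ext ?B x = ext A x"
        using assms B BC ext_incl[of ?B x] ext_mem[of A x]
        by (intro equalityI ext_least[of _ ?B x] ext_least[of _ A x] ext_sub ext_mem) auto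
      moreover have "idx (ext A x) A = idx (ext A x) ?B * idx ?B A"
        using assms B BC by (intro idx_mult ext_sub) auto
      ultimately show ?thesis by simp
    qed
    then have "q ^ idx (ext A x) A \<le> idx (ext A x) A" using assms(3) by (intro dvd_imp_le) auto
    moreover have "idx (ext A x) A < q ^ idx (ext A x) A" using q_ge_2 by (intro power_gt_expt) auto
    ultimately show False by simp
  qed
  then obtain r where r: "r \<in> ?I" "r \<noteq> \<zero>" by blast
  obtain k where "?I = P k"
  proof (rule ideal_is_P[of ?I r])
    show "a \<otimes> b \<in> ?I" if "a \<in> carrier R" "b \<in> ?I" for a b
      using that s assms by (auto simp: smult_assoc1)
  qed (use r s assms in auto)
  then show ?thesis using that by blast
qed

definition scale :: "'a \<Rightarrow> 'c set \<Rightarrow> 'c set" where "scale r A = (\<lambda>x. r \<bullet> x) ` A"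

lemma scale_sub: assumes "sub A" "r \<in> carrier R" shows "sub (scale r A)"
proof (rule subI)
  note s = subD[OF assms(1)]
  show "scale r A \<subseteq> carrier M" using s assms unfolding scale_def by auto
  show "\<zero>\<^sub>M \<in> scale r A" using s assms unfolding scale_def by (auto intro!: image_eqI[of _ _ "\<zero>\<^sub>M"])
  show "x \<boxplus> y \<in> scale r A" if xy: "x \<in> scale r A" "y \<in> scale r A" for x y
  proof -
    obtain a b where "x = r \<bullet> a" "y = r \<bullet> b" "a \<in> A" "b \<in> A" using xy unfolding scale_def by blast
    then show ?thesis using s assms unfolding scale_def by (auto intro!: image_eqI[of _ _ "a \<boxplus> b"] simp: smult_r_distr)
  qed
  show "t \<bullet> x \<in> scale r A" if tx: "t \<in> carrier R" "x \<in> scale r A" for t x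
  proof -
    obtain a where "x = r \<bullet> a" "a \<in> A" using tx unfolding scale_def by auto
    then show ?thesis using s assms that unfolding scale_def 
      by (auto intro!: image_eqI[of _ _ "t \<bullet> a"] simp: smult_assoc1[symmetric] R.m_comm)
  qed
qed

lemma smult_cancel: "\<lbrakk>r \<in> carrier R; r \<noteq> \<zero>; x \<in> carrier M; y \<in> carrier M; r \<bullet> x = r \<bullet> y\<rbrakk> \<Longrightarrow> x = y"
proof -
  assume *: "r \<in> carrier R" "r \<noteq> \<zero>" "x \<in> carrier M" "y \<in> carrier M" "r \<bullet> x = r \<bullet> y"
  have "r \<bullet> (x \<boxminus> y) = r \<bullet> x \<boxminus> r \<bullet> y" using *(1-4) by (simp add: M.minus_eq smult_r_distr smult_r_minus)
  then have "r \<bullet> (x \<boxminus> y) = \<zero>\<^sub>M" using * by (simp add: M.minus_eq M.r_neg)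
  then have "x \<boxminus> y = \<zero>\<^sub>M" using torsion_free[of r "x \<boxminus> y"] * by auto
  then have "(x \<boxminus> y) \<boxplus> y = \<zero>\<^sub>M \<boxplus> y" by simp
  then show "x = y" using * by (simp add: M.minus_eq M.a_assoc M.l_neg)
qed

lemma scale_mem_iff: assumes "sub A" "r \<in> carrier R" "r \<noteq> \<zero>" "x \<in> carrier M" shows "r \<bullet> x \<in> scale r A \<longleftrightarrow> x \<in> A"
  using smult_cancel[OF assms(2,3)] assms(4) subD[OF assms(1)] unfolding scale_def by blast

lemma scale_incl: "\<lbrakk>sub A; r \<in> carrier R\<rbrakk> \<Longrightarrow> scale r A \<subseteq> A"
  unfolding scale_def using subD by auto

lemma idx_scale: assumes "sub A" "sub B" "A \<subseteq> B" "r \<in> carrier R" "r \<noteq> \<zero>"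
  shows "idx (scale r B) (scale r A) = idx B A"
proof -
  have "card ((cs (scale r A) \<circ> (\<lambda>x. r \<bullet> x)) ` B) = card (cs A ` B)"
  proof (rule card_image_cong_rel)
    fix x y assume xy: "x \<in> B" "y \<in> B"
    have c: "x \<in> carrier M" "y \<in> carrier M" using xy assms subD by blast+
    have "r \<bullet> x \<boxminus> r \<bullet> y = r \<bullet> (x \<boxminus> y)" using c assms by (simp add: M.minus_eq smult_r_distr smult_r_minus)
    then have "cs (scale r A) (r \<bullet> x) = cs (scale r A) (r \<bullet> y) \<longleftrightarrow> r \<bullet> (x \<boxminus> y) \<in> scale r A"
      using c assms by (subst cs_eq_iff) (auto intro: scale_sub)
    also have "\<dots> \<longleftrightarrow> x \<boxminus> y \<in> A" using c assms by (intro scale_mem_iff) auto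
    also have "\<dots> \<longleftrightarrow> cs A x = cs A y" using c assms by (subst cs_eq_iff) auto
    finally show "(cs (scale r A) \<circ> (\<lambda>x. r \<bullet> x)) x = (cs (scale r A) \<circ> (\<lambda>x. r \<bullet> x)) y \<longleftrightarrow> cs A x = cs A y" by simp
  qed
  then show ?thesis unfolding idx_def scale_def by (simp add: image_comp)
qed

end

section \<open>Submodules of an extension by one generator\<close>

text \<open>
  The coefficients of \<open>1 / ((1 - T)(1 - QT) ... (1 - Q^(m-1) T))\<close>.
\<close>

fun subcount :: "nat \<Rightarrow> nat \<Rightarrow> nat \<Rightarrow> nat" where
  "subcount Q 0 j = (if j = 0 then 1 else 0)"
| "subcount Q (Suc m) j = (\<Sum>i\<le>j. Q ^ i * subcount Q m i)"

context dvr_lattice begin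

definition msum :: "'c set \<Rightarrow> 'c set \<Rightarrow> 'c set" where "msum A B = {a \<boxplus> b |a b. a \<in> A \<and> b \<in> B}"

lemma msum_I: "\<lbrakk>a \<in> A; b \<in> B\<rbrakk> \<Longrightarrow> a \<boxplus> b \<in> msum A B"
  unfolding msum_def by blast

lemma msum_E: assumes "y \<in> msum A B" obtains a b where "a \<in> A" "b \<in> B" "y = a \<boxplus> b"
  using assms unfolding msum_def by blast

lemma msum_sub: assumes "sub A" "sub B" shows "sub (msum A B)"
proof (rule subI)
  note s = subD[OF assms(1)] subD[OF assms(2)]
  show "msum A B \<subseteq> carrier M" using s by (auto elim!: msum_E)
  show "\<zero>\<^sub>M \<in> msum A B" using msum_I[of "\<zero>\<^sub>M" A "\<zero>\<^sub>M" B] s by simp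
  show "x \<boxplus> y \<in> msum A B" if xy: "x \<in> msum A B" "y \<in> msum A B" for x y
  proof -
    obtain a b c d where *: "a \<in> A" "b \<in> B" "x = a \<boxplus> b" "c \<in> A" "d \<in> B" "y = c \<boxplus> d"
      using xy by (auto elim!: msum_E)
    have "x \<boxplus> y = (a \<boxplus> c) \<boxplus> (b \<boxplus> d)" using * s by (simp add: M.a_ac)
    then show ?thesis using * s msum_I by simp
  qed
  show "r \<bullet> x \<in> msum A B" if rx: "r \<in> carrier R" "x \<in> msum A B" for r x
  proof -
    obtain a b where *: "a \<in> A" "b \<in> B" "x = a \<boxplus> b" using rx by (auto elim!: msum_E)
    have "r \<bullet> x = r \<bullet> a \<boxplus> r \<bullet> b" using * rx s by (simp add: smult_r_distr)
    then show ?thesis using * rx s msum_I by simp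
  qed
qed

lemma msum_incl: "\<lbrakk>sub A; sub B\<rbrakk> \<Longrightarrow> A \<subseteq> msum A B" "\<lbrakk>sub A; sub B\<rbrakk> \<Longrightarrow> B \<subseteq> msum A B"
proof -
  assume s: "sub A" "sub B"
  show "A \<subseteq> msum A B"
  proof
    fix x assume "x \<in> A" then show "x \<in> msum A B" 
      using msum_I[of x A "\<zero>\<^sub>M" B] subD(2)[OF s(1)] subD(3)[OF s(2)] by simp
  qed
  show "B \<subseteq> msum A B"
  proof
    fix x assume "x \<in> B" then show "x \<in> msum A B" 
      using msum_I[of "\<zero>\<^sub>M" A x B] subD(2)[OF s(2)] subD(3)[OF s(1)] by simp
  qed
qed

lemma msum_least: "\<lbrakk>sub C; A \<subseteq> C; B \<subseteq> C\<rbrakk> \<Longrightarrow> msum A B \<subseteq> C"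
  using subD(4)[of C] by (auto elim!: msum_E)

lemma idx_msum: assumes "sub A" "sub B" shows "idx (msum A B) B = idx A (A \<inter> B)"
proof -
  note s = subD[OF assms(1)] subD[OF assms(2)]
  have "cs B ` msum A B = cs B ` A"
  proof -
    have "cs B (a \<boxplus> b) = cs B a" if "a \<in> A" "b \<in> B" for a b
    proof -
      have "(a \<boxplus> b) \<boxminus> a = b" using that s by (simp add: M.minus_eq M.a_assoc M.a_comm[of b] M.r_neg2)
      then show ?thesis using that s assms by (subst cs_eq_iff) auto
    qed
    then have "cs B ` msum A B \<subseteq> cs B ` A" by (auto elim!: msum_E)
    then show ?thesis using msum_incl[OF assms] by blast
  qed
  moreover have "card (cs B ` A) = card (cs (A \<inter> B) ` A)"
    using s assms by (intro card_image_cong_rel) (subst (1 2) cs_eq_iff, auto intro: sub_Int)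
  ultimately show ?thesis unfolding idx_def by simp
qed

lemma ext_between: assumes "sub U" "b \<in> carrier M" "sub C" "U \<subseteq> C" "C \<subseteq> ext U b" shows "ext C b = ext U b"
proof
  show "ext C b \<subseteq> ext U b" using assms by (intro ext_least ext_sub ext_mem) auto
  show "ext U b \<subseteq> ext C b" using assms ext_incl[of C b] by (intro ext_least ext_sub ext_mem) auto
qed

definition indep :: "'c set \<Rightarrow> 'c \<Rightarrow> bool" where
  "indep U b \<longleftrightarrow> b \<in> carrier M \<and> (\<forall>r\<in>carrier R. r \<bullet> b \<in> U \<longrightarrow> r = \<zero>)"

text \<open>
  One step of a Hermite normal form: submodules of \<open>U + Rb\<close> are sorted by their intersection with
  \<open>U\<close> and by the ideal of the coefficients of \<open>b\<close> in their elements.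
\<close>

definition fibre :: "'c set \<Rightarrow> 'c \<Rightarrow> 'c set \<Rightarrow> nat \<Rightarrow> 'c set set" where
  "fibre U b L k = {H. sub H \<and> H \<subseteq> ext U b \<and> H \<inter> U = L \<and> (\<forall>r\<in>carrier R. r \<bullet> b \<in> msum U H \<longleftrightarrow> r \<in> P k)}"

text \<open>
  Any element of \<open>H\<close> that is congruent to \<open>p^k b\<close> modulo \<open>U\<close> generates \<open>H\<close> together with the
  intersection \<open>L\<close>.
\<close>

lemma fibre_generator:
  assumes "sub U" "indep U b" "H \<in> fibre U b L k"
  obtains v where "v \<in> U" "H = ext L (v \<boxplus> p [^] k \<bullet> b)"
proof -
  have H: "sub H" "H \<subseteq> ext U b" "H \<inter> U = L" "\<And>r. r \<in> carrier R \<Longrightarrow> r \<bullet> b \<in> msum U H \<longleftrightarrow> r \<in> P k"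
    using assms(3) unfolding fibre_def by auto
  have b: "b \<in> carrier M" using assms by (simp add: indep_def)
  note s = subD[OF assms(1)] and t = subD[OF H(1)]
  have "p [^] k \<in> P k" using P_I[of \<one> k] by simp
  then have "p [^] k \<bullet> b \<in> msum U H" using H(4) by simp
  then obtain u h where uh: "u \<in> U" "h \<in> H" "p [^] k \<bullet> b = u \<boxplus> h" by (rule msum_E)
  define v where "v = \<ominus>\<^bsub>M\<^esub> u"
  have v: "v \<in> U" using uh s v_def by auto
  have vh: "v \<boxplus> p [^] k \<bullet> b = h" unfolding uh v_def using uh(1,2) s t by (simp add: M.r_neg1)
  have "H \<subseteq> ext L h"
  proof
    fix x assume x: "x \<in> H"
    obtain u' r where ur: "u' \<in> U" "r \<in> carrier R" "x = u' \<boxplus> r \<bullet> b" using subsetD[OF H(2) x] by (rule ext_E)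
    have cu: "u' \<in> carrier M" "v \<in> carrier M" using s ur v by auto
    have "r \<bullet> b = \<ominus>\<^bsub>M\<^esub> u' \<boxplus> x" unfolding ur(3) using cu ur(2) b by (simp add: M.r_neg1)
    moreover have "\<ominus>\<^bsub>M\<^esub> u' \<boxplus> x \<in> msum U H" using x ur(1) s by (intro msum_I) auto
    ultimately have "r \<bullet> b \<in> msum U H" by simp
    then obtain c where c: "c \<in> carrier R" "r = p [^] k \<otimes> c" using H(4) ur by (auto elim: P_E)
    have h: "h = v \<boxplus> p [^] k \<bullet> b" using vh by simp
    have rb: "c \<bullet> h = c \<bullet> v \<boxplus> r \<bullet> b" unfolding h c(2) using c b cu
      by (simp add: smult_r_distr smult_assoc1[symmetric] R.m_comm)
    have xe: "x = (u' \<boxminus> c \<bullet> v) \<boxplus> c \<bullet> h"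
      unfolding rb ur(3) using c b cu ur(2) by (simp add: M.minus_eq M.a_assoc M.r_neg1)
    have 1: "u' \<boxminus> c \<bullet> v \<in> U" using s ur c v by auto
    moreover have "u' \<boxminus> c \<bullet> v \<in> H" 
      using xe x sub_add_iff(2)[OF H(1), of "c \<bullet> h" "u' \<boxminus> c \<bullet> v"] t(7)[OF c(1) uh(2)] 1 s by auto
    ultimately show "x \<in> ext L h" using xe ext_I[of "u' \<boxminus> c \<bullet> v" L c h] c H(3) by auto
  qed
  moreover have "ext L h \<subseteq> H" using H uh by (intro ext_least) auto
  ultimately show ?thesis using that v vh by blast
qed

lemma fibre_construct:
  assumes "sub U" "indep U b" "sub L" "L \<subseteq> U" "v \<in> U"
  shows "ext L (v \<boxplus> p [^] k \<bullet> b) \<in> fibre U b L k" "indep L (v \<boxplus> p [^] k \<bullet> b)"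
proof -
  let ?h = "v \<boxplus> p [^] k \<bullet> b"
  note s = subD[OF assms(1)] and t = subD[OF assms(3)]
  have b: "b \<in> carrier M" and ind: "\<And>r. r \<in> carrier R \<Longrightarrow> r \<bullet> b \<in> U \<Longrightarrow> r = \<zero>" using assms by (auto simp: indep_def)
  have v: "v \<in> carrier M" using s assms by auto
  have h: "?h \<in> carrier M" using b v by auto
  have rh: "r \<bullet> ?h = r \<bullet> v \<boxplus> (r \<otimes> p [^] k) \<bullet> b" if "r \<in> carrier R" for r
    using that b v by (simp add: smult_r_distr smult_assoc1)
  have rU: "r = \<zero>" if "r \<in> carrier R" "r \<bullet> ?h \<in> U" for r
  proof -
    have "(r \<otimes> p [^] k) \<bullet> b \<in> U" using that rh assms s b sub_add_iff(1)[OF assms(1), of "r \<bullet> v" "(r \<otimes> p [^] k) \<bullet> b"] by auto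
    then have "r \<otimes> p [^] k = \<zero>" using ind that by auto
    then show ?thesis using that by (simp add: integral_iff)
  qed
  then show "indep L ?h" unfolding indep_def using h assms by blast
  have E: "sub (ext L ?h)" using assms h by (intro ext_sub) auto
  have "ext L ?h \<inter> U = L"
  proof
    show "L \<subseteq> ext L ?h \<inter> U" using assms ext_incl[OF assms(3) h] by auto
    show "ext L ?h \<inter> U \<subseteq> L"
    proof
      fix x assume x: "x \<in> ext L ?h \<inter> U"
      then obtain a r where ar: "a \<in> L" "r \<in> carrier R" "x = a \<boxplus> r \<bullet> ?h" by (auto elim: ext_E)
      have "r \<bullet> ?h \<in> U" using x ar assms h sub_add_iff(1)[OF assms(1), of a "r \<bullet> ?h"] by auto
      then have "r = \<zero>" using rU ar by auto
      then show "x \<in> L" using ar h t by simp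
    qed
  qed
  moreover have "ext L ?h \<subseteq> ext U b"
    using assms b by (intro ext_least ext_sub subset_trans[OF assms(4) ext_incl] subD(4)[OF ext_sub] subD(7)[OF ext_sub] ext_mem ext_incl[THEN subsetD]) auto
  moreover have "r \<bullet> b \<in> msum U (ext L ?h) \<longleftrightarrow> r \<in> P k" if r: "r \<in> carrier R" for r
  proof
    assume "r \<bullet> b \<in> msum U (ext L ?h)"
    then obtain u a t where u: "u \<in> U" "a \<in> L" "t \<in> carrier R" "r \<bullet> b = u \<boxplus> (a \<boxplus> t \<bullet> ?h)" by (auto elim!: msum_E ext_E)
    have cu: "u \<in> carrier M" "a \<in> carrier M" using u(1,2) s t by auto
    have "(r \<ominus> t \<otimes> p [^] k) \<bullet> b = r \<bullet> b \<boxminus> (t \<otimes> p [^] k) \<bullet> b"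
      using r u(3) b by (simp add: M.minus_eq R.minus_eq smult_l_distr smult_l_minus)
    also have "\<dots> = u \<boxplus> (a \<boxplus> t \<bullet> v)" unfolding u(4) rh[OF u(3)] using cu v b u(3)
      by (simp add: M.minus_eq M.a_assoc M.r_neg)
    also have "\<dots> \<in> U" using u assms s by auto
    finally have "r \<ominus> t \<otimes> p [^] k = \<zero>" using ind r u by auto
    then have "r = p [^] k \<otimes> t" using r u(3) by (simp add: R.m_comm)
    then show "r \<in> P k" using u by auto
  next
    assume "r \<in> P k"
    then obtain c where c: "c \<in> carrier R" "r = p [^] k \<otimes> c" by (rule P_E)
    have "r \<bullet> b = \<ominus>\<^bsub>M\<^esub> (c \<bullet> v) \<boxplus> (\<zero>\<^sub>M \<boxplus> c \<bullet> ?h)"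
      unfolding rh[OF c(1)] c(2) using c(1) v b by (simp add: M.r_neg1 R.m_comm)
    also have "\<dots> \<in> msum U (ext L ?h)" using c assms s t by (intro msum_I ext_I) auto
    finally show "r \<bullet> b \<in> msum U (ext L ?h)" .
  qed
  ultimately show "ext L ?h \<in> fibre U b L k" unfolding fibre_def using E by blast
qed

text \<open>
  The generator \<open>v + p^k b\<close> is determined by \<open>H\<close> up to adding an element of \<open>L\<close> to \<open>v\<close>.
\<close>

lemma fibre_card:
  assumes "sub U" "indep U b" "sub L" "L \<subseteq> U"
  shows "card (fibre U b L k) = idx U L" "idx U L \<noteq> 0 \<Longrightarrow> finite (fibre U b L k)"
proof -
  let ?F = "\<lambda>v. ext L (v \<boxplus> p [^] k \<bullet> b)"
  note s = subD[OF assms(1)] and t = subD[OF assms(3)]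
  have b: "b \<in> carrier M" using assms by (auto simp: indep_def)
  have eq: "fibre U b L k = ?F ` U" using fibre_generator[OF assms(1,2)] fibre_construct(1)[OF assms] by blast
  have inc: "?F v \<subseteq> ?F w" if vw: "v \<in> U" "w \<in> U" "v \<boxminus> w \<in> L" for v w
  proof (rule ext_least)
    have c: "v \<in> carrier M" "w \<in> carrier M" using vw s by auto
    show F: "sub (?F w)" using c b assms by (intro ext_sub) auto
    show L: "L \<subseteq> ?F w" using c b assms by (intro ext_incl) auto
    have "v \<boxplus> p [^] k \<bullet> b = (v \<boxminus> w) \<boxplus> (w \<boxplus> p [^] k \<bullet> b)" using c b by (simp add: M.minus_eq M.a_assoc M.r_neg1)
    also have "\<dots> \<in> ?F w" using vw L c b assms by (intro subD(4)[OF F] ext_mem) auto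
    finally show "v \<boxplus> p [^] k \<bullet> b \<in> ?F w" .
  qed
  have inv: "v \<boxminus> w \<in> L" if vw: "v \<in> U" "w \<in> U" "?F v = ?F w" for v w
  proof -
    have c: "v \<in> carrier M" "w \<in> carrier M" using vw s by auto
    have F: "sub (?F w)" using c b assms by (intro ext_sub) auto
    have "v \<boxplus> p [^] k \<bullet> b \<in> ?F w" using vw(3)[symmetric] ext_mem[OF assms(3), of "v \<boxplus> p [^] k \<bullet> b"] c b by auto
    then have "(v \<boxplus> p [^] k \<bullet> b) \<boxminus> (w \<boxplus> p [^] k \<bullet> b) \<in> ?F w" using c b assms by (intro subD(5)[OF F] ext_mem) auto
    also have "(v \<boxplus> p [^] k \<bullet> b) \<boxminus> (w \<boxplus> p [^] k \<bullet> b) = v \<boxminus> w" using c b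
      by (simp add: M.minus_eq M.minus_add M.a_ac M.r_neg M.r_neg1 M.r_neg2)
    finally have "v \<boxminus> w \<in> ?F w \<inter> U" using vw s by auto
    then show ?thesis using fibre_construct(1)[OF assms vw(2), of k] unfolding fibre_def by auto
  qed
  have "(?F v = ?F w) = (cs L v = cs L w)" if vw: "v \<in> U" "w \<in> U" for v w
  proof -
    have c: "v \<in> carrier M" "w \<in> carrier M" using vw s by auto
    have "w \<boxminus> v \<in> L" if "v \<boxminus> w \<in> L"
      using t(6)[OF that] c by (simp add: M.minus_eq M.minus_add M.a_comm)
    then have "?F v = ?F w \<longleftrightarrow> v \<boxminus> w \<in> L" using inc inv vw by blast
    then show ?thesis using c assms by (subst cs_eq_iff) auto
  qed
  then show 1: "card (fibre U b L k) = idx U L" unfolding eq idx_def by (rule card_image_cong_rel)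
  show "finite (fibre U b L k)" if "idx U L \<noteq> 0" using that 1 card.infinite by fastforce
qed

text \<open>
  The chain \<open>H \<subseteq> U + H \<subseteq> U + Rb\<close> has a lower step isomorphic to \<open>U / L\<close> and a cyclic upper step.
\<close>

lemma fibre_idx:
  assumes "sub U" "indep U b" "H \<in> fibre U b L k"
  shows "idx (ext U b) H = q ^ k * idx U L"
proof -
  have H: "sub H" "H \<subseteq> ext U b" "H \<inter> U = L" "\<And>r. r \<in> carrier R \<Longrightarrow> r \<bullet> b \<in> msum U H \<longleftrightarrow> r \<in> P k"
    using assms(3) unfolding fibre_def by auto
  have b: "b \<in> carrier M" using assms by (simp add: indep_def)
  have C: "sub (msum U H)" "U \<subseteq> msum U H" "H \<subseteq> msum U H" using msum_sub msum_incl assms H by auto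
  have B: "sub (ext U b)" "U \<subseteq> ext U b" "b \<in> ext U b" using ext_sub ext_incl ext_mem assms b by auto
  have CB: "msum U H \<subseteq> ext U b" using B H by (intro msum_least) auto
  have "ext (msum U H) b = ext U b"
    using assms C CB b by (intro ext_between) auto
  moreover have "idx (ext (msum U H) b) (msum U H) = q ^ k" using C b H by (intro idx_cyclic) auto
  moreover have "idx (ext U b) H = idx (ext U b) (msum U H) * idx (msum U H) H" using H B C CB by (intro idx_mult) auto
  moreover have "idx (msum U H) H = idx U L" using idx_msum[OF assms(1) H(1)] H(3) by (simp add: Int_commute)
  ultimately show ?thesis by simp
qed

lemma fibre_exists:
  assumes "sub U" "indep U b" "sub H" "H \<subseteq> ext U b" "idx (ext U b) H \<noteq> 0"
  obtains k where "H \<in> fibre U b (H \<inter> U) k"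
proof -
  have b: "b \<in> carrier M" using assms by (simp add: indep_def)
  have C: "sub (msum U H)" "U \<subseteq> msum U H" "H \<subseteq> msum U H" using msum_sub msum_incl assms by auto
  have B: "sub (ext U b)" "U \<subseteq> ext U b" "b \<in> ext U b" using ext_sub ext_incl ext_mem assms b by auto
  have CB: "msum U H \<subseteq> ext U b" using B assms by (intro msum_least) auto
  have "ext (msum U H) b = ext U b"
    using assms C CB b by (intro ext_between) auto
  moreover have "idx (ext U b) H = idx (ext U b) (msum U H) * idx (msum U H) H" using assms B C CB by (intro idx_mult) auto
  ultimately have "idx (ext (msum U H) b) (msum U H) \<noteq> 0" using assms(5) by auto
  then obtain k where "\<And>r. r \<in> carrier R \<Longrightarrow> r \<bullet> b \<in> msum U H \<longleftrightarrow> r \<in> P k" using conductor[OF C(1) b] by blast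
  then show ?thesis using that assms unfolding fibre_def by blast
qed

section \<open>Free submodules\<close>

text \<open>
  A basis is adjoined one element at a time, which is the form in which all inductions on the rank
  use it.
\<close>

inductive free :: "nat \<Rightarrow> 'c set \<Rightarrow> bool" where
  free_0: "free 0 {\<zero>\<^sub>M}"
| free_Suc: "\<lbrakk>free m U; indep U b\<rbrakk> \<Longrightarrow> free (Suc m) (ext U b)"

lemma sub_zero: "sub {\<zero>\<^sub>M}"
  by (rule subI) auto

lemma free_sub: "free m U \<Longrightarrow> sub U"
  by (induct rule: free.induct) (auto intro: sub_zero ext_sub simp: indep_def)

lemma free_finite_index: "\<lbrakk>free m U; sub H; H \<subseteq> U; idx U H \<noteq> 0\<rbrakk> \<Longrightarrow> free m H"
proof (induct arbitrary: H rule: free.induct)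
  case free_0
  then have "H = {\<zero>\<^sub>M}" using subD[of H] by auto
  then show ?case by (simp add: free.free_0)
next
  case (free_Suc m U b)
  have U: "sub U" using free_Suc free_sub by blast
  obtain k where k: "H \<in> fibre U b (H \<inter> U) k" using fibre_exists[OF U free_Suc(3-6)] by blast
  have "idx (ext U b) H = q ^ k * idx U (H \<inter> U)" by (rule fibre_idx[OF U free_Suc(3) k])
  then have 1: "free m (H \<inter> U)" using free_Suc U by (intro free_Suc(2) sub_Int) auto
  obtain v where v: "v \<in> U" "H = ext (H \<inter> U) (v \<boxplus> p [^] k \<bullet> b)" by (rule fibre_generator[OF U free_Suc(3) k])
  have "indep (H \<inter> U) (v \<boxplus> p [^] k \<bullet> b)" using v U free_Suc by (intro fibre_construct(2)[of U] sub_Int) auto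
  then have "free (Suc m) (ext (H \<inter> U) (v \<boxplus> p [^] k \<bullet> b))" using free.free_Suc[OF 1] by blast
  then show ?case using v(2) by simp
qed

definition index_subs :: "'c set \<Rightarrow> nat \<Rightarrow> 'c set set" where
  "index_subs U j = {H. sub H \<and> H \<subseteq> U \<and> idx U H = q ^ j}"

lemma q_pow_inj: "q ^ i = q ^ j \<longleftrightarrow> i = j"
  using q_ge_2 by (auto intro: power_inject_exp[THEN iffD1])

lemma q_pow_split: assumes "q ^ j = q ^ k * (x::nat)" shows "k \<le> j \<and> x = q ^ (j - k)"
proof -
  have "q ^ k dvd q ^ j" using assms by simp
  then have k: "k \<le> j" using q_ge_2 by (intro power_dvd_imp_le[of q]) auto
  then have "q ^ j = q ^ k * q ^ (j - k)" by (simp add: power_add[symmetric])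
  then show ?thesis using k assms q_ge_2 by auto
qed

text \<open>
  A submodule of \<open>U + Rb\<close> is given by its intersection with \<open>U\<close>, say of index \<open>q^i\<close>, its leading
  ideal, which is then determined by the index, and one of \<open>q^i\<close> cosets. This is the recursion of
  \<open>subcount\<close>.
\<close>

lemma card_index_subs: "free m U \<Longrightarrow> finite (index_subs U j) \<and> card (index_subs U j) = subcount q m j"
proof (induct arbitrary: j rule: free.induct)
  case free_0
  have i: "idx {\<zero>\<^sub>M} {\<zero>\<^sub>M} = 1" by (rule idx_self[OF sub_zero])
  have "H = {\<zero>\<^sub>M}" if "sub H" "H \<subseteq> {\<zero>\<^sub>M}" for H using that subD[of H] by auto
  then have "index_subs {\<zero>\<^sub>M} j = (if j = 0 then {{\<zero>\<^sub>M}} else {})"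
    unfolding index_subs_def using sub_zero i q_pow_inj[of 0 j] by (cases "j = 0") force+
  then show ?case by simp
next
  case (free_Suc m U b)
  have U: "sub U" using free_Suc free_sub by blast
  have eq: "index_subs (ext U b) j = (\<Union>i\<in>{..j}. \<Union>L\<in>index_subs U i. fibre U b L (j - i))"
  proof (intro equalityI subsetI)
    fix H assume "H \<in> index_subs (ext U b) j"
    then have H: "sub H" "H \<subseteq> ext U b" "idx (ext U b) H = q ^ j" by (auto simp: index_subs_def)
    obtain k where k: "H \<in> fibre U b (H \<inter> U) k" using fibre_exists[OF U free_Suc(3) H(1,2)] H(3) q_ge_2 by auto
    have "k \<le> j \<and> idx U (H \<inter> U) = q ^ (j - k)" using fibre_idx[OF U free_Suc(3) k] H(3) q_pow_split[of j k "idx U (H \<inter> U)"] by simp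
    then show "H \<in> (\<Union>i\<in>{..j}. \<Union>L\<in>index_subs U i. fibre U b L (j - i))"
      using k U H sub_Int by (intro UN_I[of "j - k"] UN_I[of "H \<inter> U"]) (auto simp: index_subs_def)
  next
    fix H assume "H \<in> (\<Union>i\<in>{..j}. \<Union>L\<in>index_subs U i. fibre U b L (j - i))"
    then obtain i L where iL: "i \<le> j" "L \<in> index_subs U i" "H \<in> fibre U b L (j - i)" by auto
    then have "idx (ext U b) H = q ^ (j - i) * q ^ i" using fibre_idx[OF U free_Suc(3)] by (auto simp: index_subs_def)
    then show "H \<in> index_subs (ext U b) j" using iL by (auto simp: index_subs_def fibre_def power_add[symmetric])
  qed
  have fin: "finite (fibre U b L k)" "card (fibre U b L k) = q ^ i" if "L \<in> index_subs U i" for L i k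
    using that fibre_card[OF U free_Suc(3), of L k] q_ge_2 by (auto simp: index_subs_def)
  have disj: "fibre U b L k \<inter> fibre U b L' k' = {}" if "L \<noteq> L'" for L L' k k'
    using that by (auto simp: fibre_def)
  have 1: "finite (\<Union>L\<in>index_subs U i. fibre U b L (j - i)) \<and> card (\<Union>L\<in>index_subs U i. fibre U b L (j - i)) = q ^ i * subcount q m i" for i
  proof
    show "finite (\<Union>L\<in>index_subs U i. fibre U b L (j - i))" using fin free_Suc by auto
    have "card (\<Union>L\<in>index_subs U i. fibre U b L (j - i)) = (\<Sum>L\<in>index_subs U i. card (fibre U b L (j - i)))"
      using fin free_Suc disj by (intro card_UN_disjoint) auto
    also have "\<dots> = (\<Sum>L\<in>index_subs U i. q ^ i)" using fin by (intro sum.cong) auto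
    finally show "card (\<Union>L\<in>index_subs U i. fibre U b L (j - i)) = q ^ i * subcount q m i" using free_Suc by (simp add: mult.commute)
  qed
  have "card (index_subs (ext U b) j) = (\<Sum>i\<in>{..j}. card (\<Union>L\<in>index_subs U i. fibre U b L (j - i)))"
    unfolding eq
  proof (rule card_UN_disjoint)
    show "\<forall>i\<in>{..j}. \<forall>i'\<in>{..j}. i \<noteq> i' \<longrightarrow> (\<Union>L\<in>index_subs U i. fibre U b L (j - i)) \<inter> (\<Union>L\<in>index_subs U i'. fibre U b L (j - i')) = {}"
    proof (intro ballI impI)
      fix i i' :: nat assume "i \<noteq> i'"
      then have "L \<noteq> L'" if "L \<in> index_subs U i" "L' \<in> index_subs U i'" for L L' using that q_pow_inj[of i i'] by (auto simp: index_subs_def)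
      then show "(\<Union>L\<in>index_subs U i. fibre U b L (j - i)) \<inter> (\<Union>L\<in>index_subs U i'. fibre U b L (j - i')) = {}"
        using disj by blast
    qed
  qed (use 1 in auto)
  then show ?case using 1 unfolding eq by simp
qed

text \<open>
  For \<open>y\<close> independent of \<open>L\<close> these correspond to the homomorphisms from \<open>L\<close> to \<open>R y / p^k y\<close>.
\<close>

definition lifts :: "'c set \<Rightarrow> 'c \<Rightarrow> nat \<Rightarrow> 'c set set" where
  "lifts L y k = {H. sub H \<and> ext H y = ext L y \<and> (\<forall>r\<in>carrier R. r \<bullet> y \<in> H \<longleftrightarrow> r \<in> P k)}"

lemma lifts_idx: "\<lbrakk>H \<in> lifts L y k; y \<in> carrier M\<rbrakk> \<Longrightarrow> idx (ext L y) H = q ^ k"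
  using idx_cyclic[of H y k] by (auto simp: lifts_def)

text \<open>
  Induction on the rank, by intersecting with the extension of the smaller free module by \<open>y\<close>: the
  image of one more basis element is free to be chosen among \<open>q^k\<close> values.
\<close>

lemma card_lifts: "\<lbrakk>free m L; indep L y\<rbrakk> \<Longrightarrow> finite (lifts L y k) \<and> card (lifts L y k) = q ^ (m * k)"
proof (induct rule: free.induct)
  case free_0
  have y: "y \<in> carrier M" and ind: "\<And>r. r \<in> carrier R \<Longrightarrow> r \<bullet> y = \<zero>\<^sub>M \<Longrightarrow> r = \<zero>" using free_0 by (auto simp: indep_def)
  have E: "ext {\<zero>\<^sub>M} x = {r \<bullet> x |r. r \<in> carrier R}" if "x \<in> carrier M" for x
  proof (intro equalityI subsetI)
    fix z assume "z \<in> ext {\<zero>\<^sub>M} x"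
    then show "z \<in> {r \<bullet> x |r. r \<in> carrier R}" using that by (elim ext_E) auto
  next
    fix z assume "z \<in> {r \<bullet> x |r. r \<in> carrier R}"
    then obtain r where r: "r \<in> carrier R" "z = r \<bullet> x" by auto
    then show "z \<in> ext {\<zero>\<^sub>M} x" using ext_I[of "\<zero>\<^sub>M" "{\<zero>\<^sub>M}" r x] that by simp
  qed
  have "lifts {\<zero>\<^sub>M} y k = {{r \<bullet> y |r. r \<in> P k}}"
  proof (intro equalityI subsetI)
    fix H assume "H \<in> lifts {\<zero>\<^sub>M} y k"
    then have H: "sub H" "ext H y = {r \<bullet> y |r. r \<in> carrier R}" "\<And>r. r \<in> carrier R \<Longrightarrow> r \<bullet> y \<in> H \<longleftrightarrow> r \<in> P k"
      unfolding lifts_def E[OF y] by blast+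
    have "H = {r \<bullet> y |r. r \<in> P k}"
    proof (intro equalityI subsetI)
      fix x assume x: "x \<in> H"
      then obtain r where r: "r \<in> carrier R" "x = r \<bullet> y" using H(2) ext_incl[OF H(1) y] by blast
      then show "x \<in> {r \<bullet> y |r. r \<in> P k}" using x H(3)[OF r(1)] by blast
    next
      fix x assume "x \<in> {r \<bullet> y |r. r \<in> P k}"
      then obtain r where r: "r \<in> P k" "x = r \<bullet> y" by blast
      then show "x \<in> H" using H(3)[of r] P_closed by blast
    qed
    then show "H \<in> {{r \<bullet> y |r. r \<in> P k}}" by simp
  next
    fix H assume "H \<in> {{r \<bullet> y |r. r \<in> P k}}"
    then have H: "H = {r \<bullet> y |r. r \<in> P k}" by simp
    have sH: "sub H" unfolding H
    proof (rule subI)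
      show "{r \<bullet> y |r. r \<in> P k} \<subseteq> carrier M" using y P_closed by auto
      show "\<zero>\<^sub>M \<in> {r \<bullet> y |r. r \<in> P k}" using y P_zero by force
      show "a \<boxplus> b \<in> {r \<bullet> y |r. r \<in> P k}" if "a \<in> {r \<bullet> y |r. r \<in> P k}" "b \<in> {r \<bullet> y |r. r \<in> P k}" for a b
        using that y P_closed by (auto simp: smult_l_distr[symmetric])
      show "t \<bullet> a \<in> {r \<bullet> y |r. r \<in> P k}" if "t \<in> carrier R" "a \<in> {r \<bullet> y |r. r \<in> P k}" for t a
        using that y P_closed by (auto simp: smult_assoc1[symmetric])
    qed
    have in_iff: "r \<bullet> y \<in> H \<longleftrightarrow> r \<in> P k" if "r \<in> carrier R" for r
    proof
      assume "r \<bullet> y \<in> H"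
      then obtain t where t: "t \<in> P k" "r \<bullet> y = t \<bullet> y" unfolding H by auto
      have "(r \<ominus> t) \<bullet> y = r \<bullet> y \<boxminus> t \<bullet> y" using that t P_closed y
        by (simp add: M.minus_eq R.minus_eq smult_l_distr smult_l_minus)
      also have "\<dots> = \<zero>\<^sub>M" unfolding t(2) using t(1) P_closed y by (simp add: M.minus_eq M.r_neg)
      finally have "r \<ominus> t = \<zero>" using that t P_closed ind by auto
      then show "r \<in> P k" using that t P_closed by simp
    qed (auto simp: H)
    have "ext H y = ext {\<zero>\<^sub>M} y"
    proof (intro equalityI ext_least ext_sub)
      show "H \<subseteq> ext {\<zero>\<^sub>M} y" unfolding H E[OF y] using P_closed by auto
    qed (use sH y sub_zero ext_mem subD(3)[OF ext_sub[OF sH y]] in auto)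
    then show "H \<in> lifts {\<zero>\<^sub>M} y k" using sH in_iff by (auto simp: lifts_def)
  qed
  then show ?case by simp
next
  case (free_Suc m L b)
  have L: "sub L" using free_Suc free_sub by blast
  have b: "b \<in> carrier M" "\<And>r. r \<in> carrier R \<Longrightarrow> r \<bullet> b \<in> L \<Longrightarrow> r = \<zero>" using free_Suc by (auto simp: indep_def)
  have y: "y \<in> carrier M" and ind: "\<And>r. r \<in> carrier R \<Longrightarrow> r \<bullet> y \<in> ext L b \<Longrightarrow> r = \<zero>" using free_Suc by (auto simp: indep_def)
  have Lb: "sub (ext L b)" "L \<subseteq> ext L b" "b \<in> ext L b" using L b ext_sub ext_incl ext_mem by auto
  have Ly: "indep L y" unfolding indep_def using y ind Lb by blast
  have IH: "finite (lifts L y k)" "card (lifts L y k) = q ^ (m * k)" using free_Suc(2)[OF Ly] by auto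
  let ?U = "ext L y"
  have U: "sub ?U" "L \<subseteq> ?U" "y \<in> ?U" using L y ext_sub ext_incl ext_mem by auto
  have Ub: "indep ?U b" unfolding indep_def
  proof (intro conjI ballI impI b(1))
    fix r assume r: "r \<in> carrier R" "r \<bullet> b \<in> ?U"
    obtain a t where at: "a \<in> L" "t \<in> carrier R" "r \<bullet> b = a \<boxplus> t \<bullet> y" using r(2) by (rule ext_E)
    have "a \<boxplus> t \<bullet> y \<in> ext L b" unfolding at(3)[symmetric] using r Lb by (auto intro: subD)
    then have "t \<bullet> y \<in> ext L b" using at Lb y sub_add_iff(1)[OF Lb(1), of a "t \<bullet> y"] by auto
    then have "t = \<zero>" using ind at by auto
    then have "r \<bullet> b \<in> L" using at y subD(2)[OF L] by simp
    then show "r = \<zero>" using b r by auto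
  qed
  have swap: "ext (ext L b) y = ext ?U b"
    using L Lb U y b ext_sub[OF U(1) b(1)] ext_sub[OF Lb(1) y] ext_incl[OF U(1) b(1)] ext_incl[OF Lb(1) y] 
      ext_mem[OF U(1) b(1)] ext_mem[OF Lb(1) y]
    by (intro equalityI ext_least) auto
  have eq: "lifts (ext L b) y k = (\<Union>H'\<in>lifts L y k. fibre ?U b H' 0)"
  proof (intro equalityI subsetI)
    fix H assume "H \<in> lifts (ext L b) y k"
    then have H: "sub H" "ext H y = ext ?U b" "\<And>r. r \<in> carrier R \<Longrightarrow> r \<bullet> y \<in> H \<longleftrightarrow> r \<in> P k"
      by (auto simp: lifts_def swap)
    have Hs: "H \<subseteq> ext ?U b" using ext_incl[OF H(1) y] H(2) by simp
    have HU: "sub (H \<inter> ?U)" using H U by (intro sub_Int)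
    have m: "x \<in> msum ?U H" if x: "x \<in> ext ?U b" for x
    proof -
      have "x \<in> ext H y" using x H(2) by simp
      then obtain h t where ht: "h \<in> H" "t \<in> carrier R" "x = h \<boxplus> t \<bullet> y" by (rule ext_E)
      have "x = t \<bullet> y \<boxplus> h" using ht y subD(2)[OF H(1)] by (simp add: M.a_comm)
      then show ?thesis using msum_I[of "t \<bullet> y" ?U h H] ht subD(7)[OF U(1) ht(2) U(3)] by simp
    qed
    have "b \<in> msum ?U H" using m ext_mem[OF U(1) b(1)] by simp
    then have "H \<in> fibre ?U b (H \<inter> ?U) 0" unfolding fibre_def using H Hs subD(7)[OF msum_sub[OF U(1) H(1)]] by auto
    moreover have "H \<inter> ?U \<in> lifts L y k"
    proof -
      have "ext (H \<inter> ?U) y = ?U"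
      proof
        show "ext (H \<inter> ?U) y \<subseteq> ?U" using U by (intro ext_least) auto
        show "?U \<subseteq> ext (H \<inter> ?U) y"
        proof
        fix x assume x: "x \<in> ?U"
        then have "x \<in> ext H y" using H(2) ext_incl[OF U(1) b(1)] by auto
        then obtain h t where ht: "h \<in> H" "t \<in> carrier R" "x = h \<boxplus> t \<bullet> y" by (rule ext_E)
        then have "h \<in> ?U" using sub_add_iff(2)[OF U(1), of "t \<bullet> y" h] x subD(2)[OF H(1)] subD(7)[OF U(1) ht(2) U(3)] by auto
        then show "x \<in> ext (H \<inter> ?U) y" using ht ext_I by auto
        qed
      qed
      then show ?thesis using HU H(3) subD(7)[OF U(1) _ U(3)] by (auto simp: lifts_def)
    qed
    ultimately show "H \<in> (\<Union>H'\<in>lifts L y k. fibre ?U b H' 0)" by blast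
  next
    fix H assume "H \<in> (\<Union>H'\<in>lifts L y k. fibre ?U b H' 0)"
    then obtain H' where H': "sub H'" "ext H' y = ?U" "\<And>r. r \<in> carrier R \<Longrightarrow> r \<bullet> y \<in> H' \<longleftrightarrow> r \<in> P k"
       and H: "sub H" "H \<subseteq> ext ?U b" "H \<inter> ?U = H'" "\<And>r. r \<in> carrier R \<Longrightarrow> r \<bullet> b \<in> msum ?U H"
      by (auto simp: lifts_def fibre_def)
    have E: "sub (ext H y)" "H \<subseteq> ext H y" "y \<in> ext H y" using H y ext_sub ext_incl ext_mem by auto
    have UE: "?U \<subseteq> ext H y" unfolding H'(2)[symmetric] using E H by (intro ext_least) auto
    have "b \<in> msum ?U H" using H(4)[of \<one>] b by simp
    then have bE: "b \<in> ext H y" using msum_least[OF E(1) UE E(2)] by auto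
    have "ext H y = ext ?U b"
      using E UE bE H ext_sub[OF U(1) b(1)] ext_incl[OF U(1) b(1)] U by (intro equalityI ext_least) auto
    moreover have "r \<bullet> y \<in> H \<longleftrightarrow> r \<in> P k" if "r \<in> carrier R" for r
      using H'(3)[OF that] H(3) subD(7)[OF U(1) that U(3)] by auto
    ultimately show "H \<in> lifts (ext L b) y k" using H by (auto simp: lifts_def swap)
  qed
  have fin: "finite (fibre ?U b H' 0) \<and> card (fibre ?U b H' 0) = q ^ k" if H': "H' \<in> lifts L y k" for H'
  proof -
    have "sub H'" "H' \<subseteq> ?U" using H' ext_incl[of H' y] y by (auto simp: lifts_def)
    then show ?thesis using fibre_card[OF U(1) Ub, of H' 0] lifts_idx[OF H' y] q_ge_2 by auto
  qed
  have "card (lifts (ext L b) y k) = (\<Sum>H'\<in>lifts L y k. card (fibre ?U b H' 0))"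
    unfolding eq using fin IH by (intro card_UN_disjoint) (auto simp: fibre_def)
  also have "\<dots> = (\<Sum>H'\<in>lifts L y k. q ^ k)" using fin by (intro sum.cong) auto
  finally have "card (lifts (ext L b) y k) = q ^ (Suc m * k)" using IH by (simp add: power_add mult.commute)
  moreover have "finite (lifts (ext L b) y k)" unfolding eq using IH fin by auto
  ultimately show ?case by blast
qed

end

context dvr_lattice begin

section \<open>Intermediate submodules of index q\<close>

definition lines :: "'c set \<Rightarrow> 'c set \<Rightarrow> 'c set set" where
  "lines Z Y = {Z'. sub Z' \<and> Z \<subseteq> Z' \<and> Z' \<subseteq> Y \<and> idx Z' Z = q}"

lemma ext_in_lines:
  assumes "sub Z" "sub Y" "Z \<subseteq> Y" "\<And>y. y \<in> Y \<Longrightarrow> p \<bullet> y \<in> Z" "u \<in> Y" "u \<notin> Z"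
  shows "ext Z u \<in> lines Z Y"
proof -
  have u: "u \<in> carrier M" using assms subD by blast
  show ?thesis unfolding lines_def using assms u
    by (auto intro!: ext_sub idx_line ext_incl[THEN subsetD] dest: ext_least[THEN subsetD, rotated 3])
qed

lemma lines_eq_ext:
  assumes "sub Z" "sub Y" "\<And>y. y \<in> Y \<Longrightarrow> p \<bullet> y \<in> Z" "Z' \<in> lines Z Y" "u \<in> Z'" "u \<notin> Z"
  shows "Z' = ext Z u"
proof -
  have Z': "sub Z'" "Z \<subseteq> Z'" "Z' \<subseteq> Y" "idx Z' Z = q" using assms by (auto simp: lines_def)
  have u: "u \<in> carrier M" using assms Z' subD by blast
  have E: "sub (ext Z u)" "Z \<subseteq> ext Z u" "ext Z u \<subseteq> Z'" using assms Z' u by (intro ext_sub ext_incl ext_least; simp)+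
  have "idx Z' Z = idx Z' (ext Z u) * idx (ext Z u) Z" using assms Z' E by (intro idx_mult) auto
  moreover have "idx (ext Z u) Z = q" using assms Z' u by (intro idx_line) auto
  ultimately have "idx Z' (ext Z u) = 1" using Z' q_ge_2 by simp
  then show ?thesis using idx_1_imp_eq E Z' by metis
qed

lemma cs_mem_iff: assumes "sub Z" "sub A" "Z \<subseteq> A" "x \<in> carrier M" shows "cs Z x \<in> cs Z ` A \<longleftrightarrow> x \<in> A"
proof
  assume "cs Z x \<in> cs Z ` A"
  then obtain a where a: "a \<in> A" "cs Z x = cs Z a" by auto
  have ac: "a \<in> carrier M" using a subD[OF assms(2)] by auto
  have "x \<boxminus> a \<in> Z" using a ac assms by (simp add: cs_eq_iff)
  then have "(x \<boxminus> a) \<boxplus> a \<in> A" using a assms by (intro subD(4)) auto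
  then show "x \<in> A" using ac assms by (simp add: M.minus_eq M.a_assoc M.l_neg)
qed auto

text \<open>
  Every nonzero coset of \<open>Z\<close> in \<open>Y\<close> spans exactly one such submodule, and each of them contains
  \<open>q - 1\<close> nonzero cosets.
\<close>

lemma card_lines:
  assumes "sub Z" "sub Y" "Z \<subseteq> Y" "\<And>y. y \<in> Y \<Longrightarrow> p \<bullet> y \<in> Z" "idx Y Z \<noteq> 0"
  shows "finite (lines Z Y)" "card (lines Z Y) * (q - 1) = idx Y Z - 1"
proof -
  let ?Q = "\<lambda>A. cs Z ` A - {cs Z \<zero>\<^sub>M}"
  have finY: "finite (cs Z ` Y)" using assms(5) unfolding idx_def by (metis card.infinite)
  have cY: "Y \<subseteq> carrier M" using subD assms by blast
  have mem: "cs Z x \<in> cs Z ` A \<longleftrightarrow> x \<in> A" if "A \<in> lines Z Y" "x \<in> Y" for A x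
    using that assms cY by (intro cs_mem_iff) (auto simp: lines_def)
  have "inj_on (\<lambda>A. cs Z ` A) (lines Z Y)"
  proof (rule inj_onI)
    fix A B assume AB: "A \<in> lines Z Y" "B \<in> lines Z Y" "cs Z ` A = cs Z ` B"
    have "x \<in> A \<longleftrightarrow> x \<in> B" if "x \<in> Y" for x using mem[OF AB(1) that] mem[OF AB(2) that] AB(3) by simp
    then show "A = B" using AB by (auto simp: lines_def)
  qed
  moreover have "(\<lambda>A. cs Z ` A) ` lines Z Y \<subseteq> Pow (cs Z ` Y)" unfolding lines_def by blast
  moreover from this have "finite ((\<lambda>A. cs Z ` A) ` lines Z Y)" by (rule finite_subset) (simp add: finY)
  ultimately show fin: "finite (lines Z Y)" by (metis finite_imageD)
  have zero: "cs Z x = cs Z \<zero>\<^sub>M \<longleftrightarrow> x \<in> Z" if "x \<in> Y" for x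
    using that assms cY by (subst cs_eq_iff) auto
  have eq: "?Q Y = (\<Union>A\<in>lines Z Y. ?Q A)"
  proof (intro equalityI subsetI)
    fix c assume "c \<in> ?Q Y"
    then obtain u where u: "u \<in> Y" "c = cs Z u" "u \<notin> Z" using zero by auto
    have "u \<in> ext Z u" using u assms cY by (intro ext_mem) auto
    then show "c \<in> (\<Union>A\<in>lines Z Y. ?Q A)"
      using u zero ext_in_lines[OF assms(1,2,3,4) u(1,3)] by blast
  qed (auto simp: lines_def)
  have disj: "?Q A \<inter> ?Q B = {}" if AB: "A \<in> lines Z Y" "B \<in> lines Z Y" "A \<noteq> B" for A B
  proof (rule ccontr)
    assume "?Q A \<inter> ?Q B \<noteq> {}"
    then obtain u where u: "u \<in> A" "cs Z u \<in> cs Z ` B" "cs Z u \<noteq> cs Z \<zero>\<^sub>M" by auto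
    have uY: "u \<in> Y" using u AB by (auto simp: lines_def)
    have "u \<notin> Z" "u \<in> B" using u zero[OF uY] mem[OF AB(2) uY] by auto
    then show False using lines_eq_ext[OF assms(1,2,4), of _ u] AB u by blast
  qed
  have zin: "cs Z \<zero>\<^sub>M \<in> cs Z ` A" if "sub A" for A using subD(3)[OF that] by auto
  have "card (?Q Y) = (\<Sum>A\<in>lines Z Y. card (?Q A))"
    unfolding eq
  proof (rule card_UN_disjoint)
    show "\<forall>A\<in>lines Z Y. finite (?Q A)" 
    proof
      fix A assume "A \<in> lines Z Y"
      then have "cs Z ` A \<subseteq> cs Z ` Y" unfolding lines_def by blast
      then show "finite (?Q A)" using finY by (simp add: finite_subset)
    qed
  qed (use fin disj in auto)
  also have "\<dots> = (\<Sum>A\<in>lines Z Y. q - 1)"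
    using zin by (intro sum.cong) (auto simp: lines_def idx_def card_Diff_singleton)
  finally show "card (lines Z Y) * (q - 1) = idx Y Z - 1"
    using zin[OF assms(2)] by (simp add: idx_def card_Diff_singleton)
qed

lemma idx_divisors_nonzero:
  assumes "sub A" "sub B" "sub C" "A \<subseteq> B" "B \<subseteq> C" "idx C A \<noteq> 0"
  shows "idx C B \<noteq> 0" "idx B A \<noteq> 0"
  using idx_mult[OF assms(1-5)] assms(6) by auto

text \<open>
  Between \<open>Z\<close> and \<open>Y\<close> one can climb by steps of index \<open>q\<close>.
\<close>

lemma line_induct:
  assumes "sub Z" "sub Y" "Z \<subseteq> Y" "\<And>y. y \<in> Y \<Longrightarrow> p \<bullet> y \<in> Z" "idx Y Z \<noteq> 0"
    and refl: "Q Y"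
    and step: "\<And>Z u. \<lbrakk>sub Z; Z \<subseteq> Y; \<And>y. y \<in> Y \<Longrightarrow> p \<bullet> y \<in> Z; idx Y Z \<noteq> 0; u \<in> Y; u \<notin> Z; 
       sub (ext Z u); Z \<subseteq> ext Z u; ext Z u \<subseteq> Y; idx (ext Z u) Z = q; idx Y Z = idx Y (ext Z u) * q; Q (ext Z u)\<rbrakk> \<Longrightarrow> Q Z"
  shows "Q Z"
  using assms(1,3-5)
proof (induct "idx Y Z" arbitrary: Z rule: less_induct)
  case less
  show ?case
  proof (cases "Z = Y")
    case False
    then obtain u where u: "u \<in> Y" "u \<notin> Z" using less by auto
    have "ext Z u \<in> lines Z Y" using less assms(2) u by (intro ext_in_lines) auto
    then have E: "sub (ext Z u)" "Z \<subseteq> ext Z u" "ext Z u \<subseteq> Y" "idx (ext Z u) Z = q" by (auto simp: lines_def)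
    have m: "idx Y Z = idx Y (ext Z u) * q" using idx_mult[OF less(2) E(1) assms(2) E(2,3)] E(4) by simp
    have "Q (ext Z u)" using E m less q_ge_2 by (intro less(1)) auto
    then show ?thesis using E m less u by (intro step[of Z u]) auto
  qed (simp add: refl)
qed

lemma idx_power: 
  assumes "sub Z" "sub Y" "Z \<subseteq> Y" "\<And>y. y \<in> Y \<Longrightarrow> p \<bullet> y \<in> Z" "idx Y Z \<noteq> 0"
  shows "\<exists>j. idx Y Z = q ^ j"
proof (rule line_induct[OF assms])
  show "\<exists>j. idx Y Y = q ^ j" using idx_self[OF assms(2)] by (auto intro: exI[of _ 0])
next
  fix Z u assume "idx Y Z = idx Y (ext Z u) * q" "\<exists>j. idx Y (ext Z u) = q ^ j"
  then obtain j where "idx Y Z = q ^ Suc j" by auto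
  then show "\<exists>j. idx Y Z = q ^ j" by blast
qed

lemma free_scale: "free m U \<Longrightarrow> idx U (scale p U) = q ^ m"
proof (induct rule: free.induct)
  case free_0
  have "scale p {\<zero>\<^sub>M} = {\<zero>\<^sub>M}" by (simp add: scale_def)
  then show ?case using idx_self[OF sub_zero] by simp
next
  case (free_Suc m U b)
  have U: "sub U" using free_Suc free_sub by blast
  have b: "b \<in> carrier M" "\<And>r. r \<in> carrier R \<Longrightarrow> r \<bullet> b \<in> U \<Longrightarrow> r = \<zero>" using free_Suc by (auto simp: indep_def)
  have "scale p (ext U b) = ext (scale p U) (\<zero>\<^sub>M \<boxplus> p [^] (1::nat) \<bullet> b)"
  proof -
    have e: "p \<bullet> (a \<boxplus> r \<bullet> b) = p \<bullet> a \<boxplus> r \<bullet> (\<zero>\<^sub>M \<boxplus> p [^] (1::nat) \<bullet> b)" if "a \<in> U" "r \<in> carrier R" for a r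
      using that subD[OF U] b by (simp add: smult_r_distr smult_assoc1[symmetric] R.m_comm)
    show ?thesis
    proof (intro equalityI subsetI)
      fix z assume "z \<in> scale p (ext U b)"
      then obtain a r where "a \<in> U" "r \<in> carrier R" "z = p \<bullet> (a \<boxplus> r \<bullet> b)" by (auto simp: scale_def elim!: ext_E)
      then show "z \<in> ext (scale p U) (\<zero>\<^sub>M \<boxplus> p [^] (1::nat) \<bullet> b)" using e ext_I[of "p \<bullet> a" "scale p U" r] by (auto simp: scale_def)
    next
      fix z assume "z \<in> ext (scale p U) (\<zero>\<^sub>M \<boxplus> p [^] (1::nat) \<bullet> b)"
      then obtain a r where "a \<in> U" "r \<in> carrier R" "z = p \<bullet> a \<boxplus> r \<bullet> (\<zero>\<^sub>M \<boxplus> p [^] (1::nat) \<bullet> b)" by (auto simp: scale_def elim!: ext_E)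
      then show "z \<in> scale p (ext U b)" using e[symmetric] ext_I[of a U r b] by (auto simp: scale_def)
    qed
  qed
  moreover have "ext (scale p U) (\<zero>\<^sub>M \<boxplus> p [^] (1::nat) \<bullet> b) \<in> fibre U b (scale p U) 1"
    using U free_Suc(3) subD(3)[OF U] by (intro fibre_construct scale_sub scale_incl) auto
  ultimately show ?case using fibre_idx[OF U free_Suc(3), of _ "scale p U" 1] free_Suc(2) by simp
qed

end

section \<open>Alternating forms and orthogonal submodules\<close>

text \<open>
  The number \<open>n\<close> is half the rank of the sublattices that are considered.
\<close>

locale form_lattice = dvr_lattice +
  fixes w :: "'c \<Rightarrow> 'c \<Rightarrow> 'a" and n :: nat
  assumes w_closed [simp, intro]: "\<lbrakk>x \<in> carrier M; y \<in> carrier M\<rbrakk> \<Longrightarrow> w x y \<in> carrier R"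
    and w_add_l: "\<lbrakk>x \<in> carrier M; y \<in> carrier M; z \<in> carrier M\<rbrakk> \<Longrightarrow> w (x \<oplus>\<^bsub>M\<^esub> y) z = w x z \<oplus> w y z"
    and w_add_r: "\<lbrakk>x \<in> carrier M; y \<in> carrier M; z \<in> carrier M\<rbrakk> \<Longrightarrow> w z (x \<oplus>\<^bsub>M\<^esub> y) = w z x \<oplus> w z y"
    and w_smult_l: "\<lbrakk>r \<in> carrier R; x \<in> carrier M; y \<in> carrier M\<rbrakk> \<Longrightarrow> w (r \<odot>\<^bsub>M\<^esub> x) y = r \<otimes> w x y"
    and w_smult_r: "\<lbrakk>r \<in> carrier R; x \<in> carrier M; y \<in> carrier M\<rbrakk> \<Longrightarrow> w x (r \<odot>\<^bsub>M\<^esub> y) = r \<otimes> w x y"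
    and w_self: "x \<in> carrier M \<Longrightarrow> w x x = \<zero>"
begin

lemma w_swap: assumes "x \<in> carrier M" "y \<in> carrier M" shows "w y x = \<ominus> w x y"
proof -
  have "w (x \<boxplus> y) (x \<boxplus> y) = (w x x \<oplus> w x y) \<oplus> (w y x \<oplus> w y y)"
    using assms by (simp add: w_add_l w_add_r R.a_ac)
  then have "w y x \<oplus> w x y = \<zero>" using assms by (simp add: w_self R.a_comm)
  then show ?thesis using assms by (simp add: R.minus_equality)
qed

lemma w_swap_P: "\<lbrakk>x \<in> carrier M; y \<in> carrier M; w x y \<in> P k\<rbrakk> \<Longrightarrow> w y x \<in> P k"
  using w_swap[of x y] by auto

lemma w_zero: "x \<in> carrier M \<Longrightarrow> w \<zero>\<^sub>M x = \<zero>" "x \<in> carrier M \<Longrightarrow> w x \<zero>\<^sub>M = \<zero>"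
  using w_smult_l[of \<zero> "\<zero>\<^sub>M" x] w_smult_r[of \<zero> x "\<zero>\<^sub>M"] by auto

lemma w_diff_l: "\<lbrakk>x \<in> carrier M; y \<in> carrier M; z \<in> carrier M\<rbrakk> \<Longrightarrow> w (x \<boxminus> y) z = w x z \<ominus> w y z"
proof -
  assume *: "x \<in> carrier M" "y \<in> carrier M" "z \<in> carrier M"
  have "\<ominus>\<^bsub>M\<^esub> y = (\<ominus> \<one>) \<bullet> y" using * by (simp add: smult_l_minus)
  then have "w (\<ominus>\<^bsub>M\<^esub> y) z = \<ominus> w y z" using * w_smult_l[of "\<ominus> \<one>" y z] by (simp add: R.l_minus)
  then show ?thesis using * by (simp add: M.minus_eq R.minus_eq w_add_l)
qed

text \<open>
  With \<open>k + 1\<close> in place of \<open>k\<close> and \<open>U\<close> of level \<open>k\<close>, this is the orthogonal complement of \<open>Z\<close> with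
  respect to the reduction of \<open>p^-k w\<close> modulo \<open>p\<close>.
\<close>

definition orth :: "nat \<Rightarrow> 'c set \<Rightarrow> 'c set \<Rightarrow> 'c set" where
  "orth k U Z = {u \<in> U. \<forall>x\<in>Z. w u x \<in> P k}"

lemma orth_sub: assumes "sub U" "Z \<subseteq> U" shows "sub (orth k U Z)"
  using subD[OF assms(1)] assms(2) unfolding orth_def
  by (intro subI) (auto simp: w_zero w_add_l w_smult_l subset_iff)

lemma orth_antimono: "Z \<subseteq> Y \<Longrightarrow> orth k U Y \<subseteq> orth k U Z"
  unfolding orth_def by auto

lemma orth_subset: "orth k U Z \<subseteq> U"
  unfolding orth_def by auto

definition level :: "nat \<Rightarrow> 'c set \<Rightarrow> bool" where
  "level k U \<longleftrightarrow> (\<forall>x\<in>U. \<forall>y\<in>U. w x y \<in> P k)"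

definition linear_on :: "'c set \<Rightarrow> ('c \<Rightarrow> 'a) \<Rightarrow> bool" where
  "linear_on U f \<longleftrightarrow> (\<forall>x\<in>U. f x \<in> carrier R) \<and> (\<forall>x\<in>U. \<forall>y\<in>U. f (x \<boxplus> y) = f x \<oplus> f y)
      \<and> (\<forall>r\<in>carrier R. \<forall>x\<in>U. f (r \<bullet> x) = r \<otimes> f x)"

abbreviation rad where "rad k U \<equiv> orth (Suc k) U U"

text \<open>
  In terms of a suitable basis: \<open>p^-k w\<close> is integral on \<open>U\<close> with elementary divisors \<open>1\<close>
  (\<open>2d\<close> times) and \<open>p\<close> (\<open>2(n - d)\<close> times). The formulation avoids bases. It consists of the index of
  the radical modulo \<open>p\<close>, nondegeneracy, and the requirement that every linear functional whose
  values on the radical are divisible by \<open>p\<close> is represented by an element of \<open>U\<close>. These conditions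
  pass directly to the isotropic submodules below, see \<open>good_step\<close>.
\<close>

definition good :: "nat \<Rightarrow> nat \<Rightarrow> 'c set \<Rightarrow> bool" where
  "good k d U \<longleftrightarrow> free (2 * n) U \<and> level k U \<and> idx U (rad k U) = q ^ (2 * d)
     \<and> (\<forall>u\<in>U. (\<forall>x\<in>U. w u x = \<zero>) \<longrightarrow> u = \<zero>\<^sub>M)
     \<and> (\<forall>f. linear_on U f \<and> (\<forall>x\<in>rad k U. f x \<in> P 1) \<longrightarrow> (\<exists>u\<in>U. \<forall>x\<in>U. w u x = p [^] k \<otimes> f x))"

text \<open>
  These are the preimages of the isotropic subspaces of \<open>U\<close> modulo its radical.
\<close>

definition isos :: "nat \<Rightarrow> 'c set \<Rightarrow> 'c set set" where
  "isos k U = {Z. sub Z \<and> rad k U \<subseteq> Z \<and> Z \<subseteq> U \<and> level (Suc k) Z}"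

lemma pow_cancel: "\<lbrakk>c \<in> carrier R; c' \<in> carrier R; p [^] (k::nat) \<otimes> c = p [^] k \<otimes> c'\<rbrakk> \<Longrightarrow> c = c'"
  by (subst (asm) m_lcancel) auto

context
  fixes k U d
  assumes U: "sub U" and lev: "level k U" and idxU: "idx U (rad k U) = q ^ (2 * d)"
begin

lemma idxU_nz: "idx U (rad k U) \<noteq> 0"
  using idxU q_ge_2 by simp

lemma rad_sub: "sub (rad k U)"
  using U by (intro orth_sub) auto

lemma rad_subset: "rad k U \<subseteq> U"
  by (rule orth_subset)

lemma UM: "x \<in> U \<Longrightarrow> x \<in> carrier M"
  using subD[OF U] by auto

lemma pU_rad: "x \<in> U \<Longrightarrow> p \<bullet> x \<in> rad k U"
  using lev subD[OF U] unfolding orth_def level_def by (auto simp: w_smult_l P_mult_p_iff)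

lemma rad_orth: "rad k U \<subseteq> orth (Suc k) U Z" if "Z \<subseteq> U"
  using that by (rule orth_antimono)

lemma orth_rad: "orth (Suc k) U (rad k U) = U"
proof
  show "U \<subseteq> orth (Suc k) U (rad k U)"
  proof
    fix x assume x: "x \<in> U"
    have "w x y \<in> P (Suc k)" if y: "y \<in> rad k U" for y
    proof (rule w_swap_P)
      show "w y x \<in> P (Suc k)" using y x by (simp add: orth_def)
      show "x \<in> carrier M" using x by (rule UM)
      show "y \<in> carrier M" using y orth_subset by (intro UM) blast
    qed
    then show "x \<in> orth (Suc k) U (rad k U)" using x by (simp add: orth_def)
  qed
qed (rule orth_subset)

text \<open>
  The smaller orthogonal complement is the kernel of \<open>v \<mapsto> w v u\<close> with values in \<open>p^k / p^(k+1)\<close>,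
  which has \<open>q\<close> elements.
\<close>

lemma orth_line: 
  assumes Z: "sub Z" "Z \<subseteq> U" and u: "u \<in> U"
  shows "idx (orth (Suc k) U Z) (orth (Suc k) U (ext Z u)) \<le> q"
proof -
  let ?A = "orth (Suc k) U Z" and ?B = "orth (Suc k) U (ext Z u)"
  have um: "u \<in> carrier M" using u UM by auto
  have E: "sub (ext Z u)" "ext Z u \<subseteq> U" using Z u U um by (auto intro!: ext_sub dest: ext_least[THEN subsetD, rotated 3])
  have B: "sub ?B" using U E by (intro orth_sub) auto
  have B_iff: "v \<in> ?B" if v: "v \<in> ?A" "w v u \<in> P (Suc k)" for v
  proof -
    have "w v (x \<boxplus> r \<bullet> u) \<in> P (Suc k)" if "x \<in> Z" "r \<in> carrier R" for x r
      using that v um subD[OF Z(1)] UM unfolding orth_def by (auto simp: w_add_r w_smult_r)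
    then show ?thesis using v unfolding orth_def by (auto elim!: ext_E)
  qed
  have "\<exists>c s. c \<in> carrier R \<and> w v u = p [^] k \<otimes> c \<and> s \<in> S \<and> c \<ominus> s \<in> P 1" if v: "v \<in> U" for v
  proof -
    have "w v u \<in> P k" using v u lev by (auto simp: level_def)
    then obtain c where "c \<in> carrier R" "w v u = p [^] k \<otimes> c" by (rule P_E)
    then show ?thesis using S_repr[of c] P_1 by auto
  qed
  then obtain c g where cg: "\<And>v. v \<in> U \<Longrightarrow> c v \<in> carrier R \<and> w v u = p [^] k \<otimes> c v \<and> g v \<in> S \<and> c v \<ominus> g v \<in> P 1"
    by metis
  have eq: "cs ?B v = cs ?B v'" if v: "v \<in> ?A" "v' \<in> ?A" "g v = g v'" for v v'
  proof -
    have vU: "v \<in> U" "v' \<in> U" using v orth_subset by auto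
    have gc: "g v \<in> carrier R" using cg[OF vU(1)] S_closed by auto
    have "(c v \<ominus> g v) \<ominus> (c v' \<ominus> g v') \<in> P 1" by (rule P_diff) (use cg vU in blast)+
    also have "(c v \<ominus> g v) \<ominus> (c v' \<ominus> g v') = c v \<ominus> c v'" using cg[OF vU(1)] cg[OF vU(2)] gc
      unfolding v(3)[symmetric] by algebra
    finally have "p [^] k \<otimes> (c v \<ominus> c v') \<in> P (k + 1)" by (rule P_mult_pow)
    also have "p [^] k \<otimes> (c v \<ominus> c v') = w v u \<ominus> w v' u" using cg vU by (simp add: R.minus_eq R.r_distr R.r_minus)
    also have "\<dots> = w (v \<boxminus> v') u" using vU um UM by (simp add: w_diff_l)
    finally have "v \<boxminus> v' \<in> ?B" using v orth_sub[OF U Z(2)] by (intro B_iff subD(5)) auto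
    then show ?thesis using vU UM B by (subst cs_eq_iff) auto
  qed
  obtain T where T: "T \<subseteq> ?A" "inj_on (cs ?B) T" "cs ?B ` ?A = cs ?B ` T"
    using subset_image_inj[of "cs ?B ` ?A" "cs ?B" ?A] by auto
  have "inj_on g T"
  proof (rule inj_onI)
    fix x y assume xy: "x \<in> T" "y \<in> T" "g x = g y"
    then have "cs ?B x = cs ?B y" using eq T(1) by blast
    then show "x = y" using inj_onD[OF T(2)] xy by blast
  qed
  moreover have "g ` T \<subseteq> S" using T(1) orth_subset[of "Suc k" U Z] cg by blast
  ultimately have "card T \<le> q" using S_finite by (intro card_inj_on_le[of g])
  then show ?thesis unfolding idx_def T(3) using T(2) by (simp add: card_image)
qed

lemma orth_idx_le:
  assumes "sub Z" "sub Y" "rad k U \<subseteq> Z" "Z \<subseteq> Y" "Y \<subseteq> U"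
  shows "idx (orth (Suc k) U Z) (orth (Suc k) U Y) \<le> idx Y Z"
proof -
  have p: "p \<bullet> y \<in> Z" if "y \<in> Y" for y using that assms pU_rad by auto
  have XU: "Z \<subseteq> U" using assms by auto
  have nz: "idx Y Z \<noteq> 0"
    using idx_divisors_nonzero(1)[OF rad_sub assms(1) U assms(3) XU idxU_nz]
      idx_mult[OF assms(1,2) U assms(4,5)] by simp
  have "rad k U \<subseteq> Z \<longrightarrow> idx (orth (Suc k) U Z) (orth (Suc k) U Y) \<le> idx Y Z"
  proof (rule line_induct[OF assms(1,2,4) p nz])
    show "rad k U \<subseteq> Y \<longrightarrow> idx (orth (Suc k) U Y) (orth (Suc k) U Y) \<le> idx Y Y"
      using idx_self[OF orth_sub[OF U assms(5)]] idx_self[OF assms(2)] by simp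
  next
    fix Z u assume step: "sub Z" "Z \<subseteq> Y" "u \<in> Y" "sub (ext Z u)" "Z \<subseteq> ext Z u" "ext Z u \<subseteq> Y"
      "idx Y Z = idx Y (ext Z u) * q"
      "rad k U \<subseteq> ext Z u \<longrightarrow> idx (orth (Suc k) U (ext Z u)) (orth (Suc k) U Y) \<le> idx Y (ext Z u)"
    show "rad k U \<subseteq> Z \<longrightarrow> idx (orth (Suc k) U Z) (orth (Suc k) U Y) \<le> idx Y Z"
    proof
      assume r: "rad k U \<subseteq> Z"
      let ?o = "orth (Suc k) U"
      have XU: "Z \<subseteq> U" "u \<in> U" "ext Z u \<subseteq> U" using step assms by auto
      have "idx (?o Z) (?o Y) = idx (?o Z) (?o (ext Z u)) * idx (?o (ext Z u)) (?o Y)"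
        using step assms XU U by (intro idx_mult orth_sub orth_antimono) auto
      also have "\<dots> \<le> q * idx Y (ext Z u)" using step r orth_line[OF step(1) XU(1,2)] by (intro mult_le_mono) auto
      finally show "idx (?o Z) (?o Y) \<le> idx Y Z" using step by (simp add: mult.commute)
    qed
  qed
  then show ?thesis using assms by auto
qed

text \<open>
  Two applications of \<open>orth_idx_le\<close> give \<open>\<le>\<close> in both equations. The products of the two sides
  agree, both being the index of the radical, so equality holds.
\<close>

lemma orth_idx:
  assumes Z: "sub Z" "rad k U \<subseteq> Z" "Z \<subseteq> U"
  shows "idx U (orth (Suc k) U Z) = idx Z (rad k U)" "idx (orth (Suc k) U Z) (rad k U) = idx U Z"
proof -
  let ?o = "orth (Suc k) U"
  have a: "idx U (?o Z) \<le> idx Z (rad k U)" using orth_idx_le[OF rad_sub Z(1) subset_refl Z(2,3)] orth_rad by simp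
  have b: "idx (?o Z) (rad k U) \<le> idx U Z" using orth_idx_le[OF Z(1) U Z(2,3)] by simp
  have c: "idx U (rad k U) = idx U Z * idx Z (rad k U)" using rad_sub Z U by (intro idx_mult) auto
  have d: "idx U (rad k U) = idx U (?o Z) * idx (?o Z) (rad k U)"
    using Z U by (intro idx_mult rad_sub orth_sub orth_subset rad_orth) auto
  have pos: "idx U Z > 0" "idx Z (rad k U) > 0" using c idxU_nz by auto
  have e: "idx U Z * idx Z (rad k U) = idx U (?o Z) * idx (?o Z) (rad k U)" using c d by simp
  show 1: "idx U (?o Z) = idx Z (rad k U)"
  proof (rule ccontr)
    assume "\<not> ?thesis"
    then have "idx U (?o Z) < idx Z (rad k U)" using a by simp
    then have "idx U (?o Z) * idx (?o Z) (rad k U) < idx Z (rad k U) * idx U Z"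
      using b pos by (intro mult_less_le_imp_less) (use d idxU_nz in auto)
    then show False using e by (simp add: mult.commute)
  qed
  show "idx (?o Z) (rad k U) = idx U Z" using e pos unfolding 1 by simp
qed

lemma orth_orth:
  assumes Z: "sub Z" "rad k U \<subseteq> Z" "Z \<subseteq> U"
  shows "orth (Suc k) U (orth (Suc k) U Z) = Z"
proof -
  let ?o = "orth (Suc k) U"
  note oX = orth_sub[OF U Z(3), of "Suc k"] rad_orth[OF Z(3)] orth_subset[of "Suc k" U Z]
  note ooX = orth_sub[OF U oX(3), of "Suc k"] rad_orth[OF oX(3)] orth_subset[of "Suc k" U "?o Z"]
  have sub: "Z \<subseteq> ?o (?o Z)"
  proof
    fix x assume x: "x \<in> Z"
    then have xU: "x \<in> U" using Z by auto
    have "w x y \<in> P (Suc k)" if y: "y \<in> ?o Z" for y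
    proof (rule w_swap_P)
      show "w y x \<in> P (Suc k)" using y x by (simp add: orth_def)
      show "x \<in> carrier M" using xU by (rule UM)
      show "y \<in> carrier M" using y orth_subset by (intro UM) blast
    qed
    then show "x \<in> ?o (?o Z)" using xU by (simp add: orth_def)
  qed
  have "idx (?o (?o Z)) (rad k U) = idx Z (rad k U)" using orth_idx[OF Z] orth_idx[OF oX] by simp
  moreover have "idx (?o (?o Z)) (rad k U) = idx (?o (?o Z)) Z * idx Z (rad k U)"
    using rad_sub Z ooX sub by (intro idx_mult) auto
  moreover have "idx Z (rad k U) \<noteq> 0" using idx_divisors_nonzero[OF rad_sub Z(1) U Z(2,3) idxU_nz] by simp
  ultimately have "idx (?o (?o Z)) Z = 1" by simp
  then show ?thesis using idx_1_imp_eq[OF Z(1) ooX(1) sub] by simp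
qed

lemma isos_orth: "Z \<in> isos k U \<Longrightarrow> Z \<subseteq> orth (Suc k) U Z"
  unfolding isos_def orth_def level_def by auto

text \<open>
  Since \<open>Z\<close> is contained in its orthogonal complement, its dimension modulo the radical is at most
  half of \<open>2d\<close>; the number \<open>e\<close> is the defect.
\<close>

lemma isos_idx:
  assumes Z: "Z \<in> isos k U"
  obtains e where "e \<le> d" "idx U Z = q ^ (d + e)" "idx Z (rad k U) = q ^ (d - e)" "idx (orth (Suc k) U Z) Z = q ^ (2 * e)"
proof -
  have Z': "sub Z" "rad k U \<subseteq> Z" "Z \<subseteq> U" "level (Suc k) Z" using Z by (auto simp: isos_def)
  have p: "p \<bullet> y \<in> Z" if "y \<in> U" for y using that Z' pU_rad by auto
  have m: "idx U (rad k U) = idx U Z * idx Z (rad k U)" using rad_sub Z' U by (intro idx_mult) auto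
  obtain j where j: "idx U Z = q ^ j" using idx_power[OF Z'(1) U Z'(3) p] m idxU_nz by auto
  have 1: "j \<le> 2 * d \<and> idx Z (rad k U) = q ^ (2 * d - j)"
    by (rule q_pow_split) (use m j idxU in simp)
  have o: "idx U Z = idx U (orth (Suc k) U Z) * idx (orth (Suc k) U Z) Z"
    using Z' U isos_orth[OF Z] by (intro idx_mult orth_sub orth_subset) auto
  have 2: "2 * d - j \<le> j \<and> idx (orth (Suc k) U Z) Z = q ^ (j - (2 * d - j))"
    by (rule q_pow_split) (use o j 1 orth_idx[OF Z'(1-3)] in simp)
  show ?thesis
    by (rule that[of "j - d"]) (use 1 2 j in \<open>auto simp: algebra_simps intro!: arg_cong[of _ _ "\<lambda>x. q ^ x"]\<close>)
qed

end

end

section \<open>From level k to level k + 1\<close>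

text \<open>
  The recursion satisfied by the generating functions of the sublattices of level \<open>k + l\<close> in a good
  lattice with parameters \<open>k\<close> and \<open>d\<close>.
\<close>

fun level_series :: "nat \<Rightarrow> nat \<Rightarrow> nat \<Rightarrow> nat \<Rightarrow> rat fps" where
  "level_series q n 0 d = Abs_fps (\<lambda>j. of_nat (subcount q (2 * n) j))"
| "level_series q n (Suc l) d = (\<Sum>e\<le>d. fps_const (mob_count (of_nat q) d e) * fps_X ^ (d + e) * level_series q n l (n - e))"

context form_lattice begin

lemma good_facts:
  assumes "good k d U"
  shows "sub U" "level k U" "idx U (rad k U) = q ^ (2 * d)" "free (2 * n) U"
    "\<And>u. \<lbrakk>u \<in> U; \<And>x. x \<in> U \<Longrightarrow> w u x = \<zero>\<rbrakk> \<Longrightarrow> u = \<zero>\<^sub>M"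
    "\<And>f. \<lbrakk>linear_on U f; \<And>x. x \<in> rad k U \<Longrightarrow> f x \<in> P 1\<rbrakk> \<Longrightarrow> \<exists>u\<in>U. \<forall>x\<in>U. w u x = p [^] k \<otimes> f x"
  using assms free_sub unfolding good_def by blast+

lemma good_d_le: assumes "good k d U" shows "d \<le> n"
proof -
  note g = good_facts[OF assms]
  note c = g(1-3)
  have r: "sub (rad k U)" "rad k U \<subseteq> U" using rad_sub[OF c] rad_subset[OF c] by auto
  have "scale p U \<subseteq> rad k U" using pU_rad[OF c] unfolding scale_def by auto
  then have "idx U (scale p U) = idx U (rad k U) * idx (rad k U) (scale p U)"
    using r g(1) by (intro idx_mult scale_sub) auto
  then have "q ^ (2 * n) = q ^ (2 * d) * idx (rad k U) (scale p U)" unfolding free_scale[OF g(4)] g(3) .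
  then have "2 * d \<le> 2 * n" using q_pow_split by blast
  then show ?thesis by simp
qed

text \<open>
  The radical of \<open>Z\<close> at the next level is \<open>p\<close> times the orthogonal complement of \<open>Z\<close>: if
  \<open>w v\<close> has values in \<open>p^(k+2)\<close> on \<open>Z\<close>, then \<open>p^-(k+1) w v\<close> is a functional on \<open>U\<close> with
  values divisible by \<open>p\<close> on the radical, so that it is represented by some \<open>u \<in> U\<close>, and \<open>v = p u\<close>. A functional \<open>h\<close> on \<open>Z\<close> is
  represented by first representing \<open>x \<mapsto> h(p x)\<close> on \<open>U\<close>; the representing element lies in \<open>Z\<close>
  because it is orthogonal to the orthogonal complement of \<open>Z\<close>.
\<close>

lemma good_step:
  assumes good: "good k d U" and Z: "Z \<in> isos k U" and e: "idx U Z = q ^ (d + e)"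
  shows "good (Suc k) (n - e) Z" "e \<le> d"
proof -
  note g = good_facts[OF good]
  note c = g(1-3)
  let ?o = "orth (Suc k) U"
  have Z': "sub Z" "rad k U \<subseteq> Z" "Z \<subseteq> U" "level (Suc k) Z" using Z by (auto simp: isos_def)
  obtain e' where e': "e' \<le> d" "idx U Z = q ^ (d + e')" "idx Z (rad k U) = q ^ (d - e')" using isos_idx[OF c Z] by metis
  have ee: "e' = e" using e e'(2) q_pow_inj by auto
  show ed: "e \<le> d" using e' ee by simp
  have en: "e \<le> n" using ed good_d_le[OF good] by simp
  have UM: "x \<in> carrier M" if "x \<in> U" for x using that subD(2)[OF g(1)] by auto
  have o: "sub (?o Z)" "?o Z \<subseteq> U" using orth_sub[OF g(1) Z'(3)] orth_subset by auto
  have po: "p \<bullet> x \<in> Z" if "x \<in> U" for x using pU_rad[OF c that] Z' by auto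
  have free: "free (2 * n) Z" using g(1) Z' e q_ge_2 by (intro free_finite_index[OF g(4)]) auto
  have nondeg: "u = \<zero>\<^sub>M" if u: "u \<in> Z" "\<And>x. x \<in> Z \<Longrightarrow> w u x = \<zero>" for u
  proof (rule g(5))
    show uU: "u \<in> U" using u Z' by auto
    fix x assume x: "x \<in> U"
    have "p \<otimes> w u x = w u (p \<bullet> x)" using x uU UM by (simp add: w_smult_r)
    also have "\<dots> = \<zero>" using u(2) po x by simp
    finally show "w u x = \<zero>" using x uU UM by (simp add: integral_iff)
  qed
  have rad_eq: "rad (Suc k) Z = scale p (?o Z)"
  proof (intro equalityI subsetI)
    fix v assume "v \<in> scale p (?o Z)"
    then obtain u where u: "u \<in> U" "\<And>x. x \<in> Z \<Longrightarrow> w u x \<in> P (Suc k)" "v = p \<bullet> u" by (auto simp: scale_def orth_def)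
    have "w v x \<in> P (Suc (Suc k))" if "x \<in> Z" for x
      using that u UM Z'(3) P_mult_p_iff[of "w u x" "Suc k"] by (auto simp: w_smult_l)
    then show "v \<in> rad (Suc k) Z" using u po by (simp add: orth_def)
  next
    fix v assume v: "v \<in> rad (Suc k) Z"
    then have vZ: "v \<in> Z" "v \<in> U" and vo: "\<And>x. x \<in> Z \<Longrightarrow> w v x \<in> P (Suc (Suc k))" using Z' by (auto simp: orth_def)
    have vM: "v \<in> carrier M" using UM vZ by auto
    have vU: "w v x \<in> P (Suc k)" if x: "x \<in> U" for x
    proof -
      have "p \<otimes> w v x \<in> P (Suc (Suc k))" using vo[OF po[OF x]] x vM UM by (simp add: w_smult_r)
      then show ?thesis using x vM UM by (simp add: P_mult_p_iff)
    qed
    \<comment> \<open>the functional \<open>p^-(k+1) w v\<close>\<close>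
    define f where "f x = (SOME c. c \<in> carrier R \<and> w v x = p [^] Suc k \<otimes> c)" for x
    have f: "f x \<in> carrier R \<and> w v x = p [^] Suc k \<otimes> f x" if "x \<in> U" for x
      unfolding f_def by (rule someI_ex) (use vU[OF that] in \<open>unfold P_def, blast\<close>)
    have f_unique: "f x = a" if x: "x \<in> U" and a: "a \<in> carrier R" "w v x = p [^] Suc k \<otimes> a" for x a
    proof (rule pow_cancel)
      show "p [^] Suc k \<otimes> f x = p [^] Suc k \<otimes> a" using f[OF x] a(2) by metis
    qed (use f[OF x] a in auto)
    have lin: "linear_on U f" unfolding linear_on_def
    proof (intro conjI ballI)
      fix x y assume x: "x \<in> U" and y: "y \<in> U"
      show "f (x \<boxplus> y) = f x \<oplus> f y"
      proof (rule f_unique)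
        show "x \<boxplus> y \<in> U" using x y subD(4)[OF g(1)] by auto
        show "f x \<oplus> f y \<in> carrier R" using f x y by auto
        have "w v (x \<boxplus> y) = w v x \<oplus> w v y" using x y vM UM by (simp add: w_add_r)
        also have "\<dots> = p [^] Suc k \<otimes> f x \<oplus> p [^] Suc k \<otimes> f y" using f[OF x] f[OF y] by metis
        also have "\<dots> = p [^] Suc k \<otimes> (f x \<oplus> f y)" using f[OF x] f[OF y] by (simp add: R.r_distr)
        finally show "w v (x \<boxplus> y) = p [^] Suc k \<otimes> (f x \<oplus> f y)" .
      qed
    next
      fix r x assume r: "r \<in> carrier R" and x: "x \<in> U"
      show "f (r \<bullet> x) = r \<otimes> f x"
      proof (rule f_unique)
        show "r \<bullet> x \<in> U" using r x subD(7)[OF g(1)] by auto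
        show "r \<otimes> f x \<in> carrier R" using f x r by auto
        have "w v (r \<bullet> x) = r \<otimes> w v x" using r x vM UM by (simp add: w_smult_r)
        also have "\<dots> = r \<otimes> (p [^] Suc k \<otimes> f x)" using f[OF x] by metis
        also have "\<dots> = p [^] Suc k \<otimes> (r \<otimes> f x)" using f[OF x] r by (simp add: R.m_lcomm[of r])
        finally show "w v (r \<bullet> x) = p [^] Suc k \<otimes> (r \<otimes> f x)" .
      qed
    qed (use f in auto)
    have "f x \<in> P 1" if x: "x \<in> rad k U" for x
    proof -
      have xZ: "x \<in> Z" "x \<in> U" using x Z' by auto
      have "p [^] Suc k \<otimes> f x \<in> P (Suc k + 1)" using vo[OF xZ(1)] f[OF xZ(2)] by simp
      then show ?thesis using P_mult_pow_iff[of "f x" "Suc k" 1] f[OF xZ(2)] by blast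
    qed
    then obtain u where u: "u \<in> U" "\<And>x. x \<in> U \<Longrightarrow> w u x = p [^] k \<otimes> f x" using g(6)[OF lin] by blast
    have "w (v \<boxminus> p \<bullet> u) x = \<zero>" if x: "x \<in> U" for x
    proof -
      have fx: "f x \<in> carrier R" using f[OF x] by blast
      have "w (v \<boxminus> p \<bullet> u) x = w v x \<ominus> p \<otimes> w u x" using x u vM UM by (simp add: w_diff_l w_smult_l)
      also have "w v x = p [^] Suc k \<otimes> f x" using f[OF x] by blast
      also have "p \<otimes> w u x = p [^] Suc k \<otimes> f x" unfolding u(2)[OF x] using fx by (simp add: R.m_ac)
      finally show ?thesis using fx by (simp add: R.minus_eq R.r_neg)
    qed
    then have "v \<boxminus> p \<bullet> u = \<zero>\<^sub>M" using u vZ subD[OF g(1)] by (intro g(5)) auto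
    then have "(v \<boxminus> p \<bullet> u) \<boxplus> p \<bullet> u = \<zero>\<^sub>M \<boxplus> p \<bullet> u" by simp
    then have vpu: "v = p \<bullet> u" using vM UM u by (simp add: M.minus_eq M.a_assoc M.l_neg)
    have "w u x \<in> P (Suc k)" if x: "x \<in> Z" for x
    proof -
      have xU: "x \<in> U" using x Z' by auto
      have "p \<otimes> w u x \<in> P (Suc (Suc k))" using vo[OF x] unfolding vpu using xU u(1) UM by (auto simp: w_smult_l)
      then show ?thesis using xU u(1) UM by (simp add: P_mult_p_iff)
    qed
    then show "v \<in> scale p (?o Z)" using u vpu by (auto simp: scale_def orth_def)
  qed
  have radZ: "sub (rad (Suc k) Z)" "rad (Suc k) Z \<subseteq> Z" using orth_sub[OF Z'(1) subset_refl] orth_subset by auto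
  have idx_rad: "idx Z (rad (Suc k) Z) = q ^ (2 * (n - e))"
  proof -
    have "idx U Z * idx Z (rad (Suc k) Z) = idx U (rad (Suc k) Z)" using idx_mult[OF radZ(1) Z'(1) g(1) radZ(2) Z'(3)] by simp
    also have "\<dots> = idx U (scale p U) * idx (scale p U) (scale p (?o Z))"
      unfolding rad_eq using g(1) o by (intro idx_mult scale_sub scale_incl) (auto simp: scale_def)
    also have "\<dots> = q ^ (2 * n) * idx U (?o Z)" using idx_scale[OF o(1) g(1) o(2)] free_scale[OF g(4)] by simp
    also have "\<dots> = q ^ (2 * n) * q ^ (d - e)" using orth_idx(1)[OF c Z'(1-3)] e' ee by simp
    also have "\<dots> = q ^ (2 * n + (d - e))" by (simp add: power_add)
    finally have "q ^ (2 * n + (d - e)) = q ^ (d + e) * idx Z (rad (Suc k) Z)" using e by simp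
    then have "idx Z (rad (Suc k) Z) = q ^ (2 * n + (d - e) - (d + e))" using q_pow_split by blast
    moreover have "2 * n + (d - e) - (d + e) = 2 * (n - e)" using ed en by auto
    ultimately show ?thesis by simp
  qed
  have dual: "\<exists>u\<in>Z. \<forall>x\<in>Z. w u x = p [^] Suc k \<otimes> h x" if h: "linear_on Z h" "\<forall>x\<in>rad (Suc k) Z. h x \<in> P 1" for h
  proof -
    define f where "f x = h (p \<bullet> x)" for x
    have hc: "h x \<in> carrier R" if "x \<in> Z" for x using h that by (auto simp: linear_on_def)
    have hs: "h (r \<bullet> x) = r \<otimes> h x" if "r \<in> carrier R" "x \<in> Z" for r x using h that by (auto simp: linear_on_def)
    have "linear_on U f" unfolding linear_on_def
    proof (intro conjI ballI)
      fix x y assume x: "x \<in> U" and y: "y \<in> U"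
      have "h (p \<bullet> x \<boxplus> p \<bullet> y) = h (p \<bullet> x) \<oplus> h (p \<bullet> y)" using h(1) po[OF x] po[OF y] by (auto simp: linear_on_def)
      then show "f (x \<boxplus> y) = f x \<oplus> f y" unfolding f_def using x y UM by (simp add: smult_r_distr)
    next
      fix r x assume r: "r \<in> carrier R" and x: "x \<in> U"
      have "p \<bullet> r \<bullet> x = r \<bullet> p \<bullet> x" using r x UM by (simp add: smult_assoc1[symmetric] R.m_comm)
      then show "f (r \<bullet> x) = r \<otimes> f x" unfolding f_def using hs[OF r po[OF x]] by simp
    qed (use hc po in \<open>auto simp: f_def\<close>)
    moreover have "f x \<in> P 1" if x: "x \<in> rad k U" for x
    proof -
      have xZ: "x \<in> Z" using x Z' by auto
      have "f x = p [^] (1::nat) \<otimes> h x" unfolding f_def using hs[OF p_closed xZ] by simp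
      then show ?thesis using P_I[OF hc[OF xZ], of 1] by (simp only:)
    qed
    ultimately obtain u where u: "u \<in> U" "\<And>x. x \<in> U \<Longrightarrow> w u x = p [^] k \<otimes> f x" using g(6) by blast
    have "w u x \<in> P (Suc k)" if x: "x \<in> ?o Z" for x
    proof -
      have xU: "x \<in> U" using x orth_subset by auto
      have "p \<bullet> x \<in> rad (Suc k) Z" unfolding rad_eq using x by (auto simp: scale_def)
      then have "f x \<in> P 1" using h(2) by (simp add: f_def)
      then have "p [^] k \<otimes> f x \<in> P (k + 1)" by (rule P_mult_pow)
      then show ?thesis using u(2)[OF xU] by simp
    qed
    then have "u \<in> ?o (?o Z)" using u by (simp add: orth_def)
    then have uZ: "u \<in> Z" using orth_orth[OF c Z'(1-3)] by simp
    have "w u x = p [^] Suc k \<otimes> h x" if x: "x \<in> Z" for x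
    proof -
      have xU: "x \<in> U" using x Z' by auto
      have "w u x = p [^] k \<otimes> (p \<otimes> h x)" using u(2)[OF xU] hs[OF p_closed x] by (simp add: f_def)
      then show ?thesis using hc[OF x] by (simp add: R.m_assoc)
    qed
    then show ?thesis using uZ by blast
  qed
  show "good (Suc k) (n - e) Z" unfolding good_def using free Z'(4) idx_rad nondeg dual by blast
qed

section \<open>Moebius inversion over isotropic submodules\<close>

definition isos_above :: "nat \<Rightarrow> nat \<Rightarrow> 'c set \<Rightarrow> 'c set \<Rightarrow> nat \<Rightarrow> 'c set set" where
  "isos_above k d U A e = {Z \<in> isos k U. A \<subseteq> Z \<and> idx U Z = q ^ (d + e)}"

definition mob_weight :: "nat \<Rightarrow> rat" where "mob_weight e = (- 1) ^ e * of_nat q ^ e\<^sup>2"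

context
  fixes k d U
  assumes U: "sub U" and lev: "level k U" and idxU: "idx U (rad k U) = q ^ (2 * d)"
begin

lemma isos_pU: "\<lbrakk>A \<in> isos k U; x \<in> U\<rbrakk> \<Longrightarrow> p \<bullet> x \<in> A"
  using pU_rad[OF U lev idxU, of x] by (auto simp: isos_def)

text \<open>
  The form being alternating, \<open>A\<close> stays isotropic when a vector orthogonal to \<open>A\<close> is adjoined.
\<close>

lemma isos_line:
  assumes A: "A \<in> isos k U" and L: "L \<in> lines A (orth (Suc k) U A)"
  shows "L \<in> isos k U"
proof -
  let ?o = "orth (Suc k) U"
  have A': "sub A" "rad k U \<subseteq> A" "A \<subseteq> U" "level (Suc k) A" using A by (auto simp: isos_def)
  have L': "sub L" "A \<subseteq> L" "L \<subseteq> ?o A" "idx L A = q" using L by (auto simp: lines_def)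
  have LU: "L \<subseteq> U" using L'(3) orth_subset by blast
  have UM: "x \<in> carrier M" if "x \<in> U" for x using that subD(2)[OF U] by auto
  have "L \<noteq> A" using L'(4) idx_self[OF A'(1)] q_ge_2 by auto
  then obtain u where u: "u \<in> L" "u \<notin> A" using L' by auto
  have Le: "L = ext A u"
    by (rule lines_eq_ext[OF A'(1) orth_sub[OF U A'(3)] _ L u]) (use isos_pU[OF A] orth_subset in blast)
  have uU: "u \<in> U" using u LU by auto
  have ua: "w u x \<in> P (Suc k)" if "x \<in> A" for x using u(1) L'(3) that by (auto simp: orth_def)
  have au: "w x u \<in> P (Suc k)" if "x \<in> A" for x
    by (rule w_swap_P[OF _ _ ua[OF that]]) (use UM uU A' that in auto)
  have aa: "w x y \<in> P (Suc k)" if "x \<in> A" "y \<in> A" for x y using A'(4) that by (auto simp: level_def)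
  have "w (x \<boxplus> r \<bullet> u) (y \<boxplus> t \<bullet> u) \<in> P (Suc k)" if xy: "x \<in> A" "y \<in> A" "r \<in> carrier R" "t \<in> carrier R" for x y r t
  proof -
    have m: "x \<in> carrier M" "y \<in> carrier M" "u \<in> carrier M" using xy A' UM uU by auto
    have "w (x \<boxplus> r \<bullet> u) (y \<boxplus> t \<bullet> u) = (w x y \<oplus> r \<otimes> w u y) \<oplus> t \<otimes> (w x u \<oplus> r \<otimes> w u u)"
      using m xy(3,4) by (simp add: w_add_l w_add_r w_smult_l w_smult_r)
    also have "\<dots> \<in> P (Suc k)" using m xy ua au aa by (intro P_add P_mult) (simp_all add: w_self)
    finally show ?thesis .
  qed
  then have "level (Suc k) L" unfolding level_def Le by (auto elim!: ext_E)
  then show ?thesis using L' A' LU by (auto simp: isos_def)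
qed

text \<open>
  Induction on the codimension \<open>a\<close>, counting the pairs \<open>A \<subset> L \<subseteq> Z\<close> in which \<open>L\<close> has index \<open>q\<close> over
  \<open>A\<close> in two ways. There are \<open>(q^(2a) - 1)/(q - 1)\<close> choices of \<open>L\<close> in the orthogonal complement of
  \<open>A\<close>, and \<open>(q^(a-e) - 1)/(q - 1)\<close> of them lie in a given \<open>Z\<close>.
\<close>

lemma card_isos_above: "\<lbrakk>A \<in> isos k U; idx U A = q ^ (d + a)\<rbrakk> \<Longrightarrow> finite (isos_above k d U A e) \<and> of_nat (card (isos_above k d U A e)) = iso_count (of_nat q) a e"
proof (induct a arbitrary: A)
  case 0
  have A: "sub A" "rad k U \<subseteq> A" "A \<subseteq> U" using 0 by (auto simp: isos_def)
  have "idx Z A = 1 \<and> e = 0" if "Z \<in> isos_above k d U A e" for Z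
  proof -
    have Z: "sub Z" "A \<subseteq> Z" "Z \<subseteq> U" "idx U Z = q ^ (d + e)" using that by (auto simp: isos_above_def isos_def)
    have "q ^ d = q ^ (d + e) * idx Z A" using idx_mult[OF A(1) Z(1) U Z(2,3)] Z(4) 0 by simp
    then have "d + e \<le> d \<and> idx Z A = q ^ (d - (d + e))" by (rule q_pow_split)
    then show ?thesis by simp
  qed
  moreover have "Z = A" if "Z \<in> isos_above k d U A e" "idx Z A = 1" for Z
    using idx_1_imp_eq[OF A(1)] that by (auto simp: isos_above_def isos_def)
  moreover have "A \<in> isos_above k d U A 0" using 0 by (auto simp: isos_above_def)
  ultimately have "isos_above k d U A e = (if e = 0 then {A} else {})" by auto
  then show ?case using q_ge_2 by (simp add: iso_count_def)
next
  case (Suc a)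
  let ?o = "orth (Suc k) U" and ?Q = "of_nat q :: rat"
  have Q: "?Q > 1" using q_ge_2 by simp
  have A: "sub A" "rad k U \<subseteq> A" "A \<subseteq> U" using Suc by (auto simp: isos_def)
  obtain a' where "idx U A = q ^ (d + a')" "idx (?o A) A = q ^ (2 * a')" using isos_idx[OF U lev idxU Suc(2)] by metis
  then have oA: "idx (?o A) A = q ^ (2 * Suc a)" using Suc(3) q_pow_inj[of "d + a'" "d + Suc a"] by simp
  have oAs: "sub (?o A)" "A \<subseteq> ?o A" "?o A \<subseteq> U" using orth_sub[OF U A(3)] isos_orth[OF U lev idxU Suc(2)] orth_subset by auto
  let ?L = "lines A (?o A)"
  have L: "finite ?L" "card ?L * (q - 1) = q ^ (2 * Suc a) - 1"
    using card_lines[OF A(1) oAs(1,2)] isos_pU[OF Suc(2)] oAs(3) oA q_ge_2 by auto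
  have Lm: "L \<in> isos k U \<and> idx U L = q ^ (d + a) \<and> A \<subseteq> L" if L: "L \<in> ?L" for L
  proof -
    have L': "sub L" "A \<subseteq> L" "L \<subseteq> U" "idx L A = q" using L oAs by (auto simp: lines_def)
    have "q ^ (d + Suc a) = q ^ 1 * idx U L" using idx_mult[OF A(1) L'(1) U L'(2,3)] L'(4) Suc(3) by (simp add: mult.commute)
    then have "idx U L = q ^ (d + Suc a - 1)" using q_pow_split by blast
    then show ?thesis using isos_line[OF Suc(2) L] L' by simp
  qed
  show ?case
  proof (cases "e \<le> a")
    case False
    show ?thesis
    proof (cases "e = Suc a")
      case True
      have "Z = A" if "Z \<in> isos_above k d U A e" for Z
      proof -
        have Z: "sub Z" "A \<subseteq> Z" "Z \<subseteq> U" "idx U Z = q ^ (d + e)" using that by (auto simp: isos_above_def isos_def)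
        have "q ^ (d + e) = q ^ (d + e) * idx Z A" using idx_mult[OF A(1) Z(1) U Z(2,3)] Z(4) Suc(3) True by simp
        then have "idx Z A = 1" using q_ge_2 by simp
        then show ?thesis using idx_1_imp_eq[OF A(1) Z(1,2)] by simp
      qed
      moreover have "A \<in> isos_above k d U A e" using Suc True by (auto simp: isos_above_def)
      ultimately have "isos_above k d U A e = {A}" by auto
      then show ?thesis using True iso_count_self[OF Q] by simp
    next
      case neq: False
      have "False" if "Z \<in> isos_above k d U A e" for Z
      proof -
        have Z: "sub Z" "A \<subseteq> Z" "Z \<subseteq> U" "idx U Z = q ^ (d + e)" using that by (auto simp: isos_above_def isos_def)
        have "q ^ (d + Suc a) = q ^ (d + e) * idx Z A" using idx_mult[OF A(1) Z(1) U Z(2,3)] Z(4) Suc(3) by simp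
        then have "d + e \<le> d + Suc a" using q_pow_split by blast
        then show False using False neq by simp
      qed
      then have "isos_above k d U A e = {}" by auto
      then show ?thesis using False neq by (simp add: iso_count_def)
    qed
  next
    case True
    have eq: "isos_above k d U A e = (\<Union>L\<in>?L. isos_above k d U L e)"
    proof (intro equalityI subsetI)
      fix Z assume "Z \<in> (\<Union>L\<in>?L. isos_above k d U L e)"
      then show "Z \<in> isos_above k d U A e" using Lm by (auto simp: isos_above_def)
    next
      fix Z assume Zab: "Z \<in> isos_above k d U A e"
      then have Z: "Z \<in> isos k U" "sub Z" "A \<subseteq> Z" "Z \<subseteq> U" "idx U Z = q ^ (d + e)" by (auto simp: isos_above_def isos_def)
      have Zo: "Z \<subseteq> ?o A" using isos_orth[OF U lev idxU Z(1)] orth_antimono[OF Z(3)] by blast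
      have "Z \<noteq> A" using Z(5) Suc(3) True q_pow_inj[of "d + e" "d + Suc a"] by auto
      then obtain u where u: "u \<in> Z" "u \<notin> A" using Z by auto
      have "ext A u \<in> lines A Z" using ext_in_lines[OF A(1) Z(2,3) _ u] isos_pU[OF Suc(2)] Z(4) by blast
      then have "ext A u \<in> ?L" "ext A u \<subseteq> Z" using Zo by (auto simp: lines_def)
      then show "Z \<in> (\<Union>L\<in>?L. isos_above k d U L e)" using Zab by (auto simp: isos_above_def)
    qed
    have IH: "finite (isos_above k d U L e)" "of_nat (card (isos_above k d U L e)) = iso_count ?Q a e" if "L \<in> ?L" for L
      using Suc(1)[of L] Lm[OF that] by auto
    have fin: "finite (isos_above k d U A e)" unfolding eq using L IH by auto
    have lA: "{L \<in> ?L. Z \<in> isos_above k d U L e} = lines A Z" "card (lines A Z) * (q - 1) = q ^ (Suc a - e) - 1"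
      if Z': "Z \<in> isos_above k d U A e" for Z
    proof -
      have Z: "Z \<in> isos k U" "sub Z" "A \<subseteq> Z" "Z \<subseteq> U" "idx U Z = q ^ (d + e)" using Z' by (auto simp: isos_above_def isos_def)
      have Zo: "Z \<subseteq> ?o A" using isos_orth[OF U lev idxU Z(1)] orth_antimono[OF Z(3)] by blast
      show "{L \<in> ?L. Z \<in> isos_above k d U L e} = lines A Z" using Zo Z by (auto simp: isos_above_def lines_def)
      have "q ^ (d + Suc a) = q ^ (d + e) * idx Z A" using idx_mult[OF A(1) Z(2) U Z(3,4)] Z(5) Suc(3) by simp
      then have "idx Z A = q ^ (d + Suc a - (d + e))" using q_pow_split by blast
      then have i: "idx Z A = q ^ (Suc a - e)" by simp
      have pz: "p \<bullet> y \<in> A" if "y \<in> Z" for y using isos_pU[OF Suc(2)] that Z(4) by blast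
      have "idx Z A \<noteq> 0" using i q_ge_2 by simp
      then show "card (lines A Z) * (q - 1) = q ^ (Suc a - e) - 1" using card_lines(2)[OF A(1) Z(2,3) pz] i by simp
    qed
    have double: "(\<Sum>L\<in>?L. card (isos_above k d U L e)) = (\<Sum>Z\<in>isos_above k d U A e. card (lines A Z))"
    proof -
      have "(\<Sum>L\<in>?L. card (isos_above k d U L e)) = (\<Sum>L\<in>?L. card {Z \<in> isos_above k d U A e. Z \<in> isos_above k d U L e})"
        unfolding eq by (intro sum.cong arg_cong[of _ _ card]) auto
      also have "\<dots> = (\<Sum>Z\<in>isos_above k d U A e. card {L \<in> ?L. Z \<in> isos_above k d U L e})"
        by (rule sum_multicount_gen[OF L(1) fin]) auto
      also have "\<dots> = (\<Sum>Z\<in>isos_above k d U A e. card (lines A Z))" using lA by (intro sum.cong) auto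
      finally show ?thesis .
    qed
    have pq: "of_nat (q ^ m - 1) = ?Q ^ m - 1" for m using q_ge_2 by (simp add: of_nat_diff)
    have q1: "of_nat (q - 1) = ?Q - 1" using q_ge_2 by (simp add: of_nat_diff)
    have "of_nat (\<Sum>L\<in>?L. card (isos_above k d U L e)) * (?Q - 1) = (of_nat (card ?L) * (?Q - 1)) * iso_count ?Q a e"
      using IH by simp
    also have "of_nat (card ?L) * (?Q - 1) = ?Q ^ (2 * Suc a) - 1"
      unfolding q1[symmetric] of_nat_mult[symmetric] L(2) pq ..
    finally have 1: "of_nat (\<Sum>L\<in>?L. card (isos_above k d U L e)) * (?Q - 1) = (?Q ^ (2 * Suc a) - 1) * iso_count ?Q a e" .
    have "of_nat (\<Sum>Z\<in>isos_above k d U A e. card (lines A Z)) * (?Q - 1) = of_nat (\<Sum>Z\<in>isos_above k d U A e. card (lines A Z) * (q - 1))"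
      unfolding q1[symmetric] of_nat_mult[symmetric] sum_distrib_right ..
    also have "\<dots> = of_nat (card (isos_above k d U A e)) * (?Q ^ (Suc a - e) - 1)"
      using lA pq by simp
    finally have "of_nat (card (isos_above k d U A e)) * (?Q ^ (Suc a - e) - 1) = (?Q ^ (2 * Suc a) - 1) * iso_count ?Q a e" using 1 double by simp
    also have "\<dots> = iso_count ?Q (Suc a) e * (?Q ^ (Suc a - e) - 1)" using iso_count_Suc[OF Q True] by (simp add: algebra_simps)
    finally have "of_nat (card (isos_above k d U A e)) = iso_count ?Q (Suc a) e" using Qpow_neq[OF Q, of "Suc a - e"] True by simp
    then show ?thesis using fin by simp
  qed
qed

text \<open>
  An isotropic \<open>Z\<close> contains \<open>L\<close> if and only if it contains the isotropic submodule generated by \<open>L\<close>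
  and the radical, so \<open>card_isos_above\<close> and \<open>sum_mob_count\<close> apply.
\<close>

lemma moebius:
  assumes L: "sub L" "L \<subseteq> U" "level (Suc k) L"
  shows "(\<Sum>e\<le>d. \<Sum>Z\<in>isos_above k d U (rad k U) e. if L \<subseteq> Z then mob_weight e else 0) = 1"
proof -
  note c = U lev idxU
  have Q: "(of_nat q :: rat) > 1" using q_ge_2 by simp
  let ?r = "rad k U"
  have r: "sub ?r" "?r \<subseteq> U" using rad_sub[OF c] rad_subset[OF c] by auto
  have UM: "x \<in> carrier M" if "x \<in> U" for x using that subD(2)[OF U] by auto
  let ?A = "msum ?r L"
  have A: "sub ?A" "?r \<subseteq> ?A" "L \<subseteq> ?A" "?A \<subseteq> U" using msum_sub[OF r(1) L(1)] msum_incl[OF r(1) L(1)] msum_least[OF U r(2) L(2)] by auto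
  have rx: "w x y \<in> P (Suc k)" if "x \<in> ?r" "y \<in> U" for x y using that by (auto simp: orth_def)
  have xr: "w y x \<in> P (Suc k)" if "x \<in> ?r" "y \<in> U" for x y
    by (rule w_swap_P[OF _ _ rx[OF that]]) (use UM that r in auto)
  have "w (x \<boxplus> l) (y \<boxplus> l') \<in> P (Suc k)" if xy: "x \<in> ?r" "l \<in> L" "y \<in> ?r" "l' \<in> L" for x y l l'
  proof -
    have xU: "x \<in> U" "y \<in> U" "l \<in> U" "l' \<in> U" using xy r L by auto
    have "w (x \<boxplus> l) (y \<boxplus> l') = (w x y \<oplus> w l y) \<oplus> (w x l' \<oplus> w l l')" using xU UM by (simp add: w_add_l w_add_r)
    also have "\<dots> \<in> P (Suc k)" using xy xU rx xr L(3) by (intro P_add) (auto simp: level_def)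
    finally show ?thesis .
  qed
  then have "level (Suc k) ?A" unfolding level_def by (auto elim!: msum_E)
  then have Ai: "?A \<in> isos k U" using A by (auto simp: isos_def)
  obtain a where a: "a \<le> d" "idx U ?A = q ^ (d + a)" using isos_idx[OF c Ai] by metis
  have eq: "{Z \<in> isos_above k d U ?r e. L \<subseteq> Z} = isos_above k d U ?A e" for e
  proof -
    have "L \<subseteq> Z \<longleftrightarrow> ?A \<subseteq> Z" if "sub Z" "?r \<subseteq> Z" for Z
      using msum_least[OF that(1,2)] A by blast
    then show ?thesis by (auto simp: isos_above_def isos_def)
  qed
  have ri: "?r \<in> isos k U" unfolding isos_def level_def using r rx by auto
  have fin: "finite (isos_above k d U ?r e)" for e using card_isos_above[OF ri, of d e] idxU by (simp add: mult_2)
  have "(\<Sum>Z\<in>isos_above k d U ?r e. if L \<subseteq> Z then mob_weight e else 0) = mob_count (of_nat q) a e" for e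
  proof -
    have "(\<Sum>Z\<in>isos_above k d U ?r e. if L \<subseteq> Z then mob_weight e else 0) = (\<Sum>Z\<in>isos_above k d U ?A e. mob_weight e)"
      unfolding eq[symmetric] by (rule sum.inter_filter[OF fin, symmetric])
    then show ?thesis using card_isos_above[OF Ai a(2), of e] by (simp add: mob_weight_def mob_count_def)
  qed
  then have "(\<Sum>e\<le>d. \<Sum>Z\<in>isos_above k d U ?r e. if L \<subseteq> Z then mob_weight e else 0) = (\<Sum>e\<le>d. mob_count (of_nat q) a e)" by simp
  also have "\<dots> = (\<Sum>e\<le>a. mob_count (of_nat q) a e)"
    using a mob_count_gt[OF Q] by (intro sum.mono_neutral_right) auto
  also have "\<dots> = 1" by (rule sum_mob_count[OF Q])
  finally show ?thesis .
qed

end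

definition level_subs :: "nat \<Rightarrow> 'c set \<Rightarrow> nat \<Rightarrow> 'c set set" where
  "level_subs k U j = {L \<in> index_subs U j. level k L}"

text \<open>
  Each sublattice is weighted by the sum \<open>1\<close> from \<open>moebius\<close>. Exchanging the summations leaves the
  sublattices of the isotropic submodules, which are good at the next level.
\<close>

lemma card_level_subs:
  "good k d U \<Longrightarrow> of_nat (card (level_subs (k + l) U j)) = fps_nth (level_series q n l d) j"
proof (induct l arbitrary: k d U j)
  case 0
  note g = good_facts[OF 0]
  have "level_subs k U j = index_subs U j" unfolding level_subs_def index_subs_def using g(2) by (auto simp: level_def)
  then show ?case using card_index_subs[OF g(4), of j] by simp
next
  case (Suc l)
  note g = good_facts[OF Suc(2)]
  note c = g(1-3)
  let ?r = "rad k U" and ?K = "Suc k + l"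
  have r: "sub ?r" "?r \<subseteq> U" using rad_sub[OF c] rad_subset[OF c] by auto
  have ri: "?r \<in> isos k U" unfolding isos_def level_def using r by (auto simp: orth_def)
  have ab: "finite (isos_above k d U ?r e)" "of_nat (card (isos_above k d U ?r e)) = iso_count (of_nat q) d e" for e
    using card_isos_above[OF c ri, of d e] g(3) by (auto simp: mult_2)
  have fin: "finite (level_subs ?K U j)" using card_index_subs[OF g(4), of j] by (simp add: level_subs_def)
  have one: "(\<Sum>e\<le>d. \<Sum>Z\<in>isos_above k d U ?r e. if L \<subseteq> Z then mob_weight e else 0) = 1" if "L \<in> level_subs ?K U j" for L
  proof (rule moebius[OF c])
    have "P ?K \<subseteq> P (Suc k)" by (rule P_antimono) simp
    then show "sub L" "L \<subseteq> U" "level (Suc k) L" using that by (auto simp: level_subs_def index_subs_def level_def)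
  qed
  have cnt: "of_nat (card {L \<in> level_subs ?K U j. L \<subseteq> Z}) = fps_nth (fps_X ^ (d + e) * level_series q n l (n - e)) j"
    if Z: "Z \<in> isos_above k d U ?r e" for Z e
  proof -
    have Z': "Z \<in> isos k U" "idx U Z = q ^ (d + e)" "sub Z" "Z \<subseteq> U" using Z by (auto simp: isos_above_def isos_def)
    have gZ: "good (Suc k) (n - e) Z" by (rule good_step(1)[OF Suc(2) Z'(1,2)])
    have i: "idx U L = q ^ (d + e) * idx Z L" if "sub L" "L \<subseteq> Z" for L
      using idx_mult[OF that(1) Z'(3) g(1) that(2) Z'(4)] Z'(2) by simp
    show ?thesis
    proof (cases "d + e \<le> j")
      case True
      then have jj: "q ^ j = q ^ (d + e) * q ^ (j - (d + e))" by (simp add: power_add[symmetric])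
      have "idx U L = q ^ j \<longleftrightarrow> idx Z L = q ^ (j - (d + e))" if "sub L" "L \<subseteq> Z" for L
        unfolding i[OF that] jj using q_ge_2 by simp
      then have "{L \<in> level_subs ?K U j. L \<subseteq> Z} = level_subs ?K Z (j - (d + e))"
        using Z'(4) by (auto simp: level_subs_def index_subs_def)
      then show ?thesis using Suc(1)[OF gZ] True by (simp add: fps_X_power_mult_nth)
    next
      case False
      have "idx U L \<noteq> q ^ j" if "sub L" "L \<subseteq> Z" for L
        using i[OF that] q_pow_split[of j "d + e" "idx Z L"] False by auto
      then have "{L \<in> level_subs ?K U j. L \<subseteq> Z} = {}" by (auto simp: level_subs_def index_subs_def)
      then have "card {L \<in> level_subs ?K U j. L \<subseteq> Z} = 0" by (simp only: card.empty)
      then show ?thesis using False by (simp only: fps_X_power_mult_nth) simp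
    qed
  qed
  have "of_nat (card (level_subs ?K U j)) = (\<Sum>L\<in>level_subs ?K U j. \<Sum>e\<le>d. \<Sum>Z\<in>isos_above k d U ?r e. if L \<subseteq> Z then mob_weight e else 0)"
    using one by simp
  also have "\<dots> = (\<Sum>e\<le>d. \<Sum>L\<in>level_subs ?K U j. \<Sum>Z\<in>isos_above k d U ?r e. if L \<subseteq> Z then mob_weight e else 0)"
    by (rule sum.swap)
  also have "\<dots> = (\<Sum>e\<le>d. \<Sum>Z\<in>isos_above k d U ?r e. \<Sum>L\<in>level_subs ?K U j. if L \<subseteq> Z then mob_weight e else 0)"
    by (intro sum.cong refl sum.swap)
  also have "\<dots> = (\<Sum>e\<le>d. \<Sum>Z\<in>isos_above k d U ?r e. mob_weight e * fps_nth (fps_X ^ (d + e) * level_series q n l (n - e)) j)"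
  proof (intro sum.cong refl)
    fix e Z assume Z: "Z \<in> isos_above k d U ?r e"
    have "(\<Sum>L\<in>level_subs ?K U j. if L \<subseteq> Z then mob_weight e else 0) = (\<Sum>L\<in>{L \<in> level_subs ?K U j. L \<subseteq> Z}. mob_weight e)"
      by (rule sum.inter_filter[OF fin, symmetric])
    also have "\<dots> = mob_weight e * of_nat (card {L \<in> level_subs ?K U j. L \<subseteq> Z})" by simp
    finally show "(\<Sum>L\<in>level_subs ?K U j. if L \<subseteq> Z then mob_weight e else 0) = mob_weight e * fps_nth (fps_X ^ (d + e) * level_series q n l (n - e)) j"
      unfolding cnt[OF Z] .
  qed
  also have "\<dots> = (\<Sum>e\<le>d. mob_count (of_nat q) d e * fps_nth (fps_X ^ (d + e) * level_series q n l (n - e)) j)"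
    using ab(2) by (simp add: mob_count_def mob_weight_def mult_ac)
  also have "\<dots> = fps_nth (level_series q n (Suc l) d) j"
    by (simp add: fps_sum_nth mult.assoc)
  finally show ?case by simp
qed

end

section \<open>The generating function\<close>

definition subcount_series :: "nat \<Rightarrow> nat \<Rightarrow> rat fps" where
  "subcount_series q m = Abs_fps (\<lambda>j. of_nat (subcount q m j))"

abbreviation dilate :: "rat \<Rightarrow> rat fps \<Rightarrow> rat fps" where
  "dilate c f \<equiv> fps_compose f (fps_const c * fps_X)"

lemma dilate_mult: "dilate c (f * g) = dilate c f * dilate c g"
  by (rule fps_compose_mult_distrib) simp

lemma dilate_qpochhammer: "dilate c (qpochhammer fps_X (fps_const c) m) = qpochhammer (fps_X * fps_const c) (fps_const c) m"
proof (induct m)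
  case (Suc m)
  have e: "dilate c (1 - fps_X * fps_const c ^ m) = 1 - fps_const c * fps_X * fps_const c ^ m"
    by (simp add: fps_compose_sub_distrib dilate_mult fps_const_power)
  show ?case unfolding qpochhammer_Suc dilate_mult Suc e by (simp only: mult.commute[of "fps_const c" fps_X])
qed simp

text \<open>
  The recursion for \<open>subcount\<close> says that \<open>1 - T\<close> times the series for \<open>m + 1\<close> is the series for \<open>m\<close>
  at \<open>qT\<close>.
\<close>

lemma subcount_series_mult: "subcount_series q m * qpochhammer fps_X (fps_const (of_nat q)) m = 1"
proof (induct m)
  case 0
  show ?case by (rule fps_ext) (simp add: subcount_series_def)
next
  case (Suc m)
  have "subcount_series q (Suc m) * (1 - fps_X) = dilate (of_nat q) (subcount_series q m)"
  proof (rule fps_ext)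
    fix j
    show "fps_nth (subcount_series q (Suc m) * (1 - fps_X)) j = fps_nth (dilate (of_nat q) (subcount_series q m)) j"
    proof -
      have "fps_nth (dilate (of_nat q) (subcount_series q m)) j = of_nat q ^ j * of_nat (subcount q m j)"
        by (simp add: subcount_series_def fps_nth_compose_linear)
      moreover have "fps_nth (subcount_series q (Suc m) * (1 - fps_X)) j = of_nat q ^ j * of_nat (subcount q m j)"
        by (cases j) (simp_all add: subcount_series_def algebra_simps)
      ultimately show ?thesis by (simp only:)
    qed
  qed
  then have "subcount_series q (Suc m) * qpochhammer fps_X (fps_const (of_nat q)) (Suc m)
    = dilate (of_nat q) (subcount_series q m) * dilate (of_nat q) (qpochhammer fps_X (fps_const (of_nat q)) m)"
    unfolding qpochhammer_Suc_left dilate_qpochhammer mult.assoc[symmetric] by simp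
  also have "\<dots> = 1" unfolding dilate_mult[symmetric] Suc by simp
  finally show ?case .
qed

lemma fps_const_sum: "fps_const (sum f A) = (\<Sum>x\<in>A. fps_const (f x :: rat))"
  by (induct A rule: infinite_finite_induct) (simp_all flip: fps_const_add)

lemma fps_const_divide_mult:
  fixes a b :: rat assumes "b \<noteq> 0" "fps_nth D 0 = 1"
  shows "fps_const a / (fps_const b * D) = fps_const (a / b) * inverse D"
proof -
  have "fps_const a / (fps_const b * D) = fps_const a * inverse (fps_const b * D)"
    using assms by (intro fps_divide_unit) simp
  also have "\<dots> = fps_const (a * inverse b) * inverse D"
    by (simp only: fps_inverse_mult fps_const_inverse fps_const_mult[symmetric] mult.assoc)
  finally show ?thesis by (simp only: divide_inverse)
qed

context fixes q :: nat and Q :: rat assumes q: "q \<ge> 2" and Qq: "Q = of_nat q"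
begin

lemma Q_gt_1: "Q > 1" using q Qq by simp

text \<open>
  The polynomial with coefficients \<open>m\<close> applied to the vector of series. The factor \<open>T^j\<close> absorbs the
  part of the exponent in the recursion that depends on \<open>d\<close>, so that one step in \<open>l\<close> becomes
  \<open>transfer_op\<close> times \<open>T^n\<close>.
\<close>

definition pairing :: "nat \<Rightarrow> nat \<Rightarrow> (nat \<Rightarrow> rat) \<Rightarrow> rat fps" where
  "pairing n l m = (\<Sum>j\<le>n. fps_const (m j) * fps_X ^ j * level_series q n l (n - j))"

lemma pairing_Suc: "pairing n (Suc l) m = fps_X ^ n * pairing n l (transfer_op Q n m)"
proof -
  have t: "fps_const (m j) * fps_X ^ j * level_series q n (Suc l) (n - j)
      = (\<Sum>e\<le>n. fps_X ^ n * (fps_const (m j * mob_count Q (n - j) e) * fps_X ^ e * level_series q n l (n - e)))" if j: "j \<le> n" for j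
  proof -
    have "fps_const (m j) * fps_X ^ j * level_series q n (Suc l) (n - j)
      = (\<Sum>e\<le>n - j. fps_const (m j) * fps_X ^ j * (fps_const (mob_count Q (n - j) e) * fps_X ^ (n - j + e) * level_series q n l (n - e)))"
      unfolding level_series.simps sum_distrib_left Qq ..
    also have "\<dots> = (\<Sum>e\<le>n - j. fps_X ^ n * (fps_const (m j * mob_count Q (n - j) e) * fps_X ^ e * level_series q n l (n - e)))"
    proof (intro sum.cong refl)
      fix e
      have "(fps_X :: rat fps) ^ n = fps_X ^ j * fps_X ^ (n - j)" using j by (simp add: power_add[symmetric])
      then show "fps_const (m j) * fps_X ^ j * (fps_const (mob_count Q (n - j) e) * fps_X ^ (n - j + e) * level_series q n l (n - e)) 
         = fps_X ^ n * (fps_const (m j * mob_count Q (n - j) e) * fps_X ^ e * level_series q n l (n - e))"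
        by (simp only: fps_const_mult[symmetric] power_add mult_ac)
    qed
    also have "\<dots> = (\<Sum>e\<le>n. fps_X ^ n * (fps_const (m j * mob_count Q (n - j) e) * fps_X ^ e * level_series q n l (n - e)))"
      using mob_count_gt[OF Q_gt_1] by (intro sum.mono_neutral_left) auto
    finally show ?thesis .
  qed
  have "pairing n (Suc l) m = (\<Sum>j\<le>n. \<Sum>e\<le>n. fps_X ^ n * (fps_const (m j * mob_count Q (n - j) e) * fps_X ^ e * level_series q n l (n - e)))"
    unfolding pairing_def using t by (intro sum.cong) auto
  also have "\<dots> = (\<Sum>e\<le>n. \<Sum>j\<le>n. fps_X ^ n * (fps_const (m j * mob_count Q (n - j) e) * fps_X ^ e * level_series q n l (n - e)))"
    by (rule sum.swap)
  also have "\<dots> = fps_X ^ n * pairing n l (transfer_op Q n m)"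
    unfolding pairing_def transfer_op_def[OF Q_gt_1] sum_distrib_left 
    by (intro sum.cong refl) (simp add: fps_const_sum sum_distrib_right sum_distrib_left)
  finally show ?thesis .
qed

lemma pairing_smult: "pairing n l (\<lambda>j. c * m j) = fps_const c * pairing n l m"
  unfolding pairing_def sum_distrib_left by (simp only: fps_const_mult[symmetric] mult_ac)

lemma pairing_sum: "pairing n l (\<lambda>j. \<Sum>r\<in>A. m r j) = (\<Sum>r\<in>A. pairing n l (m r))"
  unfolding pairing_def by (subst sum.swap) (simp add: fps_const_sum sum_distrib_right)

definition eigval :: "nat \<Rightarrow> nat \<Rightarrow> rat" where "eigval n r = Q ^ (r * (2 * n + 1 - r) div 2)"

lemma pairing_eigen:
  assumes "r \<le> n"
  shows "pairing n l (coeff (eigen Q n r)) = (fps_X ^ n * fps_const (eigval n r)) ^ l * (subcount_series q (2 * n) * fps_of_poly (eigen Q n r))"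
proof (induct l)
  case 0
  have r: "r \<le> 2 * n + 1" using assms by simp
  have "fps_of_poly (eigen Q n r) = (\<Sum>j\<le>n. fps_const (coeff (eigen Q n r) j) * fps_X ^ j)"
  proof (rule fps_ext)
    fix i
    have "fps_nth (\<Sum>j\<le>n. fps_const (coeff (eigen Q n r) j) * fps_X ^ j) i = (\<Sum>j\<le>n. if i = j then coeff (eigen Q n r) j else 0)"
      unfolding fps_sum_nth by (intro sum.cong) (auto simp: fps_X_power_nth)
    also have "\<dots> = coeff (eigen Q n r) i"
      using eigen_degree[OF Q_gt_1 r] by (auto simp: coeff_eq_0)
    finally show "fps_nth (fps_of_poly (eigen Q n r)) i = fps_nth (\<Sum>j\<le>n. fps_const (coeff (eigen Q n r) j) * fps_X ^ j) i" by simp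
  qed
  then show ?case unfolding pairing_def level_series.simps subcount_series_def[symmetric] by (simp add: sum_distrib_left mult_ac)
next
  case (Suc l)
  have "transfer_op Q n (coeff (eigen Q n r)) = (\<lambda>j. eigval n r * coeff (eigen Q n r) j)"
    using transfer_eigen[OF Q_gt_1, of r n] assms unfolding eigval_def by auto
  then show ?case unfolding pairing_Suc pairing_smult Suc power_Suc by (simp only: pairing_smult Suc mult_ac)
qed

abbreviation "Qc \<equiv> fps_const Q"

text \<open>
  The quotient of \<open>(T;q)\<^sub>2\<^sub>n\<close> by the eigenvector with index \<open>r\<close>.
\<close>

definition eigen_den :: "nat \<Rightarrow> nat \<Rightarrow> rat fps" where
  "eigen_den n r = qpochhammer (Qc ^ r * fps_X) (Qc\<^sup>2) (n - r) * qpochhammer (Qc ^ (2 * n - r) * fps_X) Qc r"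

abbreviation "half_poch_fps r \<equiv> fps_of_poly (half_poch Q r)"

lemma half_poch_fps_rec: "half_poch_fps (Suc (Suc r)) = (1 - Qc ^ r * fps_X) * half_poch_fps r"
proof -
  have "fps_of_poly [:1, - (Q ^ r):] = 1 - Qc ^ r * fps_X"
    by (simp add: fps_of_poly_pCons fps_const_power fps_const_neg[symmetric] del: fps_const_neg)
  then show ?thesis unfolding half_poch.simps[OF Q_gt_1] fps_of_poly_mult by simp
qed

lemma half_poch_fps_jump: "half_poch_fps (r + 2 * m) = half_poch_fps r * qpochhammer (Qc ^ r * fps_X) (Qc\<^sup>2) m"
proof (induct m)
  case (Suc m)
  have "r + 2 * Suc m = Suc (Suc (r + 2 * m))" by simp
  moreover have "Qc ^ (r + 2 * m) * fps_X = Qc ^ r * fps_X * (Qc\<^sup>2) ^ m" by ((simp only: power_add power_mult), (simp only: mult_ac))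
  ultimately show ?case using Suc by (simp only: half_poch_fps_rec qpochhammer_Suc mult_ac)
qed simp

lemma half_poch_fps_pair: "half_poch_fps k * half_poch_fps (Suc k) = qpochhammer fps_X Qc k"
proof (induct k)
  case (Suc k)
  have "half_poch_fps (Suc k) * half_poch_fps (Suc (Suc k)) = (half_poch_fps k * half_poch_fps (Suc k)) * (1 - fps_X * Qc ^ k)" unfolding half_poch_fps_rec by (simp only: mult_ac)
  then show ?case unfolding Suc qpochhammer_Suc .
qed (simp add: half_poch.simps[OF Q_gt_1])

lemma eigen_times_den: assumes "r \<le> n" shows "fps_of_poly (eigen Q n r) * eigen_den n r = qpochhammer fps_X Qc (2 * n)"
proof -
  have e: "r + 2 * (n - r) = 2 * n - r" "2 * n - r + r = 2 * n" "2 * n + 1 - r = Suc (2 * n - r)" using assms by auto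
  have "fps_of_poly (eigen Q n r) * eigen_den n r = (half_poch_fps r * qpochhammer (Qc ^ r * fps_X) (Qc\<^sup>2) (n - r)) * half_poch_fps (Suc (2 * n - r)) * qpochhammer (Qc ^ (2 * n - r) * fps_X) Qc r"
    unfolding eigen_def[OF Q_gt_1] eigen_den_def fps_of_poly_mult e(3) by (simp only: mult_ac)
  also have "\<dots> = (half_poch_fps (2 * n - r) * half_poch_fps (Suc (2 * n - r))) * qpochhammer (fps_X * Qc ^ (2 * n - r)) Qc r"
    unfolding half_poch_fps_jump[symmetric] e(1) by (simp only: mult.commute)
  also have "\<dots> = qpochhammer fps_X Qc (2 * n - r + r)" unfolding half_poch_fps_pair qpochhammer_add ..
  finally show ?thesis unfolding e(2) .
qed

lemma qpochhammer_nth_0: "fps_nth (a::rat fps) 0 = 0 \<Longrightarrow> fps_nth (qpochhammer a b m) 0 = 1"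
  by (induct m) (simp_all add: qpochhammer_Suc)

lemma eigen_den_nth_0: "fps_nth (eigen_den n r) 0 = 1"
  unfolding eigen_den_def by (simp add: qpochhammer_nth_0)

lemma subcount_series_eigen: assumes "r \<le> n" shows "subcount_series q (2 * n) * fps_of_poly (eigen Q n r) = inverse (eigen_den n r)"
proof -
  have "(subcount_series q (2 * n) * fps_of_poly (eigen Q n r)) * eigen_den n r = 1"
    using eigen_times_den[OF assms] subcount_series_mult[of q "2 * n"] by (simp only: mult.assoc Qq)
  then have "eigen_den n r * (subcount_series q (2 * n) * fps_of_poly (eigen Q n r)) = 1" by (simp only: mult.commute)
  then show ?thesis by (rule fps_inverse_unique[symmetric])
qed

lemma level_series_closed:
  assumes "n \<ge> 1"
  shows "level_series q n l n = (\<Sum>r\<le>n. fps_const (eig_weight Q n r) * (fps_X ^ n * fps_const (eigval n r)) ^ l * inverse (eigen_den n r))"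
proof -
  have "(\<Sum>r\<le>n. eig_weight Q n r * coeff (eigen Q n r) j) = (if j = 0 then 1 else 0)" for j
    using arg_cong[OF eigen_expansion[OF Q_gt_1 assms], of "\<lambda>f. coeff f j"] by (simp add: coeff_sum)
  moreover have "pairing n l (\<lambda>j. if j = 0 then 1 else 0) = level_series q n l n"
  proof -
    have "pairing n l (\<lambda>j. if j = 0 then 1 else 0) = (\<Sum>j\<in>{0}. fps_const (if j = 0 then 1 else 0) * fps_X ^ j * level_series q n l (n - j))"
      unfolding pairing_def by (rule sum.mono_neutral_right) auto
    then show ?thesis by simp
  qed
  ultimately have "level_series q n l n = pairing n l (\<lambda>j. \<Sum>r\<le>n. eig_weight Q n r * coeff (eigen Q n r) j)" by simp
  also have "\<dots> = (\<Sum>r\<le>n. fps_const (eig_weight Q n r) * pairing n l (coeff (eigen Q n r)))" unfolding pairing_sum pairing_smult ..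
  also have "\<dots> = (\<Sum>r\<le>n. fps_const (eig_weight Q n r) * (fps_X ^ n * fps_const (eigval n r)) ^ l * inverse (eigen_den n r))"
    using pairing_eigen subcount_series_eigen by (intro sum.cong) (auto simp: mult.assoc)
  finally show ?thesis .
qed

text \<open>
  Truncating the geometric series after \<open>y^i\<close> does not affect the coefficients up to degree \<open>i\<close>.
\<close>

lemma fps_geometric_nth:
  fixes y :: "rat fps"
  assumes "fps_nth y 0 = 0"
  shows "fps_nth ((\<Sum>k\<le>i. y ^ k) * g) i = fps_nth (inverse (1 - y) * g) i"
proof -
  have "(1 - y) * (\<Sum>k\<le>i. y ^ k) = 1 - y ^ Suc i"
    using one_diff_power_eq[of y "Suc i"] unfolding lessThan_Suc_atMost by simp
  moreover have u: "inverse (1 - y) * (1 - y) = 1" using assms by (intro inverse_mult_eq_1) simp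
  ultimately have "(\<Sum>k\<le>i. y ^ k) = inverse (1 - y) * (1 - y ^ Suc i)" by (metis mult.assoc mult_1)
  then have "(\<Sum>k\<le>i. y ^ k) * g = inverse (1 - y) * g - y ^ Suc i * (inverse (1 - y) * g)"
    by (simp only: right_diff_distrib left_diff_distrib mult_ac mult_1)
  moreover have "fps_nth (y ^ Suc i * (inverse (1 - y) * g)) i = 0"
  proof -
    have "fps_nth (y ^ Suc i) j = 0" if "j \<le> i" for j using startsby_zero_power_prefix[OF assms, of "Suc i"] that by auto
    then show ?thesis unfolding fps_mult_nth by (intro sum.neutral) auto
  qed
  ultimately show ?thesis by simp
qed

text \<open>
  The left-hand side is \<open>\<Sum>\<^sub>k (Q^(2n) T)^k Z\<^sub>k\<close>, written coefficientwise so that every sum is finite.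
\<close>

theorem generating_function:
  assumes "n \<ge> 1"
  shows "Abs_fps (\<lambda>i. \<Sum>k\<le>i. Q ^ (2 * n * k) * fps_nth (level_series q n k n) (i - k)) =
    (\<Sum>r = 0..n.
       1 / (1 - Qc ^ (2*n + r * (2*n + 1 - r) div 2) * fps_X ^ (n + 1)) *
       ((- Qc) ^ r * (1 - Qc ^ (2*n - 2*r + 1)) * qpochhammer (Qc^2) (Qc^2) n /
        (qpochhammer Qc Qc (2*n - r + 1) * qpochhammer Qc Qc r *
         qpochhammer (Qc ^ r * fps_X) (Qc^2) (n - r) * qpochhammer (Qc ^ (2*n - r) * fps_X) Qc r)))" (is "?l = ?r")
proof -
  define y where "y r = Qc ^ (2*n + r * (2*n + 1 - r) div 2) * fps_X ^ (n + 1)" for r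
  have y0: "fps_nth (y r) 0 = 0" for r unfolding y_def by simp
  have qc: "qpochhammer (fps_const a) (fps_const b) m = fps_const (qpochhammer a b m)" for a b :: rat and m
    by (induct m) (simp_all add: qpochhammer_Suc fps_const_power fps_const_sub[symmetric] del: fps_const_sub)
  have trm: "1 / (1 - y r) * ((- Qc) ^ r * (1 - Qc ^ (2*n - 2*r + 1)) * qpochhammer (Qc^2) (Qc^2) n /
        (qpochhammer Qc Qc (2*n - r + 1) * qpochhammer Qc Qc r *
         qpochhammer (Qc ^ r * fps_X) (Qc^2) (n - r) * qpochhammer (Qc ^ (2*n - r) * fps_X) Qc r))
     = inverse (1 - y r) * (fps_const (eig_weight Q n r) * inverse (eigen_den n r))" for r
  proof -
    let ?N = "(- Q) ^ r * (1 - Q ^ (2*n - 2*r + 1)) * qpochhammer (Q^2) (Q^2) n" and ?D = "qpochhammer Q Q (2*n - r + 1) * qpochhammer Q Q r"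
    have D: "?D \<noteq> 0" using qpochhammer_nonzero[OF Q_gt_1] by simp
    have N: "(- Qc) ^ r * (1 - Qc ^ (2*n - 2*r + 1)) * qpochhammer (Qc^2) (Qc^2) n = fps_const ?N"
      unfolding fps_const_power qc fps_const_neg by (simp add: fps_const_power fps_const_sub[symmetric] del: fps_const_sub power_Suc)
    have DD: "qpochhammer Qc Qc (2*n - r + 1) * qpochhammer Qc Qc r *
         qpochhammer (Qc ^ r * fps_X) (Qc^2) (n - r) * qpochhammer (Qc ^ (2*n - r) * fps_X) Qc r = fps_const ?D * eigen_den n r"
      unfolding eigen_den_def qc by (simp add: mult.assoc)
    have "fps_const ?N / (fps_const ?D * eigen_den n r) = fps_const (eig_weight Q n r) * inverse (eigen_den n r)"
      unfolding eig_weight_def[OF Q_gt_1] using D eigen_den_nth_0 by (rule fps_const_divide_mult)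
    moreover have "1 / (1 - y r) = inverse (1 - y r)" using y0 fps_divide_unit[of "1 - y r" 1] by simp
    ultimately show ?thesis unfolding N DD by simp
  qed
  show ?thesis
  proof (rule fps_ext)
    fix i
    have yk: "fps_const (Q ^ (2 * n * k)) * fps_X ^ k * (fps_X ^ n * fps_const (eigval n r)) ^ k = y r ^ k" for k r
    proof -
      have "fps_const (Q ^ (2 * n * k)) * fps_X ^ k = (fps_const (Q ^ (2 * n)) * fps_X) ^ k"
        by (simp add: power_mult_distrib fps_const_power power_mult)
      moreover have "fps_const (Q ^ (2 * n)) * fps_X * (fps_X ^ n * fps_const (eigval n r)) = y r"
        unfolding y_def eigval_def by (simp add: power_add fps_const_power mult_ac fps_const_mult[symmetric] del: fps_const_mult)
      ultimately show ?thesis by (simp only: power_mult_distrib[symmetric])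
    qed
    have "(\<Sum>k\<le>i. Q ^ (2 * n * k) * fps_nth (level_series q n k n) (i - k)) = (\<Sum>k\<le>i. fps_nth (fps_const (Q ^ (2 * n * k)) * fps_X ^ k * level_series q n k n) i)"
      by (intro sum.cong) (auto simp: mult.assoc fps_X_power_mult_nth)
    also have "\<dots> = fps_nth (\<Sum>k\<le>i. \<Sum>r\<le>n. y r ^ k * (fps_const (eig_weight Q n r) * inverse (eigen_den n r))) i"
      unfolding fps_sum_nth[symmetric] level_series_closed[OF assms] sum_distrib_left
      by (intro arg_cong[of _ _ "\<lambda>f. fps_nth f i"] sum.cong refl) (simp only: yk[symmetric] mult_ac)
    also have "(\<Sum>k\<le>i. \<Sum>r\<le>n. y r ^ k * (fps_const (eig_weight Q n r) * inverse (eigen_den n r))) = (\<Sum>r\<le>n. (\<Sum>k\<le>i. y r ^ k) * (fps_const (eig_weight Q n r) * inverse (eigen_den n r)))"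
      unfolding sum_distrib_right by (rule sum.swap)
    also have "fps_nth \<dots> i = fps_nth (\<Sum>r\<le>n. inverse (1 - y r) * (fps_const (eig_weight Q n r) * inverse (eigen_den n r))) i"
      unfolding fps_sum_nth using fps_geometric_nth[OF y0] by (intro sum.cong) auto
    finally show "fps_nth ?l i = fps_nth ?r i"
      unfolding y_def[symmetric] trm atLeast0AtMost by simp
  qed
qed

end

context form_lattice begin

context
  fixes V y
  assumes V: "good 0 n V" and Vy: "indep V y" and all: "carrier M = ext V y"
    and wy: "\<And>x. x \<in> carrier M \<Longrightarrow> w y x = \<zero>"
begin

section \<open>Central extensions\<close>

definition central_subs :: "nat \<Rightarrow> 'c set set" where
  "central_subs i = {H. sub H \<and> (\<forall>u\<in>H. \<forall>v\<in>H. w u v \<bullet> y \<in> H) \<and> idx (carrier M) H = q ^ i}"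

lemma sV: "sub V" and fV: "free (2 * n) V" and yM: "y \<in> carrier M"
  using good_facts[OF V] Vy by (auto simp: indep_def)

lemma wy': "x \<in> carrier M \<Longrightarrow> w x y = \<zero>"
  using w_swap[OF yM, of x] wy by simp

lemma ext_y_Int: assumes "sub L" "L \<subseteq> V" shows "ext L y \<inter> V = L" "idx (carrier M) (ext L y) = idx V L"
proof -
  have z: "\<zero>\<^sub>M \<boxplus> p [^] (0::nat) \<bullet> y = y" using yM by simp
  have F: "ext L y \<in> fibre V y L 0" using fibre_construct(1)[OF sV Vy assms, of "\<zero>\<^sub>M" 0] subD(3)[OF sV] unfolding z by simp
  then show "ext L y \<inter> V = L" by (simp add: fibre_def)
  show "idx (carrier M) (ext L y) = idx V L" using fibre_idx[OF sV Vy F] all by simp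
qed

text \<open>
  A subalgebra \<open>H\<close> is sorted by its projection \<open>L\<close> to \<open>V\<close>, here written as \<open>(H + R y) \<inter> V\<close>, and by
  its intersection with \<open>R y\<close>. As \<open>y\<close> is central, the bracket of \<open>H\<close> only depends on \<open>L\<close>.
\<close>

lemma central_subs_decompose:
  "central_subs i = (\<Union>k\<in>{..i}. \<Union>L\<in>level_subs k V (i - k). lifts L y k)"
proof (intro equalityI subsetI)
  fix H assume "H \<in> central_subs i"
  then have H: "sub H" "\<And>u v. u \<in> H \<Longrightarrow> v \<in> H \<Longrightarrow> w u v \<bullet> y \<in> H" "idx (carrier M) H = q ^ i"
    by (auto simp: central_subs_def)
  note s = subD[OF H(1)]
  let ?L = "ext H y \<inter> V"
  have E: "sub (ext H y)" "H \<subseteq> ext H y" "y \<in> ext H y" using ext_sub ext_incl ext_mem H yM by auto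
  have L: "sub ?L" "?L \<subseteq> V" using sub_Int E sV by auto
  have EL: "ext ?L y = ext H y"
  proof
    show "ext ?L y \<subseteq> ext H y" using E by (intro ext_least) auto
    show "ext H y \<subseteq> ext ?L y"
    proof
      fix x assume x: "x \<in> ext H y"
      then have "x \<in> ext V y" using subD(2)[OF E(1)] all by auto
      then obtain v r where vr: "v \<in> V" "r \<in> carrier R" "x = v \<boxplus> r \<bullet> y" by (rule ext_E)
      have "v \<in> ext H y" using sub_add_iff(2)[OF E(1), of "r \<bullet> y" v] vr x subD(7)[OF E(1) vr(2) E(3)] subD(2)[OF sV] by auto
      then show "x \<in> ext ?L y" using vr ext_I by auto
    qed
  qed
  have m: "idx (carrier M) H = idx (carrier M) (ext H y) * idx (ext H y) H"
    using H E carrier_is_submodule subD(1)[OF E(1)] by (intro idx_mult) auto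
  have "q ^ i \<noteq> 0" using q_ge_2 by simp
  then have "idx (ext H y) H \<noteq> 0" using m unfolding H(3) by (intro notI) simp
  then obtain k where k: "\<And>r. r \<in> carrier R \<Longrightarrow> r \<bullet> y \<in> H \<longleftrightarrow> r \<in> P k" using conductor[OF H(1) yM] by blast
  have HL: "H \<in> lifts ?L y k" using H(1) EL k by (auto simp: lifts_def)
  have ek: "idx (ext H y) H = q ^ k" using idx_cyclic[OF H(1) yM k] .
  have "q ^ i = q ^ k * idx V ?L" using m H(3) ek ext_y_Int(2)[OF L] EL by (simp add: mult.commute)
  then have ki: "k \<le> i" "idx V ?L = q ^ (i - k)" using q_pow_split by blast+
  have "level k ?L" unfolding level_def
  proof (intro ballI)
    fix a b assume ab: "a \<in> ?L" "b \<in> ?L"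
    obtain h r where h: "h \<in> H" "r \<in> carrier R" "a = h \<boxplus> r \<bullet> y" using ab by (auto elim: ext_E)
    obtain h' r' where h': "h' \<in> H" "r' \<in> carrier R" "b = h' \<boxplus> r' \<bullet> y" using ab by (auto elim: ext_E)
    have c: "h \<in> carrier M" "h' \<in> carrier M" using h h' s by auto
    have "w a b = w h h'" unfolding h(3) h'(3) using c h(2) h'(2) yM
      by (simp add: w_add_l w_add_r w_smult_l w_smult_r wy wy')
    then show "w a b \<in> P k" using H(2)[OF h(1) h'(1)] k c by simp
  qed
  then have "?L \<in> level_subs k V (i - k)" using L ki by (auto simp: level_subs_def index_subs_def)
  then show "H \<in> (\<Union>k\<in>{..i}. \<Union>L\<in>level_subs k V (i - k). lifts L y k)" using HL ki by blast
next
  fix H assume "H \<in> (\<Union>k\<in>{..i}. \<Union>L\<in>level_subs k V (i - k). lifts L y k)"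
  then obtain k L where k: "k \<le> i" and L: "sub L" "L \<subseteq> V" "idx V L = q ^ (i - k)" "level k L" and HL: "H \<in> lifts L y k"
    by (auto simp: level_subs_def index_subs_def)
  have H: "sub H" "ext H y = ext L y" "\<And>r. r \<in> carrier R \<Longrightarrow> r \<bullet> y \<in> H \<longleftrightarrow> r \<in> P k" using HL by (auto simp: lifts_def)
  have E: "sub (ext L y)" "H \<subseteq> ext L y" using ext_sub[OF L(1) yM] ext_incl[OF H(1) yM] H(2) by auto
  have "idx (carrier M) H = idx (carrier M) (ext L y) * idx (ext L y) H"
    using H E carrier_is_submodule subD(1)[OF E(1)] by (intro idx_mult) auto
  then have "idx (carrier M) H = q ^ (i - k) * q ^ k" using ext_y_Int(2)[OF L(1,2)] L(3) lifts_idx[OF HL yM] by simp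
  then have idxH: "idx (carrier M) H = q ^ i" using k by (simp add: power_add[symmetric])
  have "w u v \<bullet> y \<in> H" if uv: "u \<in> H" "v \<in> H" for u v
  proof -
    have "u \<in> ext L y" "v \<in> ext L y" using uv E by auto
    then obtain a r b t where a: "a \<in> L" "r \<in> carrier R" "u = a \<boxplus> r \<bullet> y" and b: "b \<in> L" "t \<in> carrier R" "v = b \<boxplus> t \<bullet> y"
      by (auto elim!: ext_E)
    have c: "a \<in> carrier M" "b \<in> carrier M" using a b subD(2)[OF L(1)] by auto
    have "w u v = w a b" unfolding a(3) b(3) using c a(2) b(2) yM
      by (simp add: w_add_l w_add_r w_smult_l w_smult_r wy wy')
    then show ?thesis using L(4) a b c H(3) by (auto simp: level_def)
  qed
  then show "H \<in> central_subs i" using H idxH by (auto simp: central_subs_def)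
qed

lemma card_central_subs: "of_nat (card (central_subs i)) = (\<Sum>k\<le>i. (of_nat q :: rat) ^ (2 * n * k) * fps_nth (level_series q n k n) (i - k))"
proof -
  have fi: "finite (level_subs k V j)" for k j using card_index_subs[OF fV, of j] by (simp add: level_subs_def)
  have Lf: "finite (lifts L y k) \<and> card (lifts L y k) = q ^ (2 * n * k)" if L: "L \<in> level_subs k V j" for L k j
  proof -
    have L': "sub L" "L \<subseteq> V" "idx V L = q ^ j" using L by (auto simp: level_subs_def index_subs_def)
    have "free (2 * n) L" using L' q_ge_2 by (intro free_finite_index[OF fV]) auto
    moreover have "indep L y" using Vy L' by (auto simp: indep_def)
    ultimately show ?thesis by (rule card_lifts)
  qed
  have Lk: "k = k'" if "H \<in> lifts L y k" "H \<in> lifts L' y k'" for H L L' k k'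
  proof -
    have "p [^] k \<in> P k \<longleftrightarrow> p [^] k \<in> P k'" "p [^] k' \<in> P k \<longleftrightarrow> p [^] k' \<in> P k'"
      using that by (auto simp: lifts_def)
    moreover have "p [^] j \<in> P j" for j :: nat using P_I[of \<one> j] by simp
    moreover have "p [^] j \<notin> P l" if "j < l" for j l :: nat using P_strict[of j] P_antimono[of "Suc j" l] that by auto
    ultimately have "\<not> k < k'" "\<not> k' < k" by blast+
    then show ?thesis by simp
  qed
  have LL: "L = L'" if "H \<in> lifts L y k" "H \<in> lifts L' y k'" "L \<in> level_subs k V j" "L' \<in> level_subs k' V j'" for H L L' k k' j j'
  proof -
    have "ext L y \<inter> V = L" "ext L' y \<inter> V = L'" using that by (auto intro!: ext_y_Int simp: level_subs_def index_subs_def)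
    moreover have "ext L y = ext L' y" using that by (simp add: lifts_def)
    ultimately show ?thesis by metis
  qed
  have inner: "finite (\<Union>L\<in>level_subs k V j. lifts L y k) \<and> card (\<Union>L\<in>level_subs k V j. lifts L y k) = q ^ (2 * n * k) * card (level_subs k V j)" for k j
  proof
    show "finite (\<Union>L\<in>level_subs k V j. lifts L y k)" using fi Lf by blast
    have "card (\<Union>L\<in>level_subs k V j. lifts L y k) = (\<Sum>L\<in>level_subs k V j. card (lifts L y k))"
    proof (rule card_UN_disjoint)
      show "\<forall>L\<in>level_subs k V j. \<forall>L'\<in>level_subs k V j. L \<noteq> L' \<longrightarrow> lifts L y k \<inter> lifts L' y k = {}"
      proof (intro ballI impI)
        fix L L' assume L: "L \<in> level_subs k V j" "L' \<in> level_subs k V j" "L \<noteq> L'"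
        then show "lifts L y k \<inter> lifts L' y k = {}" using LL[OF _ _ L(1,2)] unfolding disjoint_iff by blast
      qed
    qed (use fi Lf in auto)
    also have "\<dots> = (\<Sum>L\<in>level_subs k V j. q ^ (2 * n * k))" using Lf by (intro sum.cong) auto
    finally show "card (\<Union>L\<in>level_subs k V j. lifts L y k) = q ^ (2 * n * k) * card (level_subs k V j)" by simp
  qed
  have "card (central_subs i) = (\<Sum>k\<in>{..i}. card (\<Union>L\<in>level_subs k V (i - k). lifts L y k))"
    unfolding central_subs_decompose
  proof (rule card_UN_disjoint)
    show "\<forall>k\<in>{..i}. \<forall>k'\<in>{..i}. k \<noteq> k' \<longrightarrow>
      (\<Union>L\<in>level_subs k V (i - k). lifts L y k) \<inter> (\<Union>L\<in>level_subs k' V (i - k'). lifts L y k') = {}"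
    proof (intro ballI impI)
      fix k k' :: nat assume "k \<noteq> k'"
      then show "(\<Union>L\<in>level_subs k V (i - k). lifts L y k) \<inter> (\<Union>L\<in>level_subs k' V (i - k'). lifts L y k') = {}"
        using Lk by blast
    qed
  qed (use inner in auto)
  also have "\<dots> = (\<Sum>k\<in>{..i}. q ^ (2 * n * k) * card (level_subs k V (i - k)))" using inner by simp
  finally have "of_nat (card (central_subs i)) = (\<Sum>k\<le>i. (of_nat q :: rat) ^ (2 * n * k) * of_nat (card (level_subs k V (i - k))))" by simp
  also have "\<dots> = (\<Sum>k\<le>i. (of_nat q :: rat) ^ (2 * n * k) * fps_nth (level_series q n k n) (i - k))"
  proof (intro sum.cong refl)
    fix k
    show "(of_nat q :: rat) ^ (2 * n * k) * of_nat (card (level_subs k V (i - k))) = of_nat q ^ (2 * n * k) * fps_nth (level_series q n k n) (i - k)"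
      using card_level_subs[OF V, of k "i - k"] by simp
  qed
  finally show ?thesis .
qed

end

end

context discrete_valuation_ring begin

section \<open>Uniformizers\<close>

lemma max_ideal_maximal: "maximalideal (max_ideal R) R" "max_ideal R \<noteq> {\<zero>}"
  using theI'[OF ex1_maximal] unfolding max_ideal_def by blast+

lemma max_ideal_unique: "\<lbrakk>maximalideal J R; J \<noteq> {\<zero>}\<rbrakk> \<Longrightarrow> J = max_ideal R"
  using ex1_maximal max_ideal_maximal by blast

text \<open>
  An irreducible element generates a nonzero maximal ideal and is therefore associated to \<open>p\<close>; so
  factorization into irreducibles expresses every nonzero element as a unit times a power of \<open>p\<close>.
\<close>

lemma uniformizer_exists:
  obtains p where "p \<in> carrier R" "p \<noteq> \<zero>" "p \<notin> Units R" "max_ideal R = PIdl p"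
    "\<And>a. \<lbrakk>a \<in> carrier R; a \<noteq> \<zero>\<rbrakk> \<Longrightarrow> \<exists>k::nat. \<exists>u\<in>Units R. a = p [^] k \<otimes> u"
proof -
  have mi: "ideal (max_ideal R) R" using max_ideal_maximal(1) by (rule maximalideal.axioms)
  then obtain p where p: "p \<in> carrier R" "max_ideal R = PIdl p" using exists_gen by blast
  have p0: "p \<noteq> \<zero>"
  proof
    assume "p = \<zero>"
    then have "max_ideal R = {\<zero>}" using p(2) by (auto simp: cgenideal_def intro!: exI[of _ \<zero>])
    then show False using max_ideal_maximal(2) by simp
  qed
  have pu: "p \<notin> Units R"
    using maximalideal.I_notcarr[OF max_ideal_maximal(1)] ideal_eq_carrier_iff[OF p(1)] p(2) by auto
  have irr: "\<exists>u\<in>Units R. f = p \<otimes> u" if f: "f \<in> carrier R" "f \<noteq> \<zero>" "irreducible (mult_of R) f" for f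
  proof -
    have fi: "ring_irreducible f" using f by (intro ring_irreducibleI') auto
    have "f \<in> PIdl f" using f(1) by (rule cgenideal_self)
    then have "PIdl f \<noteq> {\<zero>}" using f(2) by auto
    then have "PIdl f = PIdl p" using max_ideal_unique[OF irreducible_imp_maximalideal[OF f(1) fi]] p(2) by simp
    then obtain c where c: "c \<in> carrier R" "f = c \<otimes> p" using cgenideal_self[OF f(1)] by (auto simp: cgenideal_def)
    then have "c \<in> Units R" using ring_irreducibleE(5)[OF f(1) fi c(1) p(1) c(2)] pu by blast
    then show ?thesis using c p(1) by (intro bexI[of _ c]) (auto simp: m_comm)
  qed
  have prod: "\<exists>k::nat. \<exists>u\<in>Units R. foldr (\<otimes>) fs \<one> = p [^] k \<otimes> u"
    if "set fs \<subseteq> carrier (mult_of R)" "\<forall>f\<in>set fs. irreducible (mult_of R) f" for fs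
    using that
  proof (induct fs)
    case Nil
    then show ?case by (auto intro!: exI[of _ "0::nat"] bexI[of _ \<one>])
  next
    case (Cons f fs)
    obtain k :: nat and u where k: "u \<in> Units R" "foldr (\<otimes>) fs \<one> = p [^] k \<otimes> u" using Cons by auto
    obtain v where v: "v \<in> Units R" "f = p \<otimes> v" using irr[of f] Cons by auto
    have c: "u \<in> carrier R" "v \<in> carrier R" "p [^] k \<in> carrier R" using k v p by auto
    have "foldr (\<otimes>) (f # fs) \<one> = (p \<otimes> v) \<otimes> (p [^] k \<otimes> u)" using k v by simp
    also have "\<dots> = p [^] Suc k \<otimes> (v \<otimes> u)" using c p(1) by (simp add: m_ac)
    finally show ?case using k v by blast
  qed
  have "\<exists>k::nat. \<exists>u\<in>Units R. a = p [^] k \<otimes> u" if a: "a \<in> carrier R" "a \<noteq> \<zero>" for a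
  proof (cases "a \<in> Units R")
    case True
    then show ?thesis using a by (intro exI[of _ "0::nat"] bexI[of _ a]) auto
  next
    case False
    then obtain fs where fs: "set fs \<subseteq> carrier (mult_of R)" "wfactors (mult_of R) fs a" using factorization_property[of a] a by auto
    then have irrs: "\<forall>f\<in>set fs. irreducible (mult_of R) f" and as: "foldr (\<otimes>) fs \<one> \<sim>\<^bsub>mult_of R\<^esub> a"
      by (auto simp: wfactors_def)
    obtain k :: nat and u where k: "u \<in> Units R" "foldr (\<otimes>) fs \<one> = p [^] k \<otimes> u" using prod[OF fs(1) irrs] by blast
    have c: "u \<in> carrier R" "p [^] k \<in> carrier R" using k p by auto
    have "a divides\<^bsub>mult_of R\<^esub> foldr (\<otimes>) fs \<one>" "foldr (\<otimes>) fs \<one> divides\<^bsub>mult_of R\<^esub> a" using as by (auto simp: associated_def)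
    then obtain s t where s: "s \<in> carrier R" "p [^] k \<otimes> u = a \<otimes> s" and t: "t \<in> carrier R" "a = p [^] k \<otimes> u \<otimes> t"
      unfolding k(2) factor_def by auto
    have "a \<otimes> (s \<otimes> t) = (a \<otimes> s) \<otimes> t" using a s(1) t(1) by (simp only: m_assoc)
    then have "a \<otimes> \<one> = a \<otimes> (s \<otimes> t)" unfolding s(2)[symmetric] t(2)[symmetric] using a by simp
    then have "\<one> = s \<otimes> t" using m_lcancel[of a \<one> "s \<otimes> t"] a s(1) t(1) by simp
    then have "s \<otimes> t = \<one>" "t \<otimes> s = \<one>" using s(1) t(1) m_comm[of s t] by simp_all
    then have tU: "t \<in> Units R" using s(1) t(1) unfolding Units_def by blast
    have "a = p [^] k \<otimes> (u \<otimes> t)" using t c by (simp only: m_assoc)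
    then show ?thesis using Units_m_closed[OF k(1) tU] by blast
  qed
  then show ?thesis using that p p0 pu by blast
qed

end

lemma (in compact_dvr) dvr_lattice_exists:
  assumes M: "module R M"
    and tf: "\<And>r x. \<lbrakk>r \<in> carrier R; x \<in> carrier M; r \<odot>\<^bsub>M\<^esub> x = \<zero>\<^bsub>M\<^esub>\<rbrakk> \<Longrightarrow> r = \<zero> \<or> x = \<zero>\<^bsub>M\<^esub>"
  obtains p S where "dvr_lattice R M p S" "card S = card (carrier (residue_field R))"
proof -
  obtain p where p: "p \<in> carrier R" "p \<noteq> \<zero>" "p \<notin> Units R" "max_ideal R = PIdl p"
    "\<And>a. \<lbrakk>a \<in> carrier R; a \<noteq> \<zero>\<rbrakk> \<Longrightarrow> \<exists>k::nat. \<exists>u\<in>Units R. a = p [^] k \<otimes> u"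
    using uniformizer_exists by blast
  let ?c = "\<lambda>x. PIdl p +> x"
  obtain S where S: "S \<subseteq> carrier R" "inj_on ?c S" "?c ` carrier R = ?c ` S"
    using subset_image_inj[of "?c ` carrier R" ?c "carrier R"] by auto
  have res: "carrier (residue_field R) = ?c ` S"
    unfolding residue_field_def p(4) FactRing_def S(3)[symmetric] by (auto simp: A_RCOSETS_def')
  then have card: "card S = card (carrier (residue_field R))" using S(2) by (simp add: card_image)
  have fin: "finite S" using finite_residue_field S(2) unfolding res by (rule finite_imageD)
  have id: "ideal (PIdl p) R" using p(1) by (rule cgenideal_ideal)
  have repr: "\<exists>!s. s \<in> S \<and> a \<ominus> s \<in> PIdl p" if a: "a \<in> carrier R" for a
  proof -
    have iff: "a \<ominus> s \<in> PIdl p \<longleftrightarrow> ?c a = ?c s" if "s \<in> S" for s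
      using quotient_eq_iff_same_a_r_cos[OF id a] S(1) that by blast
    obtain s where s: "s \<in> S" "?c a = ?c s" using S(3) a by blast
    show ?thesis
    proof (rule ex1I[of _ s])
      show "s \<in> S \<and> a \<ominus> s \<in> PIdl p" using s iff by blast
      fix t assume "t \<in> S \<and> a \<ominus> t \<in> PIdl p"
      then have "t \<in> S" "?c t = ?c s" using iff s by auto
      then show "t = s" using inj_onD[OF S(2)] s by blast
    qed
  qed
  have "dvr_lattice R M p S"
  proof (intro dvr_lattice.intro dvr_lattice_axioms.intro)
    show "\<exists>k::nat. \<exists>u\<in>Units R. a = p [^] k \<otimes> u" if "a \<in> carrier R" "a \<noteq> \<zero>" for a
      using p(5) that .
  qed (fact M domain_axioms p fin S repr tf)+
  then show ?thesis using that card by blast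
qed

section \<open>The Heisenberg algebra\<close>

locale heis = dvr_lattice R "heisenberg R n" p S for R (structure) and n :: nat and p S
begin

abbreviation "L \<equiv> heisenberg R n"
abbreviation "e \<equiv> heis_basis R n"
abbreviation hadd (infixl \<open>\<boxplus>\<close> 65) where "x \<boxplus> y \<equiv> x \<oplus>\<^bsub>L\<^esub> y"
abbreviation hsmult (infixr \<open>\<bullet>\<close> 70) where "r \<bullet> x \<equiv> r \<odot>\<^bsub>L\<^esub> x"
abbreviation hzero (\<open>\<zero>\<^sub>M\<close>) where "\<zero>\<^sub>M \<equiv> \<zero>\<^bsub>L\<^esub>"

text \<open>
  The bracket of two elements is the multiple of \<open>y\<close> by its last coordinate.
\<close>

definition form :: "(nat \<Rightarrow> 'a) \<Rightarrow> (nat \<Rightarrow> 'a) \<Rightarrow> 'a" where "form u v = (u \<otimes>\<^bsub>L\<^esub> v) (2 * n + 1)"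

lemma lie: "lie_algebra R L" by (rule R.heisenberg_lie_algebra)

lemma coord [simp, intro]: "\<lbrakk>u \<in> carrier L; k \<in> {1..2 * n + 1}\<rbrakk> \<Longrightarrow> u k \<in> carrier R"
  by (auto simp: heisenberg_simps PiE_iff)

lemma coord_add: "k \<in> {1..2 * n + 1} \<Longrightarrow> (u \<boxplus> v) k = u k \<oplus> v k"
  and coord_smult: "k \<in> {1..2 * n + 1} \<Longrightarrow> (r \<bullet> u) k = r \<otimes> u k"
  and coord_zero: "k \<in> {1..2 * n + 1} \<Longrightarrow> \<zero>\<^sub>M k = \<zero>"
  by (simp_all add: heisenberg_simps)

lemma coord_eqI: "\<lbrakk>u \<in> carrier L; v \<in> carrier L; \<And>k. k \<in> {1..2 * n + 1} \<Longrightarrow> u k = v k\<rbrakk> \<Longrightarrow> u = v"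
  unfolding heisenberg_simps(1) by (rule PiE_ext)

lemma e_closed: "e j \<in> carrier L"
  by (auto simp: heisenberg_simps heis_basis_def)

lemma e_coord: "k \<in> {1..2 * n + 1} \<Longrightarrow> e j k = (if k = j then \<one> else \<zero>)"
  by (simp add: heis_basis_def)

lemma form_sum: "form u v = (\<Oplus>i\<in>{1..n}. u (2*i-1) \<otimes> v (2*i) \<ominus> u (2*i) \<otimes> v (2*i-1))"
  unfolding form_def heisenberg_simps(2) by simp

lemma bracket_form: "\<lbrakk>u \<in> carrier L; v \<in> carrier L\<rbrakk> \<Longrightarrow> u \<otimes>\<^bsub>L\<^esub> v = form u v \<bullet> e (2 * n + 1)"
proof (rule coord_eqI)
  assume uv: "u \<in> carrier L" "v \<in> carrier L"
  then show c: "u \<otimes>\<^bsub>L\<^esub> v \<in> carrier L" by (rule lie_algebra.bracket_closed[OF lie])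
  then have f: "form u v \<in> carrier R" unfolding form_def by (intro coord) auto
  then show "form u v \<bullet> e (2 * n + 1) \<in> carrier L" using e_closed by simp
  fix k assume k: "k \<in> {1..2 * n + 1}"
  show "(u \<otimes>\<^bsub>L\<^esub> v) k = (form u v \<bullet> e (2 * n + 1)) k"
  proof (cases "k = 2 * n + 1")
    case True
    then show ?thesis unfolding coord_smult[OF k] e_coord[OF k] form_def[symmetric] using f by (simp add: form_def)
  next
    case False
    have "(u \<otimes>\<^bsub>L\<^esub> v) k = \<zero>" unfolding heisenberg_simps(2) using k False by simp
    then show ?thesis unfolding coord_smult[OF k] e_coord[OF k] using f False by simp
  qed
qed

end

sublocale heis \<subseteq> form_lattice R "heisenberg R n" p S form n
proof unfold_locales
  have l: "2 * n + 1 \<in> {1..2 * n + 1}" by simp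
  show "form x y \<in> carrier R" if "x \<in> carrier L" "y \<in> carrier L" for x y
    unfolding form_def using that lie_algebra.bracket_closed[OF lie] l by (intro coord) auto
  show "form (x \<boxplus> y) z = form x z \<oplus> form y z" "form z (x \<boxplus> y) = form z x \<oplus> form z y"
    if "x \<in> carrier L" "y \<in> carrier L" "z \<in> carrier L" for x y z
    unfolding form_def lie_algebra.bracket_add_left[OF lie that] lie_algebra.bracket_add_right[OF lie that]
    by (rule coord_add[OF l])+
  show "form (r \<bullet> x) y = r \<otimes> form x y" "form x (r \<bullet> y) = r \<otimes> form x y"
    if "r \<in> carrier R" "x \<in> carrier L" "y \<in> carrier L" for r x y
    unfolding form_def lie_algebra.bracket_smult_left[OF lie that] lie_algebra.bracket_smult_right[OF lie that]
    by (rule coord_smult[OF l])+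
  show "form x x = \<zero>" if "x \<in> carrier L" for x
    unfolding form_def lie_algebra.bracket_self[OF lie that] by (rule coord_zero[OF l])
qed

context heis begin

text \<open>
  The span of the first \<open>j\<close> basis elements; \<open>flag (2 * n)\<close> is the span of the \<open>x\<^sub>i\<close>.
\<close>

definition flag :: "nat \<Rightarrow> (nat \<Rightarrow> 'a) set" where
  "flag j = {u \<in> carrier L. \<forall>i\<in>{1..2 * n + 1}. j < i \<longrightarrow> u i = \<zero>}"

lemma flag_e: "\<lbrakk>i \<le> j\<rbrakk> \<Longrightarrow> e i \<in> flag j"
  using e_closed by (auto simp: flag_def e_coord)

lemma flag_0: "flag 0 = {\<zero>\<^sub>M}"
proof
  show "flag 0 \<subseteq> {\<zero>\<^sub>M}"
  proof
    fix u assume u: "u \<in> flag 0"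
    have "u = \<zero>\<^sub>M" using u by (intro coord_eqI) (auto simp: flag_def coord_zero)
    then show "u \<in> {\<zero>\<^sub>M}" by simp
  qed
qed (auto simp: flag_def coord_zero)

lemma flag_Suc: assumes "j < 2 * n + 1" shows "flag (Suc j) = ext (flag j) (e (Suc j))"
proof (intro equalityI subsetI)
  fix u assume "u \<in> ext (flag j) (e (Suc j))"
  then obtain a r where ar: "a \<in> flag j" "r \<in> carrier R" "u = a \<boxplus> r \<bullet> e (Suc j)" by (rule ext_E)
  then show "u \<in> flag (Suc j)" using e_closed by (auto simp: flag_def coord_add coord_smult e_coord)
next
  fix u assume u: "u \<in> flag (Suc j)"
  then have uc: "u \<in> carrier L" by (simp add: flag_def)
  have j: "Suc j \<in> {1..2 * n + 1}" using assms by simp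
  define a where "a = (\<lambda>i\<in>{1..2 * n + 1}. if i = Suc j then \<zero> else u i)"
  have ac: "a \<in> carrier L" using uc by (auto simp: a_def heisenberg_simps PiE_iff)
  have af: "a \<in> flag j" unfolding flag_def
  proof (intro CollectI conjI ballI impI ac)
    fix i assume "i \<in> {1..2 * n + 1}" "j < i"
    then show "a i = \<zero>" using u by (cases "i = Suc j") (auto simp: a_def flag_def)
  qed
  have ue: "u = a \<boxplus> u (Suc j) \<bullet> e (Suc j)"
    using uc ac e_closed j by (intro coord_eqI) (auto simp: coord_add coord_smult e_coord a_def)
  show "u \<in> ext (flag j) (e (Suc j))" by (subst ue) (rule ext_I[OF af coord[OF uc j]])
qed

lemma flag_indep: assumes "j < 2 * n + 1" shows "indep (flag j) (e (Suc j))"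
proof -
  have j: "Suc j \<in> {1..2 * n + 1}" using assms by simp
  have "r = \<zero>" if r: "r \<in> carrier R" "r \<bullet> e (Suc j) \<in> flag j" for r
  proof -
    have "(r \<bullet> e (Suc j)) (Suc j) = \<zero>" using r j by (auto simp: flag_def)
    then show ?thesis using r j by (simp add: coord_smult e_coord)
  qed
  then show ?thesis using e_closed by (auto simp: indep_def)
qed

lemma free_flag: "j \<le> 2 * n + 1 \<Longrightarrow> free j (flag j)"
proof (induct j)
  case (Suc j)
  then show ?case using flag_Suc[of j] flag_indep[of j] free_Suc by simp
qed (simp add: flag_0 free_0)

lemma flag_all: "flag (2 * n + 1) = carrier L"
  by (auto simp: flag_def)

abbreviation "V \<equiv> flag (2 * n)"

lemma VL: "u \<in> V \<Longrightarrow> u \<in> carrier L"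
  by (simp add: flag_def)

lemma form_e: assumes u: "u \<in> carrier L" and i: "i \<in> {1..n}"
  shows "form u (e (2 * i)) = u (2 * i - 1)" "form u (e (2 * i - 1)) = \<ominus> u (2 * i)"
proof -
  have r: "2 * l \<in> {1..2 * n + 1}" "2 * l - 1 \<in> {1..2 * n + 1}" if "l \<in> {1..n}" for l using that by auto
  have c: "u (2 * l - 1) \<in> carrier R" "u (2 * l) \<in> carrier R" if "l \<in> {1..n}" for l
    using coord[OF u r(1)[OF that]] coord[OF u r(2)[OF that]] by auto
  have "form u (e (2 * i)) = (\<Oplus>l\<in>{1..n}. if i = l then u (2 * l - 1) else \<zero>)"
    unfolding form_sum
  proof (rule R.finsum_cong')
    fix l assume l: "l \<in> {1..n}"
    have "2 * l - 1 \<noteq> 2 * i" using l by presburger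
    then show "u (2*l-1) \<otimes> e (2 * i) (2*l) \<ominus> u (2*l) \<otimes> e (2 * i) (2*l-1) = (if i = l then u (2 * l - 1) else \<zero>)"
      unfolding e_coord[OF r(1)[OF l]] e_coord[OF r(2)[OF l]] using c[OF l] by (auto simp: R.minus_eq)
  qed (use c in auto)
  also have "\<dots> = u (2 * i - 1)" using i c by (intro R.finsum_singleton) auto
  finally show "form u (e (2 * i)) = u (2 * i - 1)" .
  have "form u (e (2 * i - 1)) = (\<Oplus>l\<in>{1..n}. if i = l then \<ominus> u (2 * l) else \<zero>)"
    unfolding form_sum
  proof (rule R.finsum_cong')
    fix l assume l: "l \<in> {1..n}"
    have "2 * l \<noteq> 2 * i - 1" "2 * l - 1 = 2 * i - 1 \<longleftrightarrow> l = i" using l i by auto presburger+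
    then show "u (2*l-1) \<otimes> e (2 * i - 1) (2*l) \<ominus> u (2*l) \<otimes> e (2 * i - 1) (2*l-1) = (if i = l then \<ominus> u (2 * l) else \<zero>)"
      unfolding e_coord[OF r(1)[OF l]] e_coord[OF r(2)[OF l]] using c[OF l] by (auto simp: R.minus_eq)
  qed (use c in auto)
  also have "\<dots> = \<ominus> u (2 * i)" using i c by (intro R.finsum_singleton) auto
  finally show "form u (e (2 * i - 1)) = \<ominus> u (2 * i)" .
qed

lemma even_odd_index: assumes "k \<in> {1..2 * n}" obtains i where "i \<in> {1..n}" "k = 2 * i" | i where "i \<in> {1..n}" "k = 2 * i - 1"
proof (cases "even k")
  case True
  then obtain i where "k = 2 * i" by auto
  then show ?thesis using that(1)[of i] assms by auto
next
  case False
  then obtain i where "k = 2 * i + 1" by (auto elim: oddE)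
  then show ?thesis using that(2)[of "Suc i"] assms by auto
qed

lemma form_y: "u \<in> carrier L \<Longrightarrow> form (e (2 * n + 1)) u = \<zero>"
  unfolding form_sum
proof (rule R.add.finprod_one_eqI)
  fix l assume u: "u \<in> carrier L" and l: "l \<in> {1..n}"
  have r: "2 * l \<in> {1..2 * n + 1}" "2 * l - 1 \<in> {1..2 * n + 1}" "2 * l \<noteq> 2 * n + 1" "2 * l - 1 \<noteq> 2 * n + 1" using l by auto
  have c: "u (2 * l) \<in> carrier R" "u (2 * l - 1) \<in> carrier R" using u r by (auto simp del: One_nat_def)
  show "e (2 * n + 1) (2 * l - 1) \<otimes> u (2 * l) \<ominus> e (2 * n + 1) (2 * l) \<otimes> u (2 * l - 1) = \<zero>"
    unfolding e_coord[OF r(1)] e_coord[OF r(2)] using r c by (simp add: R.minus_eq)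
qed

lemma linear_on_flag_eq:
  assumes f: "linear_on V f" and g: "linear_on V g" and eq: "\<And>j. j \<in> {1..2 * n} \<Longrightarrow> f (e j) = g (e j)"
  shows "j \<le> 2 * n \<Longrightarrow> x \<in> flag j \<Longrightarrow> f x = g x"
proof (induct j arbitrary: x)
  case 0
  have z: "\<zero>\<^sub>M \<in> V" using subD(3)[OF free_sub[OF free_flag]] by simp
  have hz: "h \<zero>\<^sub>M = \<zero>" if "linear_on V h" for h
  proof -
    have "h (\<zero> \<bullet> \<zero>\<^sub>M) = \<zero> \<otimes> h \<zero>\<^sub>M" "h \<zero>\<^sub>M \<in> carrier R"
      using that z R.zero_closed unfolding linear_on_def by blast+
    then show ?thesis by simp
  qed
  then show ?case using 0 hz[OF f] hz[OF g] by (simp add: flag_0)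
next
  case (Suc j)
  have sub: "flag j \<subseteq> V" using Suc by (auto simp: flag_def)
  obtain a r where ar: "a \<in> flag j" "r \<in> carrier R" "x = a \<boxplus> r \<bullet> e (Suc j)"
    using Suc flag_Suc[of j] by (auto elim: ext_E)
  have ej: "e (Suc j) \<in> V" using Suc by (intro flag_e) auto
  have "r \<bullet> e (Suc j) \<in> V" using subD(7)[OF free_sub[OF free_flag] ar(2) ej] by simp
  then have hx: "h x = h a \<oplus> r \<otimes> h (e (Suc j))" if "linear_on V h" for h
    using that ar sub ej unfolding linear_on_def by auto
  have "f a = g a" "f (e (Suc j)) = g (e (Suc j))" using Suc ar eq[of "Suc j"] by auto
  then show ?case using hx[OF f] hx[OF g] by simp
qed

text \<open>
  On the standard symplectic lattice the form is unimodular: the values of \<open>form u\<close> on the basis are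
  the coordinates of \<open>u\<close> up to sign and order.
\<close>

lemma good_V: "good 0 n V"
proof -
  have fV: "free (2 * n) V" and sV: "sub V" using free_flag[of "2 * n"] free_sub by auto
  have last: "u (2 * n + 1) = \<zero>" if "u \<in> V" for u using that by (auto simp: flag_def)
  have level: "level 0 V" unfolding level_def using VL by auto
  have eV: "e (2 * i) \<in> V" "e (2 * i - 1) \<in> V" if "i \<in> {1..n}" for i using that by (auto intro!: flag_e)
  have rad_eq: "rad 0 V = scale p V"
  proof (intro equalityI subsetI)
    fix v assume "v \<in> scale p V"
    then obtain u where u: "u \<in> V" "v = p \<bullet> u" by (auto simp: scale_def)
    have "form v x \<in> P 1" if "x \<in> V" for x
      using u VL that P_I[of "form u x" 1] by (simp add: w_smult_l)
    then show "v \<in> rad 0 V" using u subD(7)[OF sV p_closed] by (simp add: orth_def)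
  next
    fix v assume v: "v \<in> rad 0 V"
    then have vV: "v \<in> V" and vP: "\<And>x. x \<in> V \<Longrightarrow> form v x \<in> P 1" by (auto simp: orth_def)
    have vk: "v k \<in> P 1" if k: "k \<in> {1..2 * n + 1}" for k
    proof (cases "k = 2 * n + 1")
      case True
      then show ?thesis using last[OF vV] by simp
    next
      case False
      then have "k \<in> {1..2 * n}" using k by auto
      then show ?thesis
      proof (cases rule: even_odd_index)
        case (1 i)
        have "\<ominus> v k \<in> P 1" using vP[OF eV(2)[OF 1(1)]] form_e(2)[OF VL[OF vV] 1(1)] 1(2) by simp
        then have "\<ominus> (\<ominus> v k) \<in> P 1" by (rule P_minus)
        then show ?thesis using coord[OF VL[OF vV] k] by simp
      next
        case (2 i)
        show ?thesis using vP[OF eV(1)[OF 2(1)]] form_e(1)[OF VL[OF vV] 2(1)] 2(2) by simp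
      qed
    qed
    have "\<exists>c. c \<in> carrier R \<and> v k = p \<otimes> c" if k: "k \<in> {1..2 * n + 1}" for k
      using vk[OF k] by (rule P_E) auto
    then obtain c where c: "\<And>k. k \<in> {1..2 * n + 1} \<Longrightarrow> c k \<in> carrier R \<and> v k = p \<otimes> c k" by metis
    define u where "u = (\<lambda>k\<in>{1..2 * n + 1}. c k)"
    have uL: "u \<in> carrier L" using c by (auto simp: u_def heisenberg_simps)
    have l: "2 * n + 1 \<in> {1..2 * n + 1}" by simp
    have "p \<otimes> c (2 * n + 1) = \<zero>" using c[OF l] last[OF vV] by simp
    then have "c (2 * n + 1) = \<zero>" using c[OF l] by (simp add: integral_iff)
    then have "c i = \<zero>" if "i \<in> {1..2 * n + 1}" "2 * n < i" for i
    proof -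
      have "i = 2 * n + 1" using that by auto
      then show ?thesis using \<open>c (2 * n + 1) = \<zero>\<close> by (simp only:)
    qed
    then have "u \<in> V" unfolding flag_def using uL by (simp add: u_def)
    moreover have "v = p \<bullet> u" using VL[OF vV] uL c by (intro coord_eqI) (auto simp: coord_smult u_def)
    ultimately show "v \<in> scale p V" by (auto simp: scale_def)
  qed
  have idx: "idx V (rad 0 V) = q ^ (2 * n)" unfolding rad_eq by (rule free_scale[OF fV])
  have nondeg: "u = \<zero>\<^sub>M" if u: "u \<in> V" "\<forall>x\<in>V. form u x = \<zero>" for u
  proof (rule coord_eqI)
    show "u \<in> carrier L" using u VL by auto
    fix k assume k: "k \<in> {1..2 * n + 1}"
    show "u k = \<zero>\<^sub>M k" unfolding coord_zero[OF k]
    proof (cases "k = 2 * n + 1")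
      case True
      then show "u k = \<zero>" using last[OF u(1)] by simp
    next
      case False
      then have "k \<in> {1..2 * n}" using k by auto
      then show "u k = \<zero>"
      proof (cases rule: even_odd_index)
        case (1 i)
        have "\<ominus> u k = \<zero>" using u(2) eV(2)[OF 1(1)] form_e(2)[OF VL[OF u(1)] 1(1)] 1(2) by simp
        then have "\<ominus> (\<ominus> u k) = \<zero>" by simp
        then show ?thesis using coord[OF VL[OF u(1)] k] by simp
      next
        case (2 i)
        show ?thesis using u(2) eV(1)[OF 2(1)] form_e(1)[OF VL[OF u(1)] 2(1)] 2(2) by simp
      qed
    qed
  qed simp
  have dual: "\<exists>u\<in>V. \<forall>x\<in>V. form u x = p [^] (0::nat) \<otimes> f x" if f: "linear_on V f" for f
  proof -
    have fc: "f x \<in> carrier R" if "x \<in> V" for x using f that by (auto simp: linear_on_def)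
    \<comment> \<open>the element whose pairings with the basis are the prescribed values of \<open>f\<close>\<close>
    define u where "u = (\<lambda>k\<in>{1..2 * n + 1}. if k = 2 * n + 1 then \<zero> else if even k then \<ominus> f (e (k - 1)) else f (e (k + 1)))"
    have eV': "e k \<in> V" if "k \<le> 2 * n" for k using that by (rule flag_e)
    have uk: "u k \<in> carrier R" if "k \<in> {1..2 * n + 1}" for k
    proof -
      have "odd k \<Longrightarrow> k \<noteq> 2 * n + 1 \<Longrightarrow> k + 1 \<le> 2 * n" using that by auto presburger
      then show ?thesis using that fc eV' unfolding u_def by auto
    qed
    have uL: "u \<in> carrier L" using uk by (auto simp: heisenberg_simps PiE_iff u_def)
    have uV: "u \<in> V" unfolding flag_def using uL by (auto simp: u_def)
    have "linear_on V (form u)" unfolding linear_on_def using uL VL by (auto simp: w_add_r w_smult_r)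
    moreover have "form u (e j) = f (e j)" if j: "j \<in> {1..2 * n}" for j
      using j
    proof (cases rule: even_odd_index)
      case (1 i)
      have "u (2 * i - 1) = f (e (2 * i))" using 1 unfolding u_def by auto
      then show ?thesis using form_e(1)[OF uL 1(1)] 1(2) by simp
    next
      case (2 i)
      have "u (2 * i) = \<ominus> f (e (2 * i - 1))" using 2 unfolding u_def by auto
      then show ?thesis using form_e(2)[OF uL 2(1)] 2(2) fc[OF eV(2)[OF 2(1)]] by simp
    qed
    ultimately have "form u x = f x" if "x \<in> V" for x using linear_on_flag_eq[OF _ f, of "form u" "2 * n"] that by blast
    then show ?thesis using uV fc by (intro bexI[of _ u]) auto
  qed
  show ?thesis unfolding good_def using fV level idx nondeg dual by blast
qed

lemma zeta_count:
  "of_nat (card (subalgebras_of_index R L (q ^ i))) = (\<Sum>k\<le>i. (of_nat q :: rat) ^ (2 * n * k) * fps_nth (level_series q n k n) (i - k))"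
proof -
  let ?y = "e (2 * n + 1)"
  have Vy: "indep V ?y" and all: "carrier L = ext V ?y"
    using flag_indep[of "2 * n"] flag_Suc[of "2 * n"] flag_all by simp_all
  have eq: "central_subs ?y i = subalgebras_of_index R L (q ^ i)"
  proof -
    have "card (a_rcosets\<^bsub>L\<^esub> H) = idx (carrier L) H" for H
      unfolding idx_def A_RCOSETS_def' by (rule arg_cong[of _ _ card]) auto
    moreover have "u \<otimes>\<^bsub>L\<^esub> v \<in> H \<longleftrightarrow> form u v \<bullet> ?y \<in> H" if "sub H" "u \<in> H" "v \<in> H" for u v H
      using bracket_form[of u v] subD(2)[OF that(1)] that by auto
    moreover have "central_subs ?y i = {H. sub H \<and> (\<forall>u\<in>H. \<forall>v\<in>H. form u v \<bullet> ?y \<in> H) \<and> idx (carrier L) H = q ^ i}"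
      by (rule central_subs_def[OF good_V Vy all form_y])
    ultimately show ?thesis unfolding subalgebras_of_index_def lie_subalgebra_def by auto
  qed
  show ?thesis using card_central_subs[OF good_V Vy all form_y, of i] unfolding eq .
qed

end

theorem theorem2:
  fixes R :: "('a, 'm) ring_scheme" (structure) and n :: nat and q T :: "rat fps"
  assumes "compact_dvr R"
    and "n \<ge> 1"
    and q: "q = of_nat (card (carrier (residue_field R)))"
    and T: "T = fps_X"
  shows "zeta_fps R (heisenberg R n) =
    (\<Sum>r=0..n.
       1 / (1 - q ^ (2*n + r * (2*n + 1 - r) div 2) * T ^ (n + 1)) *
       ((- q) ^ r * (1 - q ^ (2*n - 2*r + 1)) * qpochhammer (q^2) (q^2) n /
        (qpochhammer q q (2*n - r + 1) * qpochhammer q q r *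
         qpochhammer (q ^ r * T) (q^2) (n - r) * qpochhammer (q ^ (2*n - r) * T) q r)))"
proof -
  interpret compact_dvr R by fact
  have M: "module R (heisenberg R n)" by (rule heisenberg_module)
  have tf: "r = \<zero> \<or> x = \<zero>\<^bsub>heisenberg R n\<^esub>"
    if r: "r \<in> carrier R" and x: "x \<in> carrier (heisenberg R n)" and eq: "r \<odot>\<^bsub>heisenberg R n\<^esub> x = \<zero>\<^bsub>heisenberg R n\<^esub>" for r x
  proof (cases "r = \<zero>")
    case False
    have "x k = \<zero>" if k: "k \<in> {1..2*n+1}" for k
    proof -
      have "r \<otimes> x k = \<zero>" using fun_cong[OF eq, of k] k by (simp add: heisenberg_simps)
      moreover have "x k \<in> carrier R" using x k by (auto simp: heisenberg_simps PiE_iff)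
      ultimately show ?thesis using False r by (simp add: integral_iff)
    qed
    then have "x = \<zero>\<^bsub>heisenberg R n\<^esub>" using x by (auto simp: heisenberg_simps intro!: PiE_ext[of x "{1..2*n+1}" "\<lambda>_. carrier R"])
    then show ?thesis by simp
  qed simp
  obtain p S where D: "dvr_lattice R (heisenberg R n) p S" and S: "card S = card (carrier (residue_field R))"
    using dvr_lattice_exists[OF M tf] by blast
  interpret heis R n p S by (rule heis.intro[OF D])
  have "zeta_fps R (heisenberg R n) = Abs_fps (\<lambda>i. \<Sum>k\<le>i. (of_nat (card S) :: rat) ^ (2 * n * k) * fps_nth (level_series (card S) n k n) (i - k))"
    unfolding zeta_fps_def S[symmetric] zeta_count ..
  moreover have "q = fps_const (of_nat (card S))" unfolding q S by (simp add: fps_of_nat)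
  ultimately show ?thesis unfolding T using generating_function[OF q_ge_2 refl assms(2)] by simp
qed

end
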